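(* Let $\mathbb F$ be a field and let $G=K_0\ge K_1\ge K_2\ge\cdots$ be a chain of normal subgroups of a group $G$ with $\bigcap_i K_i=1$, such that each $Q_i=K_i/K_{i+1}$ is orderable and amenable, and suppose that a Linnell skew field $D_{\mathbb F G}$ over $\mathbb F G$ exists. Define inductively $R_i^i=\mathbb F K_i$ and, for $0\le j<i$, $R_i^j=R_i^{j+1}**Q_j$, a subring of $D_{\mathbb F K_j}$. Then $\mathbb F G=R_0^0\subseteq R_1^0\subseteq R_2^0\subseteq\cdots$ is an increasing sequence of subrings of $D_{\mathbb F G}$, and $$\bigcup_{i=0}^\infty R_i^0=D_{\mathbb F G}.$$
   Context: An order on a group is a strict total order invariant under left and right multiplication; a group is orderable if it admits one. Crossed products. A crossed product $R*Q$ of a ring $R$ and a group $Q$ is a ring $S=\bigoplus_{q\in Q}R_q$ (as abelian groups) with $R_qR_{q'}\subseteq R_{qq'}$, $R_1=R$, and each $R_q$ containing a unit of $S$. Choosing units $s_q\in R_q$ with $s_1=1$, elements are uniquely finite sums $\sum r_q s_q$ (also written $\sum r_q q$), and $rq\cdot r'q'=r\,\tau(q)(r')\,\mu(q,q')\,qq'$, where $\tau(q)\in\operatorname{Aut}(R)$ is conjugation by $s_q$ and $\mu(q,q')=s_qs_{q'}s_{qq'}^{-1}\in R^\times$. For an order $<$ on $Q$, the Malcev--Neumann crossed product $R*_<Q$ is the ring of functions $Q\to R$ with well-ordered support (formal series $\sum r_q q$), with pointwise addition and the convolution product given by the same formula. For $K$ normal in $G$ and $Q=G/K$, the group ring is $\mathbb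 F G=\mathbb F K*Q$. Linnell skew fields. A skew field $D\supseteq\mathbb F G$ is Linnell if no proper skew subfield of $D$ contains $\mathbb F G$ and, for every subgroup $K\le G$, $g_1,\dots,g_n\in G$ in pairwise different cosets $Kg$, and nonzero $d_1,\dots,d_n$ in the division closure of $\mathbb F K$ in $D$ (the smallest skew subfield containing $\mathbb F K$), one has $\sum d_ig_i\ne0$. For $G$ locally indicable (every nontrivial finitely generated subgroup surjects onto $\mathbb Z$; this holds for the $G$ in the claim) such $D$, if it exists, is unique up to isomorphism fixing $\mathbb F G$ and is denoted $D_{\mathbb F G}$. Then for $K\le G$ the division closure of $\mathbb F K$ in $D_{\mathbb F G}$ is $D_{\mathbb F K}$, and automorphisms of $K$ extend uniquely to $D_{\mathbb F K}$. Invariant Malcev--Neumann rings. Let $\mathcal G$ be a locally indicable group such that $D_{\mathbb F\mathcal G}$ exists, and let $K\le G$ be normal subgroups of $\mathcal G$ with $Q=G/K$ orderable and amenable. For every order $<$ on $Q$, extending the structure maps of $\mathbb F G=\mathbb F K*Q$ gives a skew field $D_{\mathbb F K}*_<Q$, and $D_{\mathbb F G}$ is identified with the division closure of $\mathbb F G$ in it. Let $R$ be a ring with $\mathbb F K\subseteq R\subseteq D_{\mathbb F K}$ that is invariant under the conjugation action of $\mathcal G$ on $D_{\mathbb F K}$. Then $$R**Q:=\bigcap_{<}\big((R*_<Q)\cap D_{\mathbb F G}\big)\subseteq D_{\mathbb F G},$$ over all orders $<$ on $Q$, i.e. the elements of $D_{\mathbb F G}$ which for every order on $Q$ are represented by a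 Malcev--Neumann series with coefficients in $R$. It contains $\mathbb F G$ and is again $\mathcal G$-invariant, so the construction can be iterated. In the claim it is applied with ambient group $\mathcal G=G$ and the pairs $K_{j+1}\le K_j$. *)

theory Defs
  imports Complex_Main "HOL-Library.FuncSet" "HOL-Algebra.Algebra"
begin

definition group_order :: "('q, 'n) monoid_scheme \<Rightarrow> ('q \<Rightarrow> 'q \<Rightarrow> bool) \<Rightarrow> bool" where
  "group_order Q lt \<longleftrightarrow>
     irreflp_on (carrier Q) lt \<and> transp_on (carrier Q) lt \<and> totalp_on (carrier Q) lt \<and>
     (\<forall>x\<in>carrier Q. \<forall>y\<in>carrier Q. \<forall>z\<in>carrier Q. lt x y \<longrightarrow>
        lt (z \<otimes>\<^bsub>Q\<^esub> x) (z \<otimes>\<^bsub>Q\<^esub> y) \<and> lt (x \<otimes>\<^bsub>Q\<^esub> z) (y \<otimes>\<^bsub>Q\<^esub> z))"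

definition orderable :: "('q, 'n) monoid_scheme \<Rightarrow> bool" where
  "orderable Q \<longleftrightarrow> (\<exists>lt. group_order Q lt)"

text \<open>Amenability of a discrete group: there is a left-invariant finitely additive probability
  measure defined on all subsets.\<close>

definition amenable :: "('q, 'n) monoid_scheme \<Rightarrow> bool" where
  "amenable Q \<longleftrightarrow>
     (\<exists>m :: 'q set \<Rightarrow> real.
        (\<forall>A. A \<subseteq> carrier Q \<longrightarrow> 0 \<le> m A) \<and>
        m (carrier Q) = 1 \<and>
        (\<forall>A B. A \<subseteq> carrier Q \<longrightarrow> B \<subseteq> carrier Q \<longrightarrow> A \<inter> B = {} \<longrightarrow> m (A \<union> B) = m A + m B) \<and>
        (\<forall>g\<in>carrier Q. \<forall>A. A \<subseteq> carrier Q \<longrightarrow> m (g <#\<^bsub>Q\<^esub> A) = m A))"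

locale skew_field = ring +
  assumes skew_field_Units: "Units R = carrier R - {\<zero>}"

definition skew_subfield :: "'d set \<Rightarrow> ('d, 'm) ring_scheme \<Rightarrow> bool" where
  "skew_subfield L D \<longleftrightarrow> subring L D \<and> (\<forall>x\<in>L - {\<zero>\<^bsub>D\<^esub>}. inv\<^bsub>D\<^esub> x \<in> L)"

definition division_closure :: "('d, 'm) ring_scheme \<Rightarrow> 'd set \<Rightarrow> 'd set" where
  "division_closure D A = \<Inter>{L. skew_subfield L D \<and> A \<subseteq> L}"

definition group_ring ::
    "('f, 'm) ring_scheme \<Rightarrow> ('g, 'n) monoid_scheme \<Rightarrow> ('g \<Rightarrow> 'f) ring" where
  "group_ring F G =
     \<lparr>carrier = {a \<in> carrier G \<rightarrow>\<^sub>E carrier F. finite {g \<in> carrier G. a g \<noteq> \<zero>\<^bsub>F\<^esub>}},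
      monoid.mult = (\<lambda>a b. \<lambda>g\<in>carrier G.
        (\<Oplus>\<^bsub>F\<^esub>p\<in>{(x, y). x \<in> carrier G \<and> y \<in> carrier G \<and> a x \<noteq> \<zero>\<^bsub>F\<^esub> \<and> b y \<noteq> \<zero>\<^bsub>F\<^esub> \<and>
                          x \<otimes>\<^bsub>G\<^esub> y = g}.
           a (fst p) \<otimes>\<^bsub>F\<^esub> b (snd p))),
      one = (\<lambda>g\<in>carrier G. if g = \<one>\<^bsub>G\<^esub> then \<one>\<^bsub>F\<^esub> else \<zero>\<^bsub>F\<^esub>),
      ring.zero = (\<lambda>g\<in>carrier G. \<zero>\<^bsub>F\<^esub>),
      add = (\<lambda>a b. \<lambda>g\<in>carrier G. a g \<oplus>\<^bsub>F\<^esub> b g)\<rparr>"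

definition group_elem ::
    "('f, 'm) ring_scheme \<Rightarrow> ('g, 'n) monoid_scheme \<Rightarrow> 'g \<Rightarrow> 'g \<Rightarrow> 'f" where
  "group_elem F G g = (\<lambda>x\<in>carrier G. if x = g then \<one>\<^bsub>F\<^esub> else \<zero>\<^bsub>F\<^esub>)"

definition group_ring_part ::
    "('f, 'm) ring_scheme \<Rightarrow> ('g, 'n) monoid_scheme \<Rightarrow> 'g set \<Rightarrow> ('g \<Rightarrow> 'f) \<Rightarrow> 'g \<Rightarrow> 'f" where
  "group_ring_part F G A a = (\<lambda>x\<in>carrier G. if x \<in> A then a x else \<zero>\<^bsub>F\<^esub>)"

definition group_subring ::
    "('f, 'm) ring_scheme \<Rightarrow> ('g, 'n) monoid_scheme \<Rightarrow> 'g set \<Rightarrow> ('g \<Rightarrow> 'f) set" where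
  "group_subring F G K = {a \<in> carrier (group_ring F G). \<forall>g\<in>carrier G - K. a g = \<zero>\<^bsub>F\<^esub>}"

text \<open>The inclusion of the group ring into \<open>D\<close> is an injective ring
  homomorphism \<open>\<iota>\<close>.\<close>

definition sub_division_ring ::
    "('f, 'm) ring_scheme \<Rightarrow> ('g, 'n) monoid_scheme \<Rightarrow> ('d, 'k) ring_scheme \<Rightarrow>
     (('g \<Rightarrow> 'f) \<Rightarrow> 'd) \<Rightarrow> 'g set \<Rightarrow> 'd set" where
  "sub_division_ring F G D \<iota> K = division_closure D (\<iota> ` group_subring F G K)"

definition linnell_skew_field ::
    "('f, 'm) ring_scheme \<Rightarrow> ('g, 'n) monoid_scheme \<Rightarrow> ('d, 'k) ring_scheme \<Rightarrow>
     (('g \<Rightarrow> 'f) \<Rightarrow> 'd) \<Rightarrow> bool" where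
  "linnell_skew_field F G D \<iota> \<longleftrightarrow>
     skew_field D \<and>
     \<iota> \<in> ring_hom (group_ring F G) D \<and> inj_on \<iota> (carrier (group_ring F G)) \<and>
     division_closure D (\<iota> ` carrier (group_ring F G)) = carrier D \<and>
     (\<forall>K (n :: nat) g d. subgroup K G \<longrightarrow> n \<ge> 1 \<longrightarrow>
        g \<in> {1..n} \<rightarrow> carrier G \<longrightarrow> inj_on (\<lambda>i. K #>\<^bsub>G\<^esub> g i) {1..n} \<longrightarrow>
        d \<in> {1..n} \<rightarrow> sub_division_ring F G D \<iota> K - {\<zero>\<^bsub>D\<^esub>} \<longrightarrow>
        (\<Oplus>\<^bsub>D\<^esub>i\<in>{1..n}. d i \<otimes>\<^bsub>D\<^esub> \<iota> (group_elem F G (g i))) \<noteq> \<zero>\<^bsub>D\<^esub>)"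

text \<open>The series \<open>\<Sum> r\<^sub>q q\<close> is the function \<open>q \<mapsto> r\<^sub>q\<close>; since
  \<open>lt\<close> is total on \<open>Q\<close>, well-foundedness on the support says that the support is well-ordered.\<close>

definition malcev_neumann ::
    "('r, 'm) ring_scheme \<Rightarrow> ('q, 'n) monoid_scheme \<Rightarrow> ('q \<Rightarrow> 'r \<Rightarrow> 'r) \<Rightarrow> ('q \<Rightarrow> 'q \<Rightarrow> 'r) \<Rightarrow>
     ('q \<Rightarrow> 'q \<Rightarrow> bool) \<Rightarrow> ('q \<Rightarrow> 'r) ring" where
  "malcev_neumann R Q \<tau> \<mu> lt =
     \<lparr>carrier = {f \<in> carrier Q \<rightarrow>\<^sub>E carrier R. wfp_on {q \<in> carrier Q. f q \<noteq> \<zero>\<^bsub>R\<^esub>} lt},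
      monoid.mult = (\<lambda>f h. \<lambda>q\<in>carrier Q.
        (\<Oplus>\<^bsub>R\<^esub>p\<in>{(x, y). x \<in> carrier Q \<and> y \<in> carrier Q \<and> f x \<noteq> \<zero>\<^bsub>R\<^esub> \<and> h y \<noteq> \<zero>\<^bsub>R\<^esub> \<and>
                          x \<otimes>\<^bsub>Q\<^esub> y = q}.
           f (fst p) \<otimes>\<^bsub>R\<^esub> \<tau> (fst p) (h (snd p)) \<otimes>\<^bsub>R\<^esub> \<mu> (fst p) (snd p))),
      one = (\<lambda>q\<in>carrier Q. if q = \<one>\<^bsub>Q\<^esub> then \<one>\<^bsub>R\<^esub> else \<zero>\<^bsub>R\<^esub>),
      ring.zero = (\<lambda>q\<in>carrier Q. \<zero>\<^bsub>R\<^esub>),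
      add = (\<lambda>f h. \<lambda>q\<in>carrier Q. f q \<oplus>\<^bsub>R\<^esub> h q)\<rparr>"

abbreviation quotient_group ::
    "('g, 'n) monoid_scheme \<Rightarrow> 'g set \<Rightarrow> 'g set \<Rightarrow> 'g set monoid" where
  "quotient_group G H K \<equiv> (G\<lparr>carrier := H\<rparr>) Mod K"

text \<open>A choice of units \<open>s\<^sub>q\<close>, taken among the group elements, with \<open>s\<^sub>1 = 1\<close>. Another choice
  multiplies the coefficients of a series by elements of \<open>K\<close>, so it does not affect whether they
  lie in a given ring containing the group ring of \<open>K\<close>.\<close>

definition coset_rep :: "('g, 'n) monoid_scheme \<Rightarrow> 'g set \<Rightarrow> 'g set \<Rightarrow> 'g set \<Rightarrow> 'g" where
  "coset_rep G H K =
     (SOME s. (\<forall>q\<in>carrier (quotient_group G H K). s q \<in> q) \<and>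
        s \<one>\<^bsub>quotient_group G H K\<^esub> = \<one>\<^bsub>G\<^esub>)"

definition coset_unit ::
    "('f, 'm) ring_scheme \<Rightarrow> ('g, 'n) monoid_scheme \<Rightarrow> (('g \<Rightarrow> 'f) \<Rightarrow> 'd) \<Rightarrow>
     'g set \<Rightarrow> 'g set \<Rightarrow> 'g set \<Rightarrow> 'd" where
  "coset_unit F G \<iota> H K q = \<iota> (group_elem F G (coset_rep G H K q))"

definition coset_action ::
    "('f, 'm) ring_scheme \<Rightarrow> ('g, 'n) monoid_scheme \<Rightarrow> ('d, 'k) ring_scheme \<Rightarrow>
     (('g \<Rightarrow> 'f) \<Rightarrow> 'd) \<Rightarrow> 'g set \<Rightarrow> 'g set \<Rightarrow> 'g set \<Rightarrow> 'd \<Rightarrow> 'd" where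
  "coset_action F G D \<iota> H K q r =
     coset_unit F G \<iota> H K q \<otimes>\<^bsub>D\<^esub> r \<otimes>\<^bsub>D\<^esub> inv\<^bsub>D\<^esub> (coset_unit F G \<iota> H K q)"

definition coset_cocycle ::
    "('f, 'm) ring_scheme \<Rightarrow> ('g, 'n) monoid_scheme \<Rightarrow> ('d, 'k) ring_scheme \<Rightarrow>
     (('g \<Rightarrow> 'f) \<Rightarrow> 'd) \<Rightarrow> 'g set \<Rightarrow> 'g set \<Rightarrow> 'g set \<Rightarrow> 'g set \<Rightarrow> 'd" where
  "coset_cocycle F G D \<iota> H K q q' =
     coset_unit F G \<iota> H K q \<otimes>\<^bsub>D\<^esub> coset_unit F G \<iota> H K q' \<otimes>\<^bsub>D\<^esub>
       inv\<^bsub>D\<^esub> (coset_unit F G \<iota> H K (q \<otimes>\<^bsub>quotient_group G H K\<^esub> q'))"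

text \<open>The ring of Malcev--Neumann series over \<open>H/K\<close> with coefficients in a subring \<open>R\<close> of \<open>D\<close>.\<close>

definition coset_series ::
    "('f, 'm) ring_scheme \<Rightarrow> ('g, 'n) monoid_scheme \<Rightarrow> ('d, 'k) ring_scheme \<Rightarrow>
     (('g \<Rightarrow> 'f) \<Rightarrow> 'd) \<Rightarrow> 'g set \<Rightarrow> 'g set \<Rightarrow> 'd set \<Rightarrow> ('g set \<Rightarrow> 'g set \<Rightarrow> bool) \<Rightarrow>
     ('g set \<Rightarrow> 'd) ring" where
  "coset_series F G D \<iota> H K R lt =
     malcev_neumann (D\<lparr>carrier := R\<rparr>) (quotient_group G H K)
       (coset_action F G D \<iota> H K) (coset_cocycle F G D \<iota> H K) lt"

text \<open>The decomposition of an element of the group ring of \<open>H\<close> as a finite sum \<open>\<Sum> r\<^sub>q s\<^sub>q\<close> with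
  \<open>r\<^sub>q\<close> in the group ring of \<open>K\<close>.\<close>

definition group_ring_series ::
    "('f, 'm) ring_scheme \<Rightarrow> ('g, 'n) monoid_scheme \<Rightarrow> ('d, 'k) ring_scheme \<Rightarrow>
     (('g \<Rightarrow> 'f) \<Rightarrow> 'd) \<Rightarrow> 'g set \<Rightarrow> 'g set \<Rightarrow> ('g \<Rightarrow> 'f) \<Rightarrow> 'g set \<Rightarrow> 'd" where
  "group_ring_series F G D \<iota> H K a =
     (\<lambda>q\<in>carrier (quotient_group G H K).
        \<iota> (group_ring_part F G q a) \<otimes>\<^bsub>D\<^esub> inv\<^bsub>D\<^esub> (coset_unit F G \<iota> H K q))"

text \<open>The identification of the division closure of the group ring of \<open>H\<close> with a skew subfield of
  the Malcev--Neumann skew field. Any two such \<open>\<phi>\<close> agree on that division closure, because they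
  agree on the group ring.\<close>

definition series_embedding ::
    "('f, 'm) ring_scheme \<Rightarrow> ('g, 'n) monoid_scheme \<Rightarrow> ('d, 'k) ring_scheme \<Rightarrow>
     (('g \<Rightarrow> 'f) \<Rightarrow> 'd) \<Rightarrow> 'g set \<Rightarrow> 'g set \<Rightarrow> ('g set \<Rightarrow> 'g set \<Rightarrow> bool) \<Rightarrow>
     ('d \<Rightarrow> 'g set \<Rightarrow> 'd) \<Rightarrow> bool" where
  "series_embedding F G D \<iota> H K lt \<phi> \<longleftrightarrow>
     \<phi> \<in> ring_hom (D\<lparr>carrier := sub_division_ring F G D \<iota> H\<rparr>)
           (coset_series F G D \<iota> H K (sub_division_ring F G D \<iota> K) lt) \<and>
     (\<forall>a\<in>group_subring F G H. \<phi> (\<iota> a) = group_ring_series F G D \<iota> H K a)"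

text \<open>The ring \<open>R ** (H/K)\<close>.\<close>

definition invariant_series ::
    "('f, 'm) ring_scheme \<Rightarrow> ('g, 'n) monoid_scheme \<Rightarrow> ('d, 'k) ring_scheme \<Rightarrow>
     (('g \<Rightarrow> 'f) \<Rightarrow> 'd) \<Rightarrow> 'g set \<Rightarrow> 'g set \<Rightarrow> 'd set \<Rightarrow> 'd set" where
  "invariant_series F G D \<iota> H K R =
     {x \<in> sub_division_ring F G D \<iota> H.
        \<forall>lt. group_order (quotient_group G H K) lt \<longrightarrow>
          (\<exists>\<phi>. series_embedding F G D \<iota> H K lt \<phi> \<and>
               \<phi> x \<in> carrier (coset_series F G D \<iota> H K R lt))}"

text \<open>\<open>tower_aux F G D \<iota> K n j\<close> is \<open>R\<^sub>i\<close> with upper index \<open>j\<close>, where \<open>i = j + n\<close>; the recursion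
  increases \<open>j\<close> and keeps \<open>i\<close> fixed.\<close>

primrec tower_aux ::
    "('f, 'm) ring_scheme \<Rightarrow> ('g, 'n) monoid_scheme \<Rightarrow> ('d, 'k) ring_scheme \<Rightarrow>
     (('g \<Rightarrow> 'f) \<Rightarrow> 'd) \<Rightarrow> (nat \<Rightarrow> 'g set) \<Rightarrow> nat \<Rightarrow> nat \<Rightarrow> 'd set" where
  "tower_aux F G D \<iota> K 0 = (\<lambda>j. \<iota> ` group_subring F G (K j))"
| "tower_aux F G D \<iota> K (Suc n) =
     (\<lambda>j. invariant_series F G D \<iota> (K j) (K (Suc j)) (tower_aux F G D \<iota> K n (Suc j)))"

text \<open>Only meaningful for \<open>j \<le> i\<close>.\<close>

definition tower ::
    "('f, 'm) ring_scheme \<Rightarrow> ('g, 'n) monoid_scheme \<Rightarrow> ('d, 'k) ring_scheme \<Rightarrow>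
     (('g \<Rightarrow> 'f) \<Rightarrow> 'd) \<Rightarrow> (nat \<Rightarrow> 'g set) \<Rightarrow> nat \<Rightarrow> nat \<Rightarrow> 'd set" where
  "tower F G D \<iota> K i j = tower_aux F G D \<iota> K (i - j) j"

lemma tower_diag: "tower F G D \<iota> K i i = \<iota> ` group_subring F G (K i)"
  by (simp add: tower_def)

lemma tower_step:
  "j < i \<Longrightarrow> tower F G D \<iota> K i j =
     invariant_series F G D \<iota> (K j) (K (Suc j)) (tower F G D \<iota> K i (Suc j))"
  by (simp add: tower_def Suc_diff_Suc[symmetric])

end

theory Submission
  imports Defs
begin

text \<open>Writing a Malcev--Neumann series as the function that sends \<open>q\<close> to the term \<open>r\<^sub>q s\<^sub>q\<close> in \<open>D\<close> removes
  action and cocycle from the product, so all series live in one ring of functions with well-ordered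
  support under convolution, and coefficient rings become gradings. Such series are inverted by long
  division.

  Since \<open>Q = H/K\<close> is amenable, the crossed product of \<open>D\<^bsub>K\<^esub>\<close> and \<open>Q\<close> inside \<open>D\<close> is a right Ore domain;
  hence every element of \<open>D\<^bsub>H\<^esub>\<close> is a fraction \<open>a b\<^sup>-\<^sup>1\<close> of finite sums, and expanding fractions embeds \<open>D\<^bsub>H\<^esub>\<close>
  into the series for every order on \<open>Q\<close>. The leading term of the expansion is the quotient of the
  leading terms of \<open>a\<close> and \<open>b\<close>, so it takes only finitely many values as the order varies.

  It remains to invert a nonzero \<open>x\<close> in \<open>R\<^sub>i\<^sup>j\<close> inside some \<open>R\<^bsub>i'\<^esub>\<^sup>j\<close>. By induction each of the finitely many
  leading coefficients is inverted in a later \<open>R\<^bsub>i'\<^esub>\<^bsup>j+1\<^esup>\<close>, and the largest of these \<open>i'\<close> serves for all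
  orders. At \<open>j = i\<close> the element \<open>x\<close> lies in the group ring of \<open>K\<^sub>i\<close>, and one takes \<open>i'\<close> so large that
  distinct elements of the support of \<open>x\<close> are distinct modulo \<open>K\<^bsub>i'\<^esub>\<close>; passing to leading coefficients
  down to level \<open>i'\<close> then leaves a single term.\<close>

section \<open>Well-ordered subsets of ordered groups\<close>

text \<open>The division closure of the group ring of \<open>H\<close> is known only as an
  intersection of skew subfields, so its elements have no usable form until the right fractions are
  seen to form a skew subfield. This gives the existence of the embedding into the series that
  \<open>invariant_series\<close> demands and, through the expansions, its uniqueness. The obstacle
  to inverting is that \<open>Q\<close> may have infinitely many orders: a union over
  \<open>i'\<close> does not commute with an infinite intersection, so indices found order by order
  would be useless. Fixing one fraction of \<open>x\<close> before any order is chosen is what makes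
  the set of leading terms finite. Long division introduces no inverse except that of the leading
  coefficient, hence stays inside any invariant coefficient ring that contains this one inverse and
  the given coefficients. It also replaces the customary geometric series, which needs the
  well-ordering of all finite products from a well-ordered positive set; here products of two
  well-ordered sets suffice. The intersection over all orders matters for the iteration: conjugation
  by \<open>G\<close> need not preserve an order on \<open>Q\<close>, and only the whole family of
  orders is stable.\<close>

locale ordered_group = group Q for Q (structure) +
  fixes lt :: "'a \<Rightarrow> 'a \<Rightarrow> bool" (infix "\<sqsubset>" 50)
  assumes group_order: "group_order Q lt"
begin

lemma lt_irrefl: "x \<in> carrier Q \<Longrightarrow> \<not> x \<sqsubset> x"
  using group_order by (auto simp: group_order_def irreflp_on_def)

lemma lt_trans:
  "x \<sqsubset> y \<Longrightarrow> y \<sqsubset> z \<Longrightarrow> x \<in> carrier Q \<Longrightarrow> y \<in> carrier Q \<Longrightarrow> z \<in> carrier Q \<Longrightarrow> x \<sqsubset> z"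
  using group_order unfolding group_order_def transp_on_def by blast

lemma lt_total: "x \<in> carrier Q \<Longrightarrow> y \<in> carrier Q \<Longrightarrow> x \<noteq> y \<Longrightarrow> x \<sqsubset> y \<or> y \<sqsubset> x"
  using group_order unfolding group_order_def totalp_on_def by blast

lemma lt_asym: "x \<sqsubset> y \<Longrightarrow> x \<in> carrier Q \<Longrightarrow> y \<in> carrier Q \<Longrightarrow> \<not> y \<sqsubset> x"
  using lt_trans lt_irrefl by blast

lemma lt_mult_left:
  "x \<sqsubset> y \<Longrightarrow> x \<in> carrier Q \<Longrightarrow> y \<in> carrier Q \<Longrightarrow> z \<in> carrier Q \<Longrightarrow> z \<otimes> x \<sqsubset> z \<otimes> y"
  using group_order unfolding group_order_def by blast

lemma lt_mult_right:
  "x \<sqsubset> y \<Longrightarrow> x \<in> carrier Q \<Longrightarrow> y \<in> carrier Q \<Longrightarrow> z \<in> carrier Q \<Longrightarrow> x \<otimes> z \<sqsubset> y \<otimes> z"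
  using group_order unfolding group_order_def by blast

lemma lt_mult_left_iff:
  assumes "x \<in> carrier Q" "y \<in> carrier Q" "z \<in> carrier Q"
  shows "z \<otimes> x \<sqsubset> z \<otimes> y \<longleftrightarrow> x \<sqsubset> y"
  by (metis assms lt_asym lt_irrefl lt_mult_left lt_total m_closed)

definition well_ordered :: "'a set \<Rightarrow> bool" where
  "well_ordered A \<longleftrightarrow> A \<subseteq> carrier Q \<and> wfp_on A lt"

lemma well_orderedD: "well_ordered A \<Longrightarrow> A \<subseteq> carrier Q"
  by (simp add: well_ordered_def)

lemma well_ordered_subset: "well_ordered A \<Longrightarrow> B \<subseteq> A \<Longrightarrow> well_ordered B"
  by (auto simp: well_ordered_def intro: wfp_on_subset)

lemma well_orderedE:
  assumes "well_ordered A" "B \<subseteq> A" "B \<noteq> {}"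
  obtains m where "m \<in> B" "\<And>x. x \<in> B \<Longrightarrow> x \<noteq> m \<Longrightarrow> m \<sqsubset> x"
proof -
  from assms obtain m where m: "m \<in> B" "\<forall>y. y \<sqsubset> m \<longrightarrow> y \<notin> B"
    unfolding well_ordered_def wfp_on_iff_ex_minimal by meson
  moreover have "B \<subseteq> carrier Q"
    using assms by (auto simp: well_ordered_def)
  ultimately show thesis
    using lt_total that by blast
qed

lemma well_orderedI:
  assumes "A \<subseteq> carrier Q"
    and "\<And>B. B \<subseteq> A \<Longrightarrow> B \<noteq> {} \<Longrightarrow> \<exists>m\<in>B. \<forall>x\<in>B. \<not> x \<sqsubset> m"
  shows "well_ordered A"
  using assms unfolding well_ordered_def wfp_on_iff_ex_minimal by meson

lemma well_ordered_empty: "well_ordered {}"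
  by (rule well_orderedI) auto

lemma well_ordered_Un:
  assumes A: "well_ordered A" and B: "well_ordered B"
  shows "well_ordered (A \<union> B)"
proof (rule well_orderedI)
  show sub: "A \<union> B \<subseteq> carrier Q"
    using assms by (simp add: well_ordered_def)
  fix C assume C: "C \<subseteq> A \<union> B" "C \<noteq> {}"
  have car: "x \<in> carrier Q" if "x \<in> C" for x
    using that C sub by blast
  have min_in: "\<exists>m\<in>C \<inter> Y. \<forall>x\<in>C \<inter> Y. x \<noteq> m \<longrightarrow> m \<sqsubset> x"
    if "well_ordered Y" "C \<inter> Y \<noteq> {}" for Y
    using well_orderedE[OF that(1) _ that(2)] by (metis Int_lower2)
  show "\<exists>m\<in>C. \<forall>x\<in>C. \<not> x \<sqsubset> m"
  proof (cases "C \<inter> A = {} \<or> C \<inter> B = {}")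
    case True
    then obtain Y where Y: "well_ordered Y" "C \<inter> Y = C" using C A B by blast
    then obtain m where m: "m \<in> C" "\<forall>x\<in>C. x \<noteq> m \<longrightarrow> m \<sqsubset> x"
      using min_in[OF Y(1)] C(2) by auto
    have "\<not> x \<sqsubset> m" if "x \<in> C" for x
      using m that lt_irrefl[of x] lt_asym[of m x] car by metis
    then show ?thesis using m(1) by blast
  next
    case False
    obtain m where m: "m \<in> C \<inter> A" "\<forall>x\<in>C \<inter> A. x \<noteq> m \<longrightarrow> m \<sqsubset> x"
      using min_in[OF A] False by blast
    obtain n where n: "n \<in> C \<inter> B" "\<forall>x\<in>C \<inter> B. x \<noteq> n \<longrightarrow> n \<sqsubset> x"
      using min_in[OF B] False by blast
    define k where "k = (if m \<sqsubset> n then m else n)"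
    have mn: "m \<in> carrier Q" "n \<in> carrier Q" using m(1) n(1) car by auto
    then have km: "k = m \<or> k \<sqsubset> m" and kn: "k = n \<or> k \<sqsubset> n" and kC: "k \<in> C"
      using lt_total[OF mn] m(1) n(1) by (auto simp: k_def)
    have kc: "k \<in> carrier Q" using car kC .
    have "\<not> x \<sqsubset> k" if "x \<in> C" for x
    proof
      assume xk: "x \<sqsubset> k"
      have xc: "x \<in> carrier Q" using car that .
      have xm: "x \<sqsubset> m" and xn: "x \<sqsubset> n"
        using km kn lt_trans[OF xk _ xc kc] mn xk by auto
      have "x \<in> A \<or> x \<in> B" using that C by blast
      then have "x = m \<or> m \<sqsubset> x \<or> x = n \<or> n \<sqsubset> x" using m(2) n(2) that by blast
      then show False using xm xn lt_irrefl lt_asym xc mn by blast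
    qed
    then show ?thesis using kC by blast
  qed
qed

lemma well_ordered_singleton: "x \<in> carrier Q \<Longrightarrow> well_ordered {x}"
  by (rule well_orderedI) (auto simp: subset_singleton_iff lt_irrefl)

lemma well_ordered_finite: "finite A \<Longrightarrow> A \<subseteq> carrier Q \<Longrightarrow> well_ordered A"
proof (induction A rule: finite_induct)
  case empty
  then show ?case by (simp add: well_ordered_empty)
next
  case (insert x A)
  then show ?case
    using well_ordered_Un[OF well_ordered_singleton[of x], of A] by simp
qed

text \<open>Take the least left factor \<open>a\<close> that occurs in a set of products, and the
  least partner \<open>b\<close> of it. A product of the set below \<open>a \<otimes> b\<close> must
  have its right factor below \<open>b\<close>. So a descent among the products forces a descent in
  \<open>B\<close>, which well-founded induction on \<open>B\<close> stops.\<close>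

lemma well_ordered_mult:
  assumes A: "well_ordered A" and B: "well_ordered B"
  shows "well_ordered (A <#> B)"
proof (rule well_orderedI)
  have Ac: "\<And>a. a \<in> A \<Longrightarrow> a \<in> carrier Q" and Bc: "\<And>b. b \<in> B \<Longrightarrow> b \<in> carrier Q"
    using A B by (auto simp: well_ordered_def)
  then show sub: "A <#> B \<subseteq> carrier Q"
    by (auto simp: set_mult_def)
  have wfB: "wfp_on B lt" using B by (simp add: well_ordered_def)
  have corner: "\<exists>a\<in>A. \<exists>b\<in>B. b \<in> B' \<and> a \<otimes> b \<in> T \<and>
      (\<forall>t\<in>T. t \<sqsubset> a \<otimes> b \<longrightarrow> t \<in> A <#> {b' \<in> B. b' \<sqsubset> b})"
    if T: "T \<subseteq> A <#> B'" "T \<noteq> {}" "B' \<subseteq> B" for T B'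
  proof -
    have "{a \<in> A. \<exists>b\<in>B'. a \<otimes> b \<in> T} \<noteq> {}"
      using T by (auto simp: set_mult_def)
    then obtain a where a: "a \<in> {a \<in> A. \<exists>b\<in>B'. a \<otimes> b \<in> T}"
        "\<And>x. x \<in> {a \<in> A. \<exists>b\<in>B'. a \<otimes> b \<in> T} \<Longrightarrow> x \<noteq> a \<Longrightarrow> a \<sqsubset> x"
      using well_orderedE[OF A, of "{a \<in> A. \<exists>b\<in>B'. a \<otimes> b \<in> T}"] by blast
    then have "{b \<in> B'. a \<otimes> b \<in> T} \<noteq> {}" by blast
    then obtain b where b: "b \<in> {b \<in> B'. a \<otimes> b \<in> T}"
        "\<And>x. x \<in> {b \<in> B'. a \<otimes> b \<in> T} \<Longrightarrow> x \<noteq> b \<Longrightarrow> b \<sqsubset> x"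
      using well_orderedE[OF B, of "{b \<in> B'. a \<otimes> b \<in> T}"] T by blast
    have ab: "a \<in> carrier Q" "b \<in> carrier Q" "a \<in> A" "b \<in> B" using a b T Ac Bc by auto
    have "t \<in> A <#> {b' \<in> B. b' \<sqsubset> b}" if t: "t \<in> T" "t \<sqsubset> a \<otimes> b" for t
    proof -
      obtain a' b' where t': "a' \<in> A" "b' \<in> B'" "t = a' \<otimes> b'"
        using T(1) t(1) unfolding set_mult_def by blast
      have c: "a' \<in> carrier Q" "b' \<in> carrier Q" "b' \<in> B" using t' T Ac Bc by auto
      have "b' \<sqsubset> b"
      proof (rule ccontr)
        assume "\<not> b' \<sqsubset> b"
        then have "b = b' \<or> b \<sqsubset> b'" using lt_total ab c by blast
        moreover have "a = a' \<or> a \<sqsubset> a'" using a(2)[of a'] t' t by blast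
        ultimately have "a \<otimes> b = a' \<otimes> b' \<or> a \<otimes> b \<sqsubset> a' \<otimes> b'"
        proof (elim disjE)
          assume *: "b \<sqsubset> b'" "a \<sqsubset> a'"
          have "a \<otimes> b \<sqsubset> a \<otimes> b'" "a \<otimes> b' \<sqsubset> a' \<otimes> b'"
            using lt_mult_left[OF *(1)] lt_mult_right[OF *(2)] ab c by auto
          then show ?thesis using lt_trans ab c by blast
        qed (use lt_mult_left lt_mult_right ab c in auto)
        then show False using t(2) t'(3) lt_irrefl lt_asym ab c by auto
      qed
      then show ?thesis using t' c by (auto simp: set_mult_def)
    qed
    then show ?thesis using a b ab by blast
  qed
  \<comment> \<open>The induction runs over a strict upper bound \<open>b\<close> for the right
    factors. Either the corner is already minimal, or what lies below it has right factors below the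
    smaller \<open>b1\<close>.\<close>
  have bounded: "T \<noteq> {} \<longrightarrow> T \<subseteq> A <#> {b' \<in> B. b' \<sqsubset> b} \<longrightarrow> (\<exists>m\<in>T. \<forall>x\<in>T. \<not> x \<sqsubset> m)"
    if "b \<in> B" for b T
    using wfB
  proof (induction b arbitrary: T rule: wfp_on_induct)
    case in_set
    show ?case using that .
  next
    case (less b)
    show ?case
    proof (intro impI)
      assume T: "T \<noteq> {}" "T \<subseteq> A <#> {b' \<in> B. b' \<sqsubset> b}"
      obtain a b1 where ab: "a \<in> A" "b1 \<in> B" "b1 \<sqsubset> b" "a \<otimes> b1 \<in> T"
        "\<forall>t\<in>T. t \<sqsubset> a \<otimes> b1 \<longrightarrow> t \<in> A <#> {b' \<in> B. b' \<sqsubset> b1}"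
        using corner[OF T(2,1)] by auto
      have Tc: "\<And>t. t \<in> T \<Longrightarrow> t \<in> carrier Q"
        using T(2) Ac Bc by (auto simp: set_mult_def)
      show "\<exists>m\<in>T. \<forall>x\<in>T. \<not> x \<sqsubset> m"
      proof (cases "{t \<in> T. t \<sqsubset> a \<otimes> b1} = {}")
        case True
        then show ?thesis using ab by blast
      next
        case False
        then obtain m where m: "m \<in> {t \<in> T. t \<sqsubset> a \<otimes> b1}"
            "\<forall>x\<in>{t \<in> T. t \<sqsubset> a \<otimes> b1}. \<not> x \<sqsubset> m"
          using less(2)[OF ab(2,3), of "{t \<in> T. t \<sqsubset> a \<otimes> b1}"] ab(5) by auto
        then have "\<forall>x\<in>T. \<not> x \<sqsubset> m"
          using lt_trans Tc ab(4) by blast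
        then show ?thesis using m by blast
      qed
    qed
  qed
  fix T assume T: "T \<subseteq> A <#> B" "T \<noteq> {}"
  obtain a b where ab: "a \<in> A" "b \<in> B" "a \<otimes> b \<in> T"
    "\<forall>t\<in>T. t \<sqsubset> a \<otimes> b \<longrightarrow> t \<in> A <#> {b' \<in> B. b' \<sqsubset> b}"
    using corner[OF T] by auto
  have Tc: "\<And>t. t \<in> T \<Longrightarrow> t \<in> carrier Q" using T(1) sub by auto
  show "\<exists>m\<in>T. \<forall>x\<in>T. \<not> x \<sqsubset> m"
  proof (cases "{t \<in> T. t \<sqsubset> a \<otimes> b} = {}")
    case True
    then show ?thesis using ab by blast
  next
    case False
    then obtain m where m: "m \<in> {t \<in> T. t \<sqsubset> a \<otimes> b}"
        "\<forall>x\<in>{t \<in> T. t \<sqsubset> a \<otimes> b}. \<not> x \<sqsubset> m"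
      using bounded[OF ab(2), of "{t \<in> T. t \<sqsubset> a \<otimes> b}"] ab(4) by auto
    then have "\<forall>x\<in>T. \<not> x \<sqsubset> m"
      using lt_trans Tc ab(3) by blast
    then show ?thesis using m by blast
  qed
qed

text \<open>Along \<open>x \<otimes> y = q\<close> the factor \<open>y\<close> decreases as \<open>x\<close> increases, so the set below is well-ordered
  in both directions.\<close>

lemma finite_factorizations:
  assumes A: "well_ordered A" and B: "well_ordered B" and q: "q \<in> carrier Q"
  shows "finite {x \<in> A. inv x \<otimes> q \<in> B}"
proof -
  define Z where "Z = {x \<in> A. inv x \<otimes> q \<in> B}"
  have Zc: "\<And>x. x \<in> Z \<Longrightarrow> x \<in> carrier Q"
    using A by (auto simp: Z_def well_ordered_def)
  have anti: "inv y \<otimes> q \<sqsubset> inv x \<otimes> q" if "x \<in> carrier Q" "y \<in> carrier Q" "x \<sqsubset> y" for x y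
  proof -
    have "inv y \<otimes> x \<sqsubset> \<one>" using lt_mult_left[of x y "inv y"] that by simp
    then have "inv y \<otimes> x \<otimes> inv x \<sqsubset> \<one> \<otimes> inv x" using that by (intro lt_mult_right) auto
    then have "inv y \<sqsubset> inv x" using that by (simp add: m_assoc)
    then show ?thesis using that q by (intro lt_mult_right) auto
  qed
  \<comment> \<open>By \<open>anti\<close>, the least value of \<open>inv x \<otimes> q\<close> in
    \<open>B\<close> comes from the greatest \<open>x\<close>.\<close>
  have ex_max: "\<exists>m\<in>Y. \<forall>x\<in>Y. x \<noteq> m \<longrightarrow> x \<sqsubset> m" if Y: "Y \<subseteq> Z" "Y \<noteq> {}" for Y
  proof -
    obtain b where b: "b \<in> (\<lambda>x. inv x \<otimes> q) ` Y"
      "\<And>z. z \<in> (\<lambda>x. inv x \<otimes> q) ` Y \<Longrightarrow> z \<noteq> b \<Longrightarrow> b \<sqsubset> z"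
      using well_orderedE[OF B, of "(\<lambda>x. inv x \<otimes> q) ` Y"] Y by (auto simp: Z_def)
    then obtain m where m: "m \<in> Y" "b = inv m \<otimes> q" by auto
    have "x \<sqsubset> m" if "x \<in> Y" "x \<noteq> m" for x
    proof (rule ccontr)
      assume "\<not> x \<sqsubset> m"
      have c: "x \<in> carrier Q" "m \<in> carrier Q" using that m(1) Zc Y by auto
      have "m \<sqsubset> x" using lt_total[OF c] that(2) \<open>\<not> x \<sqsubset> m\<close> by simp
      then have lt: "inv x \<otimes> q \<sqsubset> inv m \<otimes> q" using anti c by simp
      have "inv x \<otimes> q = b \<or> b \<sqsubset> inv x \<otimes> q" using b that by blast
      then show False using lt m(2) c q lt_irrefl lt_asym by auto
    qed
    then show ?thesis using m by blast
  qed
  \<comment> \<open>A least element with infinitely many predecessors has a greatest predecessor by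
    \<open>ex_max\<close>; apart from it, they are all predecessors of that one, which has only
    finitely many by minimality.\<close>
  have initial: "finite {y \<in> Z. y \<sqsubset> x}" if "x \<in> Z" for x
  proof (rule ccontr)
    assume "infinite {y \<in> Z. y \<sqsubset> x}"
    then have "{x \<in> Z. infinite {y \<in> Z. y \<sqsubset> x}} \<noteq> {}" using that by blast
    then obtain m where m: "m \<in> {x \<in> Z. infinite {y \<in> Z. y \<sqsubset> x}}"
      "\<And>z. z \<in> {x \<in> Z. infinite {y \<in> Z. y \<sqsubset> x}} \<Longrightarrow> z \<noteq> m \<Longrightarrow> m \<sqsubset> z"
      using well_orderedE[OF A, of "{x \<in> Z. infinite {y \<in> Z. y \<sqsubset> x}}"]
      by (auto simp: Z_def)
    then have ne: "{y \<in> Z. y \<sqsubset> m} \<noteq> {}" by force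
    obtain k where k: "k \<in> {y \<in> Z. y \<sqsubset> m}" "\<forall>x\<in>{y \<in> Z. y \<sqsubset> m}. x \<noteq> k \<longrightarrow> x \<sqsubset> k"
      using ex_max[OF _ ne] by blast
    then have "{y \<in> Z. y \<sqsubset> m} \<subseteq> insert k {y \<in> Z. y \<sqsubset> k}" by blast
    moreover have "finite {y \<in> Z. y \<sqsubset> k}"
    proof (rule ccontr)
      assume "infinite {y \<in> Z. y \<sqsubset> k}"
      then have "k = m \<or> m \<sqsubset> k" using m(2)[of k] k by auto
      then show False using k(1) m(1) Zc[of k] Zc[of m] lt_irrefl[of k] lt_asym[of m k] by auto
    qed
    ultimately show False using m finite_subset by auto
  qed
  have "finite Z"
  proof (cases "Z = {}")
    case False
    then obtain k where k: "k \<in> Z" "\<forall>x\<in>Z. x \<noteq> k \<longrightarrow> x \<sqsubset> k"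
      using ex_max[of Z] by blast
    then have "Z \<subseteq> insert k {y \<in> Z. y \<sqsubset> k}" by blast
    then show ?thesis using initial[OF k(1)] finite_subset by auto
  qed simp
  then show ?thesis by (simp add: Z_def)
qed

end

section \<open>Amenable groups and skew fields\<close>

text \<open>Rado's proof of Hall's theorem, in the version for infinitely many finite sets. Pairs
  \<open>(i, x)\<close> are deleted from the family, by Zorn's lemma, as long as Hall's condition
  survives. After a maximal deletion every set is a singleton, and Hall's condition for two indices
  makes the resulting choice injective.\<close>

lemma infinite_hall:
  fixes A :: "'i \<Rightarrow> 'b set"
  assumes fin: "\<And>i. i \<in> I \<Longrightarrow> finite (A i)"
    and hall: "\<And>J. finite J \<Longrightarrow> J \<subseteq> I \<Longrightarrow> card J \<le> card (\<Union>j\<in>J. A j)"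
  shows "\<exists>f. inj_on f I \<and> (\<forall>i\<in>I. f i \<in> A i)"
proof -
  define H where "H = (\<lambda>M. \<forall>J. finite J \<longrightarrow> J \<subseteq> I \<longrightarrow> card J \<le> card (\<Union>j\<in>J. A j - M `` {j}))"
  have "\<exists>M\<in>{M. H M}. \<forall>N\<in>{M. H M}. M \<subseteq> N \<longrightarrow> N = M"
  proof (rule subset_Zorn')
    fix C assume C: "subset.chain {M. H M} C"
    show "\<Union>C \<in> {M. H M}"
    proof (cases "C = {}")
      case True
      then show ?thesis using hall by (simp add: H_def)
    next
      case False
      have "card J \<le> card (\<Union>j\<in>J. A j - (\<Union>C) `` {j})" if J: "finite J" "J \<subseteq> I" for J
      proof -
        \<comment> \<open>For a fixed finite \<open>J\<close> the condition sees only the deletions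
          inside the finite set \<open>Sigma J A\<close>, and one member of the chain contains all
          of these.\<close>
        have "finite (\<Union>C \<inter> Sigma J A)"
          using J fin by (intro finite_Int disjI2 finite_SigmaI) auto
        then obtain N where N: "N \<in> C" "\<Union>C \<inter> Sigma J A \<subseteq> N"
          using finite_subset_Union_chain[OF _ _ False C] by (metis Int_lower1)
        then have "(\<Union>j\<in>J. A j - (\<Union>C) `` {j}) = (\<Union>j\<in>J. A j - N `` {j})" by blast
        moreover have "H N" using N(1) C by (auto simp: subset.chain_def)
        ultimately show ?thesis using J by (simp add: H_def)
      qed
      then show ?thesis by (simp add: H_def)
    qed
  qed
  then obtain M where M: "H M" and max: "\<And>N. H N \<Longrightarrow> M \<subseteq> N \<Longrightarrow> N = M" by blast
  define B where "B = (\<lambda>i. A i - M `` {i})"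
  have finB: "finite (B i)" if "i \<in> I" for i using fin that by (simp add: B_def)
  have hallB: "card J \<le> card (\<Union>j\<in>J. B j)" if "finite J" "J \<subseteq> I" for J
    using M that by (simp add: H_def B_def)
  \<comment> \<open>By maximality, deleting one further pair \<open>(i, x)\<close> violates Hall's
    condition on some finite set, which must contain \<open>i\<close>. The \<open>J\<close> given
    here is that set without \<open>i\<close>, which turns the strict inequality into
    \<open>\<le>\<close>.\<close>
  have tight: "\<exists>J. finite J \<and> J \<subseteq> I \<and> i \<notin> J \<and> card ((\<Union>j\<in>J. B j) \<union> (B i - {x})) \<le> card J"
    if ix: "i \<in> I" "x \<in> B i" for i x
  proof -
    have "insert (i, x) M \<noteq> M" using ix by (auto simp: B_def)
    then have "\<not> H (insert (i, x) M)" using max by blast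
    then obtain J where J: "finite J" "J \<subseteq> I" "card (\<Union>j\<in>J. A j - insert (i, x) M `` {j}) < card J"
      by (auto simp: H_def not_le)
    have eq: "A j - insert (i, x) M `` {j} = (if j = i then B i - {x} else B j)" for j
      by (auto simp: B_def)
    have "i \<in> J"
    proof (rule ccontr)
      assume "i \<notin> J"
      then have "(\<Union>j\<in>J. A j - insert (i, x) M `` {j}) = (\<Union>j\<in>J. B j)"
        unfolding eq by auto
      then show False using hallB[OF J(1,2)] J(3) by simp
    qed
    then have "(\<Union>j\<in>J. A j - insert (i, x) M `` {j}) = (\<Union>j\<in>J - {i}. B j) \<union> (B i - {x})"
      unfolding eq by auto
    then have "card ((\<Union>j\<in>J - {i}. B j) \<union> (B i - {x})) \<le> card (J - {i})"
      using J \<open>i \<in> J\<close> by simp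
    then show ?thesis using J by (intro exI[of _ "J - {i}"]) auto
  qed
  \<comment> \<open>Submodularity: the two tight neighbourhoods have as union the neighbourhood of
    \<open>insert i (J1 \<union> J2)\<close>, and their intersection contains that of
    \<open>J1 \<inter> J2\<close>. Hall's condition for these two index sets exceeds the two tight
    bounds together by one.\<close>
  have unique: "x = y" if i: "i \<in> I" and x: "x \<in> B i" and y: "y \<in> B i" for i x y
  proof (rule ccontr)
    assume "x \<noteq> y"
    obtain J1 where J1: "finite J1" "J1 \<subseteq> I" "i \<notin> J1"
      "card ((\<Union>j\<in>J1. B j) \<union> (B i - {x})) \<le> card J1" using tight[OF i x] by blast
    obtain J2 where J2: "finite J2" "J2 \<subseteq> I" "i \<notin> J2"
      "card ((\<Union>j\<in>J2. B j) \<union> (B i - {y})) \<le> card J2" using tight[OF i y] by blast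
    let ?U = "(\<Union>j\<in>J1. B j) \<union> (B i - {x})" and ?V = "(\<Union>j\<in>J2. B j) \<union> (B i - {y})"
    have finU: "finite ?U" "finite ?V" using J1 J2 finB i by (auto intro: finite_subset)
    have "?U \<union> ?V = (\<Union>j\<in>insert i (J1 \<union> J2). B j)" using \<open>x \<noteq> y\<close> by auto
    then have 1: "card (J1 \<union> J2) + 1 \<le> card (?U \<union> ?V)"
      using hallB[of "insert i (J1 \<union> J2)"] J1 J2 i by simp
    have "(\<Union>j\<in>J1 \<inter> J2. B j) \<subseteq> ?U \<inter> ?V" by blast
    then have "card (\<Union>j\<in>J1 \<inter> J2. B j) \<le> card (?U \<inter> ?V)"
      using finU by (intro card_mono) auto
    then have 2: "card (J1 \<inter> J2) \<le> card (?U \<inter> ?V)"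
      using hallB[of "J1 \<inter> J2"] J1(1,2) by (meson finite_Int inf.coboundedI1 le_trans)
    have "card J1 + card J2 = card (J1 \<union> J2) + card (J1 \<inter> J2)"
      by (rule card_Un_Int[OF J1(1) J2(1)])
    moreover have "card ?U + card ?V = card (?U \<union> ?V) + card (?U \<inter> ?V)"
      by (rule card_Un_Int[OF finU])
    ultimately show False using 1 2 J1(4) J2(4) by linarith
  qed
  define f where "f = (\<lambda>i. SOME x. x \<in> B i)"
  have fB: "f i \<in> B i" if "i \<in> I" for i
  proof -
    have "B i \<noteq> {}" using hallB[of "{i}"] that by auto
    then show ?thesis unfolding f_def by (simp add: some_in_eq)
  qed
  have "inj_on f I"
  proof (rule inj_onI, rule ccontr)
    fix i j assume ij: "i \<in> I" "j \<in> I" "f i = f j" "i \<noteq> j"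
    have "(\<Union>k\<in>{i, j}. B k) \<subseteq> {f i}" using unique fB ij by auto
    then have "card (\<Union>k\<in>{i, j}. B k) \<le> 1" using card_mono[of "{f i}"] by simp
    then show False using hallB[of "{i, j}"] ij by simp
  qed
  moreover have "f i \<in> A i" if "i \<in> I" for i using fB[OF that] by (simp add: B_def)
  ultimately show ?thesis by blast
qed

text \<open>If \<open>S\<close> at least doubled every finite set, Hall's theorem would yield two
  injections of the group into itself with disjoint images, both moving each point by a left factor
  from \<open>S\<close>. An invariant mean would give each image mass 1. The factor 2 is chosen for
  the Ore condition, where each element of \<open>E\<close> carries two unknowns.\<close>

lemma (in group) amenable_no_doubling:
  assumes am: "amenable G" and fin: "finite S" and S: "S \<subseteq> carrier G"
  shows "\<exists>E\<subseteq>carrier G. finite E \<and> card (S <#> E) < 2 * card E"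
proof (rule ccontr)
  assume neg: "\<not> ?thesis"
  have big: "2 * card E \<le> card (S <#> E)" if "finite E" "E \<subseteq> carrier G" for E
    using neg that by (auto simp: not_less)
  \<comment> \<open>The Boolean tag makes two copies of the group, one for each of the two
    injections.\<close>
  define I where "I = carrier G \<times> (UNIV :: bool set)"
  define A where "A = (\<lambda>i :: 'a \<times> bool. (\<lambda>s. s \<otimes> fst i) ` S)"
  have "\<exists>f. inj_on f I \<and> (\<forall>i\<in>I. f i \<in> A i)"
  proof (rule infinite_hall)
    show "finite (A i)" for i using fin by (simp add: A_def)
    fix J assume J: "finite J" "J \<subseteq> I"
    have "card J \<le> card (fst ` J \<times> (UNIV :: bool set))"
      using J by (intro card_mono) force+
    also have "\<dots> = 2 * card (fst ` J)" by (simp add: card_cartesian_product)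
    also have "\<dots> \<le> card (S <#> fst ` J)"
      using J by (intro big) (auto simp: I_def)
    also have "S <#> fst ` J = (\<Union>j\<in>J. A j)"
      by (auto simp: A_def set_mult_def)
    finally show "card J \<le> card (\<Union>j\<in>J. A j)" .
  qed
  then obtain f where inj: "inj_on f I" and f: "\<And>i. i \<in> I \<Longrightarrow> f i \<in> A i" by blast
  have fS: "\<exists>s\<in>S. f (g, e) = s \<otimes> g" if "g \<in> carrier G" for g e
    using f[of "(g, e)"] that by (auto simp: I_def A_def)
  obtain m :: "'a set \<Rightarrow> real" where
    m: "(\<forall>A. A \<subseteq> carrier G \<longrightarrow> 0 \<le> m A) \<and> m (carrier G) = 1 \<and>
        (\<forall>A B. A \<subseteq> carrier G \<longrightarrow> B \<subseteq> carrier G \<longrightarrow> A \<inter> B = {} \<longrightarrow> m (A \<union> B) = m A + m B) \<and>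
        (\<forall>g\<in>carrier G. \<forall>A. A \<subseteq> carrier G \<longrightarrow> m (g <# A) = m A)"
    using am unfolding amenable_def by (elim exE) (rule that)
  then have m0: "\<And>A. A \<subseteq> carrier G \<Longrightarrow> 0 \<le> m A"
    and m1: "m (carrier G) = 1"
    and mU: "\<And>A B. A \<subseteq> carrier G \<Longrightarrow> B \<subseteq> carrier G \<Longrightarrow> A \<inter> B = {} \<Longrightarrow> m (A \<union> B) = m A + m B"
    and mI: "\<And>g A. g \<in> carrier G \<Longrightarrow> A \<subseteq> carrier G \<Longrightarrow> m (g <# A) = m A"
    by simp_all
  have fc: "f (g, e) \<in> carrier G" if "g \<in> carrier G" for g e
    using fS[OF that, of e] that S by auto
  text \<open>On each piece of a partition by the chosen factor, \<open>f\<close> is a left translation.\<close>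
  have pieces: "m ((\<lambda>g. f (g, e)) ` {g \<in> carrier G. \<exists>s\<in>T. f (g, e) = s \<otimes> g}) =
      m {g \<in> carrier G. \<exists>s\<in>T. f (g, e) = s \<otimes> g}" if "finite T" "T \<subseteq> S" for T e
    using that
  proof (induction T rule: finite_induct)
    case empty
    then show ?case by simp
  next
    case (insert s T)
    let ?P = "{g \<in> carrier G. \<exists>s\<in>T. f (g, e) = s \<otimes> g}"
    let ?N = "{g \<in> carrier G. f (g, e) = s \<otimes> g \<and> (\<forall>t\<in>T. f (g, e) \<noteq> t \<otimes> g)}"
    let ?h = "\<lambda>g. f (g, e)"
    have eq: "{g \<in> carrier G. \<exists>t\<in>insert s T. f (g, e) = t \<otimes> g} = ?P \<union> ?N" by auto
    have inj_h: "g = h" if "g \<in> carrier G" "h \<in> carrier G" "f (g, e) = f (h, e)" for g h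
      using inj_onD[OF inj that(3)] that(1,2) by (simp add: I_def)
    have dis: "?h ` ?P \<inter> ?h ` ?N = {}"
    proof -
      have "f (g, e) \<noteq> f (h, e)" if "g \<in> ?P" "h \<in> ?N" for g h
        using inj_h[of g h] that by auto
      then show ?thesis by blast
    qed
    have "?h ` ?N = s <# ?N" by (auto simp: l_coset_def)
    then have N: "m (?h ` ?N) = m ?N" using mI[of s ?N] insert.prems S by auto
    have "m (?h ` (?P \<union> ?N)) = m (?h ` ?P) + m (?h ` ?N)"
      unfolding image_Un using dis by (intro mU) (use fc in blast)+
    also have "\<dots> = m ?P + m ?N" using insert N by simp
    also have "\<dots> = m (?P \<union> ?N)" by (rule mU[symmetric]) auto
    finally show ?case unfolding eq .
  qed
  have "m ((\<lambda>g. f (g, e)) ` carrier G) = 1" for e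
  proof -
    have "{g \<in> carrier G. \<exists>s\<in>S. f (g, e) = s \<otimes> g} = carrier G" using fS by blast
    then show ?thesis using pieces[OF fin subset_refl, of e] m1 by simp
  qed
  moreover have "m ((\<lambda>g. f (g, True)) ` carrier G \<union> (\<lambda>g. f (g, False)) ` carrier G) =
      m ((\<lambda>g. f (g, True)) ` carrier G) + m ((\<lambda>g. f (g, False)) ` carrier G)"
  proof (rule mU)
    have "f (g, True) \<noteq> f (h, False)" if "g \<in> carrier G" "h \<in> carrier G" for g h
      using inj that by (auto simp: inj_on_def I_def)
    then show "(\<lambda>g. f (g, True)) ` carrier G \<inter> (\<lambda>g. f (g, False)) ` carrier G = {}" by blast
  qed (use fc in auto)
  moreover have le1: "m A \<le> 1" if "A \<subseteq> carrier G" for A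
  proof -
    have "m (A \<union> (carrier G - A)) = m A + m (carrier G - A)"
      using that by (intro mU) auto
    moreover have "A \<union> (carrier G - A) = carrier G" using that by blast
    ultimately show ?thesis using m0[of "carrier G - A"] m1 by simp
  qed
  moreover have "m ((\<lambda>g. f (g, True)) ` carrier G \<union> (\<lambda>g. f (g, False)) ` carrier G) \<le> 1"
    using fc by (intro le1) blast
  ultimately show False by simp
qed

section \<open>Arithmetic and linear equations in a skew field\<close>

context skew_field
begin

lemma nonzero_Units: "x \<in> carrier R \<Longrightarrow> x \<noteq> \<zero> \<Longrightarrow> x \<in> Units R"
  by (simp add: skew_field_Units)

lemma zero_neq_one: "\<zero> \<noteq> \<one>"
  using Units_one_closed skew_field_Units by auto

lemma skew_inv_closed: "x \<in> carrier R \<Longrightarrow> x \<noteq> \<zero> \<Longrightarrow> inv x \<in> carrier R"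
  by (simp add: nonzero_Units)

lemma skew_r_inv: "x \<in> carrier R \<Longrightarrow> x \<noteq> \<zero> \<Longrightarrow> x \<otimes> inv x = \<one>"
  by (simp add: nonzero_Units)

lemma skew_l_inv: "x \<in> carrier R \<Longrightarrow> x \<noteq> \<zero> \<Longrightarrow> inv x \<otimes> x = \<one>"
  by (simp add: nonzero_Units)

lemma skew_inv_nonzero: "x \<in> carrier R \<Longrightarrow> x \<noteq> \<zero> \<Longrightarrow> inv x \<noteq> \<zero>"
  using skew_r_inv zero_neq_one by fastforce

lemma skew_integral:
  assumes "x \<in> carrier R" "y \<in> carrier R" "x \<otimes> y = \<zero>"
  shows "x = \<zero> \<or> y = \<zero>"
proof (rule ccontr)
  assume *: "\<not> ?thesis"
  have "inv x \<otimes> (x \<otimes> y) = y"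
    using assms(1,2) * by (simp add: m_assoc[symmetric] skew_l_inv skew_inv_closed)
  moreover have "inv x \<otimes> (x \<otimes> y) = \<zero>"
    using assms * by (simp add: skew_inv_closed)
  ultimately show False using * by simp
qed

lemma skew_inv_mult:
  assumes "x \<in> carrier R" "y \<in> carrier R" "x \<noteq> \<zero>" "y \<noteq> \<zero>"
  shows "inv (x \<otimes> y) = inv y \<otimes> inv x"
proof (rule inv_char)
  have c: "inv x \<in> carrier R" "inv y \<in> carrier R" using assms skew_inv_closed by auto
  have "x \<otimes> y \<otimes> (inv y \<otimes> inv x) = x \<otimes> (y \<otimes> inv y) \<otimes> inv x"
    using assms c by (simp add: m_assoc)
  then show "x \<otimes> y \<otimes> (inv y \<otimes> inv x) = \<one>" using assms c by (simp add: skew_r_inv)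
  have "inv y \<otimes> inv x \<otimes> (x \<otimes> y) = inv y \<otimes> (inv x \<otimes> x) \<otimes> y"
    using assms c by (simp add: m_assoc)
  then show "inv y \<otimes> inv x \<otimes> (x \<otimes> y) = \<one>" using assms c by (simp add: skew_l_inv)
qed (use assms skew_inv_closed in auto)

lemma skew_subfieldD:
  assumes "skew_subfield L R"
  shows "subring L R" "L \<subseteq> carrier R" "\<zero> \<in> L" "\<one> \<in> L"
    "\<And>x. x \<in> L \<Longrightarrow> \<ominus> x \<in> L"
    "\<And>x y. x \<in> L \<Longrightarrow> y \<in> L \<Longrightarrow> x \<otimes> y \<in> L"
    "\<And>x y. x \<in> L \<Longrightarrow> y \<in> L \<Longrightarrow> x \<oplus> y \<in> L"
    "\<And>x. x \<in> L \<Longrightarrow> x \<noteq> \<zero> \<Longrightarrow> inv x \<in> L"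
  using assms subringE[of L R] by (auto simp: skew_subfield_def)

lemma subring_finsum_closed:
  assumes L: "subring L R" and f: "\<And>i. i \<in> I \<Longrightarrow> f i \<in> L"
  shows "finsum R f I \<in> L"
proof (cases "finite I")
  case True
  then show ?thesis
    using f
  proof (induction I rule: finite_induct)
    case empty
    then show ?case using subringE(2)[OF L] by simp
  next
    case (insert i I)
    then have "finsum R f (insert i I) = f i \<oplus> finsum R f I"
      using subringE(1)[OF L] by (intro finsum_insert) auto
    then show ?case using insert subringE(7)[OF L] by auto
  qed
next
  case False
  then show ?thesis using subringE(2)[OF L] by simp
qed

text \<open>Gaussian elimination, by induction on the number of equations. Coefficients stand to the
  left of the unknowns, so rows may be multiplied from the left and the argument needs no
  commutativity.\<close>

lemma underdetermined_system:
  assumes L: "skew_subfield L R"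
    and "finite T" "finite I" "card T < card I"
    and "\<And>i t. i \<in> I \<Longrightarrow> t \<in> T \<Longrightarrow> v i t \<in> L"
  shows "\<exists>r. (\<forall>i\<in>I. r i \<in> L) \<and> (\<exists>i\<in>I. r i \<noteq> \<zero>) \<and>
           (\<forall>t\<in>T. (\<Oplus>i\<in>I. v i t \<otimes> r i) = \<zero>)"
  using assms(2-)
proof (induction T arbitrary: I v rule: finite_induct)
  case empty
  then have "I \<noteq> {}" by auto
  then show ?case
    using skew_subfieldD(4)[OF L] zero_neq_one by (intro exI[of _ "\<lambda>_. \<one>"]) auto
next
  case (insert t T)
  note LD = skew_subfieldD[OF L]
  have Lc: "x \<in> carrier R" if "x \<in> L" for x using LD(2) that by blast
  show ?case
  proof (cases "\<forall>i\<in>I. v i t = \<zero>")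
    case True
    obtain r where r: "\<forall>i\<in>I. r i \<in> L" "\<exists>i\<in>I. r i \<noteq> \<zero>"
      "\<forall>t\<in>T. (\<Oplus>i\<in>I. v i t \<otimes> r i) = \<zero>"
    proof -
      have "card T < card I" using insert by simp
      from insert.IH[of I v, OF insert.prems(1) this] insert.prems(3) show ?thesis using that by blast
    qed
    have "(\<Oplus>i\<in>I. v i t \<otimes> r i) = \<zero>"
      using True r Lc by (intro add.finprod_one_eqI) auto
    then show ?thesis using r by blast
  next
    case False
    then obtain k where k: "k \<in> I" "v k t \<noteq> \<zero>" by blast
    define c where "c = inv (v k t)"
    have cL: "c \<in> L" and vkt: "v k t \<in> L" using k insert.prems LD(8) by (auto simp: c_def)
    \<comment> \<open>Row \<open>s\<close> minus \<open>v k s \<otimes> c\<close> times row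
      \<open>t\<close>, where \<open>c\<close> is the inverse of the pivot. The unknown
      \<open>k\<close> drops out and row \<open>t\<close> itself becomes zero.\<close>
    define w where "w = (\<lambda>i s. v i s \<oplus> \<ominus> (v k s \<otimes> c \<otimes> v i t))"
    have vL: "v i s \<in> L" if "i \<in> I" "s \<in> insert t T" for i s using insert.prems that by blast
    have wL: "w i s \<in> L" if "i \<in> I" "s \<in> insert t T" for i s
      using that vL k cL LD(5-7) by (simp add: w_def)
    have wt: "w i t = \<zero>" if "i \<in> I" for i
      using that k vL[of i t] Lc vkt by (simp add: w_def c_def skew_r_inv r_neg)
    obtain r where r: "\<forall>i\<in>I - {k}. r i \<in> L" "\<exists>i\<in>I - {k}. r i \<noteq> \<zero>"
      "\<forall>s\<in>T. (\<Oplus>i\<in>I - {k}. w i s \<otimes> r i) = \<zero>"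
    proof -
      have "card T < card (I - {k})" using insert.hyps insert.prems(1,2) k(1) by simp
      moreover have "w i s \<in> L" if "i \<in> I - {k}" "s \<in> T" for i s using wL that by simp
      ultimately show ?thesis using insert.IH[of "I - {k}" w] insert.prems(1) that by blast
    qed
    define z where "z = (\<Oplus>i\<in>I - {k}. v i t \<otimes> r i)"
    have zL: "z \<in> L" unfolding z_def
      using r vL LD(6) by (intro subring_finsum_closed[OF LD(1)]) auto
    \<comment> \<open>The value at \<open>k\<close> is forced by equation \<open>t\<close>, solved
      for the unknown at its pivot.\<close>
    define r' where "r' = (\<lambda>i. if i = k then \<ominus> (c \<otimes> z) else r i)"
    have r'L: "\<forall>i\<in>I. r' i \<in> L" using r zL cL LD(5,6) by (simp add: r'_def)
    have "(\<Oplus>i\<in>I. v i s \<otimes> r' i) = \<zero>" if s: "s \<in> insert t T" for s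
    proof -
      have car: "v i s \<in> carrier R" "v i t \<in> carrier R" "r i \<in> carrier R" if "i \<in> I - {k}" for i
        using that vL Lc s r(1) by auto
      have vks: "v k s \<in> carrier R" "c \<in> carrier R" "z \<in> carrier R" using vL k s cL zL Lc by auto
      have "(\<Oplus>i\<in>I. v i s \<otimes> r' i) = v k s \<otimes> r' k \<oplus> (\<Oplus>i\<in>I - {k}. v i s \<otimes> r' i)"
      proof -
        have "(\<Oplus>i\<in>insert k (I - {k}). v i s \<otimes> r' i) =
            v k s \<otimes> r' k \<oplus> (\<Oplus>i\<in>I - {k}. v i s \<otimes> r' i)"
          using insert.prems(1) r'L vL s Lc k by (intro finsum_insert) auto
        then show ?thesis using k by (simp add: insert_absorb)
      qed
      also have "(\<Oplus>i\<in>I - {k}. v i s \<otimes> r' i) = (\<Oplus>i\<in>I - {k}. v i s \<otimes> r i)"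
        using car by (intro finsum_cong') (auto simp: r'_def)
      also have "v k s \<otimes> r' k = (\<Oplus>i\<in>I - {k}. \<ominus> (v k s \<otimes> c) \<otimes> (v i t \<otimes> r i))"
      proof -
        have "v k s \<otimes> r' k = \<ominus> (v k s \<otimes> c) \<otimes> z"
          using vks by (simp add: r'_def l_minus r_minus m_assoc)
        also have "\<dots> = (\<Oplus>i\<in>I - {k}. \<ominus> (v k s \<otimes> c) \<otimes> (v i t \<otimes> r i))"
          unfolding z_def using vks car insert.prems(1) by (intro finsum_rdistr) auto
        finally show ?thesis .
      qed
      also have "\<dots> \<oplus> (\<Oplus>i\<in>I - {k}. v i s \<otimes> r i) =
          (\<Oplus>i\<in>I - {k}. \<ominus> (v k s \<otimes> c) \<otimes> (v i t \<otimes> r i) \<oplus> v i s \<otimes> r i)"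
        using vks car by (intro finsum_addf[symmetric]) auto
      also have "\<dots> = (\<Oplus>i\<in>I - {k}. w i s \<otimes> r i)"
        using vks car
        by (intro finsum_cong') (auto simp: w_def l_distr l_minus m_assoc a_comm)
      also have "\<dots> = \<zero>"
      proof (cases "s = t")
        case True
        then show ?thesis using wt car by (intro add.finprod_one_eqI) auto
      next
        case False
        then show ?thesis using r(3) s by blast
      qed
      finally show ?thesis .
    qed
    moreover have "\<exists>i\<in>I. r' i \<noteq> \<zero>" using r(2) by (auto simp: r'_def)
    ultimately show ?thesis using r'L by blast
  qed
qed

end

section \<open>Series over an ordered group\<close>

context abelian_monoid
begin

lemma finsum_swap:
  assumes "finite A" "finite B" "\<And>x y. x \<in> A \<Longrightarrow> y \<in> B \<Longrightarrow> f x y \<in> carrier G"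
  shows "(\<Oplus>x\<in>A. \<Oplus>y\<in>B. f x y) = (\<Oplus>y\<in>B. \<Oplus>x\<in>A. f x y)"
  using assms(1,3)
proof (induction A rule: finite_induct)
  case empty
  then show ?case by simp
next
  case (insert a A)
  have "(\<Oplus>x\<in>insert a A. \<Oplus>y\<in>B. f x y) = (\<Oplus>y\<in>B. f a y) \<oplus> (\<Oplus>x\<in>A. \<Oplus>y\<in>B. f x y)"
    using insert by (intro finsum_insert) auto
  also have "\<dots> = (\<Oplus>y\<in>B. f a y) \<oplus> (\<Oplus>y\<in>B. \<Oplus>x\<in>A. f x y)"
    using insert by simp
  also have "\<dots> = (\<Oplus>y\<in>B. f a y \<oplus> (\<Oplus>x\<in>A. f x y))"
    using insert by (intro finsum_addf[symmetric]) auto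
  also have "\<dots> = (\<Oplus>y\<in>B. \<Oplus>x\<in>insert a A. f x y)"
    using insert by (intro finsum_cong') (auto simp: Pi_def)
  finally show ?case .
qed

lemma finsum_mem:
  assumes "\<zero> \<in> V" "\<And>x y. x \<in> V \<Longrightarrow> y \<in> V \<Longrightarrow> x \<oplus> y \<in> V" "V \<subseteq> carrier G"
    and "\<And>i. i \<in> I \<Longrightarrow> f i \<in> V"
  shows "finsum G f I \<in> V"
proof (cases "finite I")
  case True
  then show ?thesis
    using assms(4)
  proof (induction I rule: finite_induct)
    case (insert i I)
    then have "finsum G f (insert i I) = f i \<oplus> finsum G f I"
      using assms(3) by (intro finsum_insert) auto
    then show ?case using insert assms(2) by simp
  qed (use assms(1) in simp)
qed (use assms(1) in simp)

lemma finsum_support: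
  assumes "finite A" "B \<subseteq> A" "\<And>x. x \<in> A - B \<Longrightarrow> f x = \<zero>" "\<And>x. x \<in> B \<Longrightarrow> f x \<in> carrier G"
  shows "finsum G f B = finsum G f A"
proof (rule add.finprod_mono_neutral_cong_left)
  show "f \<in> A \<rightarrow> carrier G" using assms(3,4) by (metis DiffI Pi_I zero_closed)
qed (use assms in auto)

end

locale series_ring = D: skew_field D + Q: ordered_group Q lt
  for D (structure) and Q :: "('q, 'n) monoid_scheme" and lt (infix "\<sqsubset>" 50)
begin

text \<open>A series is a total function; since \<open>well_ordered\<close> includes containment in
  the carrier, it is \<zero> off \<open>carrier Q\<close>. Equality of series is thus plain equality
  of functions.\<close>

definition series :: "('q \<Rightarrow> 'a) set" where
  "series = {f. (\<forall>q. f q \<in> carrier D) \<and> Q.well_ordered {q. f q \<noteq> \<zero>}}"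

text \<open>Factorizations of \<open>q\<close> are indexed by their left factor alone, the right one
  being determined. For series the index set is finite by \<open>finite_factorizations\<close>, so
  the sum never takes the default value of an infinite \<open>finsum\<close>.\<close>

definition conv :: "('q \<Rightarrow> 'a) \<Rightarrow> ('q \<Rightarrow> 'a) \<Rightarrow> 'q \<Rightarrow> 'a" (infixl "\<star>" 70) where
  "f \<star> h = (\<lambda>q. if q \<in> carrier Q
     then \<Oplus>x\<in>{x. f x \<noteq> \<zero> \<and> h (inv\<^bsub>Q\<^esub> x \<otimes>\<^bsub>Q\<^esub> q) \<noteq> \<zero>}. f x \<otimes> h (inv\<^bsub>Q\<^esub> x \<otimes>\<^bsub>Q\<^esub> q) else \<zero>)"

definition mono :: "'q \<Rightarrow> 'a \<Rightarrow> 'q \<Rightarrow> 'a" where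
  "mono p d = (\<lambda>q. if q = p then d else \<zero>)"

abbreviation sone :: "'q \<Rightarrow> 'a" where
  "sone \<equiv> mono \<one>\<^bsub>Q\<^esub> \<one>"

definition sadd :: "('q \<Rightarrow> 'a) \<Rightarrow> ('q \<Rightarrow> 'a) \<Rightarrow> 'q \<Rightarrow> 'a" where
  "sadd f g = (\<lambda>q. f q \<oplus> g q)"

definition sneg :: "('q \<Rightarrow> 'a) \<Rightarrow> 'q \<Rightarrow> 'a" where
  "sneg f = (\<lambda>q. \<ominus> f q)"

definition is_least :: "('q \<Rightarrow> 'a) \<Rightarrow> 'q \<Rightarrow> bool" where
  "is_least f p \<longleftrightarrow> f p \<noteq> \<zero> \<and> (\<forall>q. f q \<noteq> \<zero> \<longrightarrow> q = p \<or> p \<sqsubset> q)"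

lemma series_closed [simp]: "f \<in> series \<Longrightarrow> f q \<in> carrier D"
  by (simp add: series_def)

lemma series_well_ordered: "f \<in> series \<Longrightarrow> Q.well_ordered {q. f q \<noteq> \<zero>}"
  unfolding series_def by (drule CollectD) (rule conjunct2)

lemma series_supp_carrier: "f \<in> series \<Longrightarrow> f q \<noteq> \<zero> \<Longrightarrow> q \<in> carrier Q"
  using Q.well_orderedD[OF series_well_ordered] by blast

lemma seriesI:
  "(\<And>q. f q \<in> carrier D) \<Longrightarrow> Q.well_ordered A \<Longrightarrow> (\<And>q. f q \<noteq> \<zero> \<Longrightarrow> q \<in> A) \<Longrightarrow> f \<in> series"
  unfolding series_def using Q.well_ordered_subset[of A "{q. f q \<noteq> \<zero>}"] by auto

lemma is_least_exists:
  assumes "f \<in> series" "f q \<noteq> \<zero>"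
  obtains p where "is_least f p"
proof -
  show thesis
  proof (rule Q.well_orderedE[OF series_well_ordered[OF assms(1)] subset_refl])
    show "{q. f q \<noteq> \<zero>} \<noteq> {}" using assms(2) by blast
    fix m assume m: "m \<in> {q. f q \<noteq> \<zero>}" "\<And>x. x \<in> {q. f q \<noteq> \<zero>} \<Longrightarrow> x \<noteq> m \<Longrightarrow> m \<sqsubset> x"
    then have "is_least f m" unfolding is_least_def by blast
    then show thesis by (rule that)
  qed
qed

lemma mono_series: "p \<in> carrier Q \<Longrightarrow> d \<in> carrier D \<Longrightarrow> mono p d \<in> series"
  by (rule seriesI[OF _ Q.well_ordered_singleton[of p]]) (auto simp: mono_def split: if_splits)

lemma sone_series: "sone \<in> series"
  by (simp add: mono_series)

lemma sadd_series: "f \<in> series \<Longrightarrow> g \<in> series \<Longrightarrow> sadd f g \<in> series"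
  by (rule seriesI[OF _ Q.well_ordered_Un[OF series_well_ordered[of f] series_well_ordered[of g]]])
    (auto simp: sadd_def)

lemma sneg_series: "f \<in> series \<Longrightarrow> sneg f \<in> series"
  by (rule seriesI[OF _ series_well_ordered]) (auto simp: sneg_def)

lemma finite_conv_index:
  assumes f: "f \<in> series" and h: "h \<in> series" and q: "q \<in> carrier Q"
  shows "finite {x. f x \<noteq> \<zero> \<and> h (inv\<^bsub>Q\<^esub> x \<otimes>\<^bsub>Q\<^esub> q) \<noteq> \<zero>}"
  using Q.finite_factorizations[OF series_well_ordered[OF f] series_well_ordered[OF h] q]
  by simp

text \<open>Allows sums with different supports to be taken over one common finite index
  set.\<close>

lemma conv_eq:
  assumes f: "f \<in> series" and h: "h \<in> series" and q: "q \<in> carrier Q" and A: "finite A"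
    and sub: "\<And>x. f x \<noteq> \<zero> \<Longrightarrow> h (inv\<^bsub>Q\<^esub> x \<otimes>\<^bsub>Q\<^esub> q) \<noteq> \<zero> \<Longrightarrow> x \<in> A"
  shows "(f \<star> h) q = (\<Oplus>x\<in>A. f x \<otimes> h (inv\<^bsub>Q\<^esub> x \<otimes>\<^bsub>Q\<^esub> q))"
  unfolding conv_def using q f h
  by (simp, intro D.finsum_support[OF A]) (use sub in auto)

lemma conv_nonzeroE:
  assumes f: "f \<in> series" and h: "h \<in> series" and "(f \<star> h) q \<noteq> \<zero>"
  obtains x where "q \<in> carrier Q" "f x \<noteq> \<zero>" "h (inv\<^bsub>Q\<^esub> x \<otimes>\<^bsub>Q\<^esub> q) \<noteq> \<zero>"
proof -
  have q: "q \<in> carrier Q" using assms by (auto simp: conv_def split: if_splits)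
  have "{x. f x \<noteq> \<zero> \<and> h (inv\<^bsub>Q\<^esub> x \<otimes>\<^bsub>Q\<^esub> q) \<noteq> \<zero>} \<noteq> {}"
  proof
    assume *: "{x. f x \<noteq> \<zero> \<and> h (inv\<^bsub>Q\<^esub> x \<otimes>\<^bsub>Q\<^esub> q) \<noteq> \<zero>} = {}"
    have "(f \<star> h) q = \<zero>" unfolding conv_def * by simp
    then show False using assms by simp
  qed
  then show thesis using that q by blast
qed

lemma conv_supp:
  assumes f: "f \<in> series" and h: "h \<in> series" and "(f \<star> h) q \<noteq> \<zero>"
  shows "q \<in> {x. f x \<noteq> \<zero>} <#>\<^bsub>Q\<^esub> {x. h x \<noteq> \<zero>}"
proof -
  obtain x where x: "q \<in> carrier Q" "f x \<noteq> \<zero>" "h (inv\<^bsub>Q\<^esub> x \<otimes>\<^bsub>Q\<^esub> q) \<noteq> \<zero>"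
    using conv_nonzeroE[OF assms] .
  then have "q = x \<otimes>\<^bsub>Q\<^esub> (inv\<^bsub>Q\<^esub> x \<otimes>\<^bsub>Q\<^esub> q)"
    using series_supp_carrier[OF f] by (simp add: Q.m_assoc[symmetric])
  then show ?thesis using x unfolding set_mult_def by blast
qed

lemma conv_closed [simp]: "f \<in> series \<Longrightarrow> h \<in> series \<Longrightarrow> (f \<star> h) q \<in> carrier D"
  unfolding conv_def by (auto intro!: D.finsum_closed)

lemma conv_series:
  assumes f: "f \<in> series" and h: "h \<in> series"
  shows "f \<star> h \<in> series"
  by (rule seriesI[OF _ Q.well_ordered_mult[OF series_well_ordered[OF f] series_well_ordered[OF h]]])
    (use assms conv_supp in auto)

lemma conv_outside: "q \<notin> carrier Q \<Longrightarrow> (f \<star> h) q = \<zero>"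
  by (simp add: conv_def)

text \<open>Locality of the product in its second factor. Long division uses it to compare the limit
  of a chain of partial quotients with a single member.\<close>

lemma conv_cong_right:
  assumes "\<And>x. f x \<noteq> \<zero> \<Longrightarrow> g (inv\<^bsub>Q\<^esub> x \<otimes>\<^bsub>Q\<^esub> q) = h (inv\<^bsub>Q\<^esub> x \<otimes>\<^bsub>Q\<^esub> q)"
    and "f \<in> series" "h \<in> series"
  shows "(f \<star> g) q = (f \<star> h) q"
proof -
  have "{x. f x \<noteq> \<zero> \<and> g (inv\<^bsub>Q\<^esub> x \<otimes>\<^bsub>Q\<^esub> q) \<noteq> \<zero>} = {x. f x \<noteq> \<zero> \<and> h (inv\<^bsub>Q\<^esub> x \<otimes>\<^bsub>Q\<^esub> q) \<noteq> \<zero>}"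
    using assms(1) by auto
  then show ?thesis
    unfolding conv_def using assms by (auto intro!: D.finsum_cong')
qed

lemma sadd_conv:
  assumes "f \<in> series" "g \<in> series" "h \<in> series"
  shows "sadd f g \<star> h = sadd (f \<star> h) (g \<star> h)"
proof
  fix q
  show "(sadd f g \<star> h) q = sadd (f \<star> h) (g \<star> h) q"
  proof (cases "q \<in> carrier Q")
    case True
    define A where "A = {x. f x \<noteq> \<zero> \<and> h (inv\<^bsub>Q\<^esub> x \<otimes>\<^bsub>Q\<^esub> q) \<noteq> \<zero>} \<union>
      {x. g x \<noteq> \<zero> \<and> h (inv\<^bsub>Q\<^esub> x \<otimes>\<^bsub>Q\<^esub> q) \<noteq> \<zero>}"
    have A: "finite A" unfolding A_def using finite_conv_index True assms by blast
    have "(sadd f g \<star> h) q = (\<Oplus>x\<in>A. sadd f g x \<otimes> h (inv\<^bsub>Q\<^esub> x \<otimes>\<^bsub>Q\<^esub> q))"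
      using assms True A sadd_series by (intro conv_eq) (auto simp: A_def sadd_def)
    also have "\<dots> = (\<Oplus>x\<in>A. f x \<otimes> h (inv\<^bsub>Q\<^esub> x \<otimes>\<^bsub>Q\<^esub> q) \<oplus> g x \<otimes> h (inv\<^bsub>Q\<^esub> x \<otimes>\<^bsub>Q\<^esub> q))"
      using assms by (simp add: sadd_def D.l_distr)
    also have "\<dots> = (\<Oplus>x\<in>A. f x \<otimes> h (inv\<^bsub>Q\<^esub> x \<otimes>\<^bsub>Q\<^esub> q)) \<oplus> (\<Oplus>x\<in>A. g x \<otimes> h (inv\<^bsub>Q\<^esub> x \<otimes>\<^bsub>Q\<^esub> q))"
      using assms by (intro D.finsum_addf) auto
    also have "(\<Oplus>x\<in>A. f x \<otimes> h (inv\<^bsub>Q\<^esub> x \<otimes>\<^bsub>Q\<^esub> q)) = (f \<star> h) q"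
      using assms True A by (intro conv_eq[symmetric]) (auto simp: A_def)
    also have "(\<Oplus>x\<in>A. g x \<otimes> h (inv\<^bsub>Q\<^esub> x \<otimes>\<^bsub>Q\<^esub> q)) = (g \<star> h) q"
      using assms True A by (intro conv_eq[symmetric]) (auto simp: A_def)
    finally show ?thesis by (simp add: sadd_def)
  qed (simp add: conv_outside sadd_def)
qed

lemma conv_sadd:
  assumes "f \<in> series" "g \<in> series" "h \<in> series"
  shows "f \<star> sadd g h = sadd (f \<star> g) (f \<star> h)"
proof
  fix q
  show "(f \<star> sadd g h) q = sadd (f \<star> g) (f \<star> h) q"
  proof (cases "q \<in> carrier Q")
    case True
    define A where "A = {x. f x \<noteq> \<zero> \<and> g (inv\<^bsub>Q\<^esub> x \<otimes>\<^bsub>Q\<^esub> q) \<noteq> \<zero>} \<union>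
      {x. f x \<noteq> \<zero> \<and> h (inv\<^bsub>Q\<^esub> x \<otimes>\<^bsub>Q\<^esub> q) \<noteq> \<zero>}"
    have A: "finite A" unfolding A_def using finite_conv_index True assms by blast
    have "(f \<star> sadd g h) q = (\<Oplus>x\<in>A. f x \<otimes> sadd g h (inv\<^bsub>Q\<^esub> x \<otimes>\<^bsub>Q\<^esub> q))"
      using assms True A sadd_series by (intro conv_eq) (auto simp: A_def sadd_def)
    also have "\<dots> = (\<Oplus>x\<in>A. f x \<otimes> g (inv\<^bsub>Q\<^esub> x \<otimes>\<^bsub>Q\<^esub> q) \<oplus> f x \<otimes> h (inv\<^bsub>Q\<^esub> x \<otimes>\<^bsub>Q\<^esub> q))"
      using assms by (simp add: sadd_def D.r_distr)
    also have "\<dots> = (\<Oplus>x\<in>A. f x \<otimes> g (inv\<^bsub>Q\<^esub> x \<otimes>\<^bsub>Q\<^esub> q)) \<oplus> (\<Oplus>x\<in>A. f x \<otimes> h (inv\<^bsub>Q\<^esub> x \<otimes>\<^bsub>Q\<^esub> q))"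
      using assms by (intro D.finsum_addf) auto
    also have "(\<Oplus>x\<in>A. f x \<otimes> g (inv\<^bsub>Q\<^esub> x \<otimes>\<^bsub>Q\<^esub> q)) = (f \<star> g) q"
      using assms True A by (intro conv_eq[symmetric]) (auto simp: A_def)
    also have "(\<Oplus>x\<in>A. f x \<otimes> h (inv\<^bsub>Q\<^esub> x \<otimes>\<^bsub>Q\<^esub> q)) = (f \<star> h) q"
      using assms True A by (intro conv_eq[symmetric]) (auto simp: A_def)
    finally show ?thesis by (simp add: sadd_def)
  qed (simp add: conv_outside sadd_def)
qed

lemma sneg_conv:
  assumes "f \<in> series" "h \<in> series"
  shows "sneg f \<star> h = sneg (f \<star> h)"
proof
  fix q
  have "sadd f (sneg f) = (\<lambda>_. \<zero>)"
    using assms by (auto simp: sadd_def sneg_def D.r_neg)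
  moreover have "(\<lambda>_. \<zero>) \<star> h = (\<lambda>_. \<zero>)"
    by (auto simp: conv_def)
  ultimately have "sadd (f \<star> h) (sneg f \<star> h) q = \<zero>"
    using sadd_conv[OF assms(1) sneg_series[OF assms(1)] assms(2)] by metis
  then show "(sneg f \<star> h) q = sneg (f \<star> h) q"
    using D.minus_equality[of "(sneg f \<star> h) q" "(f \<star> h) q"] assms sneg_series
    by (simp add: sadd_def sneg_def[of "f \<star> h"] D.a_comm)
qed

text \<open>A triple product is indexed by its first factor \<open>y\<close> and the partial product
  \<open>x\<close> of its first two factors. The sets \<open>Y\<close> and \<open>Z\<close> of
  admissible values are finite, because a product of two supports is again well-ordered; the two
  sums may therefore be exchanged.\<close>

lemma conv_assoc:
  assumes f: "f \<in> series" and g: "g \<in> series" and h: "h \<in> series"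
  shows "(f \<star> g) \<star> h = f \<star> (g \<star> h)"
proof
  fix q
  show "((f \<star> g) \<star> h) q = (f \<star> (g \<star> h)) q"
  proof (cases "q \<in> carrier Q")
    case q: True
    let ?F = "{x. f x \<noteq> \<zero>}" and ?G = "{x. g x \<noteq> \<zero>}" and ?H = "{x. h x \<noteq> \<zero>}"
    note wo = series_well_ordered[OF f] series_well_ordered[OF g] series_well_ordered[OF h]
    define Y where "Y = {y \<in> ?F. inv\<^bsub>Q\<^esub> y \<otimes>\<^bsub>Q\<^esub> q \<in> ?G <#>\<^bsub>Q\<^esub> ?H}"
    define Z where "Z = {x \<in> ?F <#>\<^bsub>Q\<^esub> ?G. inv\<^bsub>Q\<^esub> x \<otimes>\<^bsub>Q\<^esub> q \<in> ?H}"
    have finY: "finite Y" unfolding Y_def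
      using Q.finite_factorizations[OF wo(1) Q.well_ordered_mult[OF wo(2,3)] q] .
    have finZ: "finite Z" unfolding Z_def
      using Q.finite_factorizations[OF Q.well_ordered_mult[OF wo(1,2)] wo(3) q] .
    have Yc: "y \<in> carrier Q" if "y \<in> Y" for y
      using that series_supp_carrier[OF f] by (auto simp: Y_def)
    have Zc: "x \<in> carrier Q" if "x \<in> Z" for x
      using that Q.well_orderedD[OF Q.well_ordered_mult[OF wo(1,2)]] by (auto simp: Z_def)
    have "((f \<star> g) \<star> h) q = (\<Oplus>x\<in>Z. (f \<star> g) x \<otimes> h (inv\<^bsub>Q\<^esub> x \<otimes>\<^bsub>Q\<^esub> q))"
      using conv_series[OF f g] h q finZ
      by (rule conv_eq) (use conv_supp[OF f g] in \<open>auto simp: Z_def\<close>)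
    also have "\<dots> = (\<Oplus>x\<in>Z. \<Oplus>y\<in>Y. f y \<otimes> (g (inv\<^bsub>Q\<^esub> y \<otimes>\<^bsub>Q\<^esub> x) \<otimes> h (inv\<^bsub>Q\<^esub> x \<otimes>\<^bsub>Q\<^esub> q)))"
    proof (rule D.finsum_cong'[OF refl])
      fix x assume x: "x \<in> Z"
      have "(f \<star> g) x = (\<Oplus>y\<in>Y. f y \<otimes> g (inv\<^bsub>Q\<^esub> y \<otimes>\<^bsub>Q\<^esub> x))"
      proof (rule conv_eq[OF f g Zc[OF x] finY])
        fix y assume y: "f y \<noteq> \<zero>" "g (inv\<^bsub>Q\<^esub> y \<otimes>\<^bsub>Q\<^esub> x) \<noteq> \<zero>"
        then have yc: "y \<in> carrier Q" using series_supp_carrier[OF f] by blast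
        have "inv\<^bsub>Q\<^esub> y \<otimes>\<^bsub>Q\<^esub> q = (inv\<^bsub>Q\<^esub> y \<otimes>\<^bsub>Q\<^esub> x) \<otimes>\<^bsub>Q\<^esub> (inv\<^bsub>Q\<^esub> x \<otimes>\<^bsub>Q\<^esub> q)"
          using yc Zc[OF x] q by (metis Q.inv_closed Q.inv_solve_left Q.m_assoc Q.m_closed)
        then have "inv\<^bsub>Q\<^esub> y \<otimes>\<^bsub>Q\<^esub> q \<in> ?G <#>\<^bsub>Q\<^esub> ?H"
          using y x unfolding set_mult_def Z_def by blast
        then show "y \<in> Y" using y by (simp add: Y_def)
      qed
      then have "(f \<star> g) x \<otimes> h (inv\<^bsub>Q\<^esub> x \<otimes>\<^bsub>Q\<^esub> q) =
          (\<Oplus>y\<in>Y. f y \<otimes> g (inv\<^bsub>Q\<^esub> y \<otimes>\<^bsub>Q\<^esub> x) \<otimes> h (inv\<^bsub>Q\<^esub> x \<otimes>\<^bsub>Q\<^esub> q))"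
        using f g h by (simp add: D.finsum_ldistr[OF finY])
      then show "(f \<star> g) x \<otimes> h (inv\<^bsub>Q\<^esub> x \<otimes>\<^bsub>Q\<^esub> q) =
          (\<Oplus>y\<in>Y. f y \<otimes> (g (inv\<^bsub>Q\<^esub> y \<otimes>\<^bsub>Q\<^esub> x) \<otimes> h (inv\<^bsub>Q\<^esub> x \<otimes>\<^bsub>Q\<^esub> q)))"
        using f g h by (simp add: D.m_assoc)
    qed (use f g h in auto)
    also have "\<dots> = (\<Oplus>y\<in>Y. \<Oplus>x\<in>Z. f y \<otimes> (g (inv\<^bsub>Q\<^esub> y \<otimes>\<^bsub>Q\<^esub> x) \<otimes> h (inv\<^bsub>Q\<^esub> x \<otimes>\<^bsub>Q\<^esub> q)))"
      using f g h by (intro D.finsum_swap finY finZ) auto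
    also have "\<dots> = (\<Oplus>y\<in>Y. f y \<otimes> (g \<star> h) (inv\<^bsub>Q\<^esub> y \<otimes>\<^bsub>Q\<^esub> q))"
    proof (rule D.finsum_cong'[OF refl])
      fix y assume y: "y \<in> Y"
      have inj: "inj_on (\<lambda>x. inv\<^bsub>Q\<^esub> y \<otimes>\<^bsub>Q\<^esub> x) Z"
        using Yc[OF y] Zc by (auto intro!: inj_onI)
      \<comment> \<open>The substitution \<open>z = inv y \<otimes> x\<close> turns factorizations
        of \<open>inv y \<otimes> q\<close> into partial products \<open>x\<close> in
        \<open>Z\<close>.\<close>
      have "(g \<star> h) (inv\<^bsub>Q\<^esub> y \<otimes>\<^bsub>Q\<^esub> q) = (\<Oplus>z\<in>(\<lambda>x. inv\<^bsub>Q\<^esub> y \<otimes>\<^bsub>Q\<^esub> x) ` Z.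
          g z \<otimes> h (inv\<^bsub>Q\<^esub> z \<otimes>\<^bsub>Q\<^esub> (inv\<^bsub>Q\<^esub> y \<otimes>\<^bsub>Q\<^esub> q)))"
      proof (rule conv_eq[OF g h])
        fix z assume z: "g z \<noteq> \<zero>" "h (inv\<^bsub>Q\<^esub> z \<otimes>\<^bsub>Q\<^esub> (inv\<^bsub>Q\<^esub> y \<otimes>\<^bsub>Q\<^esub> q)) \<noteq> \<zero>"
        then have zc: "z \<in> carrier Q" using series_supp_carrier[OF g] by blast
        have "inv\<^bsub>Q\<^esub> (y \<otimes>\<^bsub>Q\<^esub> z) \<otimes>\<^bsub>Q\<^esub> q = inv\<^bsub>Q\<^esub> z \<otimes>\<^bsub>Q\<^esub> (inv\<^bsub>Q\<^esub> y \<otimes>\<^bsub>Q\<^esub> q)"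
          using zc Yc[OF y] q by (simp add: Q.inv_mult_group Q.m_assoc)
        moreover have "y \<otimes>\<^bsub>Q\<^esub> z \<in> ?F <#>\<^bsub>Q\<^esub> ?G"
          using y z unfolding set_mult_def Y_def by blast
        ultimately have "y \<otimes>\<^bsub>Q\<^esub> z \<in> Z" using z by (simp add: Z_def)
        moreover have "z = inv\<^bsub>Q\<^esub> y \<otimes>\<^bsub>Q\<^esub> (y \<otimes>\<^bsub>Q\<^esub> z)"
          using zc Yc[OF y] by (simp add: Q.m_assoc[symmetric])
        ultimately show "z \<in> (\<lambda>x. inv\<^bsub>Q\<^esub> y \<otimes>\<^bsub>Q\<^esub> x) ` Z" by blast
      qed (use Yc[OF y] q finZ in auto)
      also have "\<dots> = (\<Oplus>x\<in>Z. g (inv\<^bsub>Q\<^esub> y \<otimes>\<^bsub>Q\<^esub> x) \<otimes>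
          h (inv\<^bsub>Q\<^esub> (inv\<^bsub>Q\<^esub> y \<otimes>\<^bsub>Q\<^esub> x) \<otimes>\<^bsub>Q\<^esub> (inv\<^bsub>Q\<^esub> y \<otimes>\<^bsub>Q\<^esub> q)))"
        using g h by (intro D.finsum_reindex[OF _ inj]) auto
      also have "\<dots> = (\<Oplus>x\<in>Z. g (inv\<^bsub>Q\<^esub> y \<otimes>\<^bsub>Q\<^esub> x) \<otimes> h (inv\<^bsub>Q\<^esub> x \<otimes>\<^bsub>Q\<^esub> q))"
      proof (rule D.finsum_cong'[OF refl])
        fix x assume x: "x \<in> Z"
        have "inv\<^bsub>Q\<^esub> (inv\<^bsub>Q\<^esub> y \<otimes>\<^bsub>Q\<^esub> x) \<otimes>\<^bsub>Q\<^esub> (inv\<^bsub>Q\<^esub> y \<otimes>\<^bsub>Q\<^esub> q) =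
            inv\<^bsub>Q\<^esub> x \<otimes>\<^bsub>Q\<^esub> (y \<otimes>\<^bsub>Q\<^esub> inv\<^bsub>Q\<^esub> y) \<otimes>\<^bsub>Q\<^esub> q"
          using Zc[OF x] Yc[OF y] q
          by (simp only: Q.inv_mult_group Q.m_assoc Q.inv_closed Q.inv_inv Q.m_closed)
        then show "g (inv\<^bsub>Q\<^esub> y \<otimes>\<^bsub>Q\<^esub> x) \<otimes> h (inv\<^bsub>Q\<^esub> (inv\<^bsub>Q\<^esub> y \<otimes>\<^bsub>Q\<^esub> x) \<otimes>\<^bsub>Q\<^esub> (inv\<^bsub>Q\<^esub> y \<otimes>\<^bsub>Q\<^esub> q)) =
            g (inv\<^bsub>Q\<^esub> y \<otimes>\<^bsub>Q\<^esub> x) \<otimes> h (inv\<^bsub>Q\<^esub> x \<otimes>\<^bsub>Q\<^esub> q)"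
          using Zc[OF x] Yc[OF y] by simp
      qed (use g h in auto)
      finally show "(\<Oplus>x\<in>Z. f y \<otimes> (g (inv\<^bsub>Q\<^esub> y \<otimes>\<^bsub>Q\<^esub> x) \<otimes> h (inv\<^bsub>Q\<^esub> x \<otimes>\<^bsub>Q\<^esub> q))) =
          f y \<otimes> (g \<star> h) (inv\<^bsub>Q\<^esub> y \<otimes>\<^bsub>Q\<^esub> q)"
        using f g h by (simp add: D.finsum_rdistr[OF finZ])
    qed (use f g h in auto)
    also have "\<dots> = (f \<star> (g \<star> h)) q"
      using f conv_series[OF g h] q finY
      by (rule conv_eq[symmetric]) (use conv_supp[OF g h] in \<open>auto simp: Y_def\<close>)
    finally show ?thesis .
  qed (simp add: conv_outside)
qed

lemma mono_conv:
  assumes p: "p \<in> carrier Q" and d: "d \<in> carrier D" and f: "f \<in> series" and q: "q \<in> carrier Q"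
  shows "(mono p d \<star> f) q = d \<otimes> f (inv\<^bsub>Q\<^esub> p \<otimes>\<^bsub>Q\<^esub> q)"
proof -
  have "(mono p d \<star> f) q = (\<Oplus>x\<in>{p}. mono p d x \<otimes> f (inv\<^bsub>Q\<^esub> x \<otimes>\<^bsub>Q\<^esub> q))"
    using mono_series[OF p d] f q by (rule conv_eq) (auto simp: mono_def split: if_splits)
  then show ?thesis using d f by (simp add: mono_def)
qed

lemma conv_mono:
  assumes p: "p \<in> carrier Q" and d: "d \<in> carrier D" and f: "f \<in> series" and q: "q \<in> carrier Q"
  shows "(f \<star> mono p d) q = f (q \<otimes>\<^bsub>Q\<^esub> inv\<^bsub>Q\<^esub> p) \<otimes> d"
proof -
  have solve: "inv\<^bsub>Q\<^esub> x \<otimes>\<^bsub>Q\<^esub> q = p \<longleftrightarrow> x = q \<otimes>\<^bsub>Q\<^esub> inv\<^bsub>Q\<^esub> p" if "x \<in> carrier Q" for x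
    using that p q
    by (metis Q.inv_closed Q.inv_inv Q.inv_solve_left' Q.inv_solve_right)
  have "(f \<star> mono p d) q =
      (\<Oplus>x\<in>{q \<otimes>\<^bsub>Q\<^esub> inv\<^bsub>Q\<^esub> p}. f x \<otimes> mono p d (inv\<^bsub>Q\<^esub> x \<otimes>\<^bsub>Q\<^esub> q))"
    using f mono_series[OF p d] q
    by (rule conv_eq) (use solve series_supp_carrier[OF f] in \<open>auto simp: mono_def split: if_splits\<close>)
  then show ?thesis using d f p q solve[of "q \<otimes>\<^bsub>Q\<^esub> inv\<^bsub>Q\<^esub> p"] by (simp add: mono_def)
qed

lemma sone_conv:
  assumes f: "f \<in> series"
  shows "sone \<star> f = f"
proof
  fix q
  show "(sone \<star> f) q = f q"
    using mono_conv[OF Q.one_closed D.one_closed f, of q] f series_supp_carrier[OF f, of q]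
    by (cases "q \<in> carrier Q") (simp, metis conv_outside)
qed

lemma conv_sone:
  assumes f: "f \<in> series"
  shows "f \<star> sone = f"
proof
  fix q
  show "(f \<star> sone) q = f q"
    using conv_mono[OF Q.one_closed D.one_closed f, of q] f series_supp_carrier[OF f, of q]
    by (cases "q \<in> carrier Q") (simp, metis conv_outside)
qed

text \<open>Only the pair of least positions contributes at their product: a larger left factor,
  together with a right factor that is at least \<open>r\<close>, would give a larger
  product.\<close>

lemma conv_least_value:
  assumes f: "f \<in> series" and h: "h \<in> series" and p: "is_least f p" and r: "is_least h r"
  shows "(f \<star> h) (p \<otimes>\<^bsub>Q\<^esub> r) = f p \<otimes> h r"
proof -
  have pc: "p \<in> carrier Q" and rc: "r \<in> carrier Q"
    using p r series_supp_carrier f h by (auto simp: is_least_def)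
  have "(f \<star> h) (p \<otimes>\<^bsub>Q\<^esub> r) = (\<Oplus>x\<in>{p}. f x \<otimes> h (inv\<^bsub>Q\<^esub> x \<otimes>\<^bsub>Q\<^esub> (p \<otimes>\<^bsub>Q\<^esub> r)))"
  proof (rule conv_eq[OF f h])
    fix x assume x: "f x \<noteq> \<zero>" "h (inv\<^bsub>Q\<^esub> x \<otimes>\<^bsub>Q\<^esub> (p \<otimes>\<^bsub>Q\<^esub> r)) \<noteq> \<zero>"
    let ?y = "inv\<^bsub>Q\<^esub> x \<otimes>\<^bsub>Q\<^esub> (p \<otimes>\<^bsub>Q\<^esub> r)"
    have xc: "x \<in> carrier Q" using series_supp_carrier[OF f x(1)] .
    then have yc: "?y \<in> carrier Q" using pc rc by simp
    have xy: "x \<otimes>\<^bsub>Q\<^esub> ?y = p \<otimes>\<^bsub>Q\<^esub> r" using xc pc rc by (simp add: Q.m_assoc[symmetric])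
    have "x = p \<or> p \<sqsubset> x" and "?y = r \<or> r \<sqsubset> ?y" using x p r by (auto simp: is_least_def)
    moreover have False if "p \<sqsubset> x"
    proof -
      have 1: "p \<otimes>\<^bsub>Q\<^esub> r \<sqsubset> x \<otimes>\<^bsub>Q\<^esub> r" using that pc xc rc by (rule Q.lt_mult_right)
      have "x \<otimes>\<^bsub>Q\<^esub> r = x \<otimes>\<^bsub>Q\<^esub> ?y \<or> x \<otimes>\<^bsub>Q\<^esub> r \<sqsubset> x \<otimes>\<^bsub>Q\<^esub> ?y"
        using \<open>?y = r \<or> r \<sqsubset> ?y\<close> Q.lt_mult_left rc yc xc by auto
      then show False
        unfolding xy using 1 Q.lt_irrefl[of "p \<otimes>\<^bsub>Q\<^esub> r"]
          Q.lt_trans[OF 1, of "p \<otimes>\<^bsub>Q\<^esub> r"] pc xc rc by auto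
    qed
    ultimately show "x \<in> {p}" by blast
  qed (use pc rc in auto)
  then show ?thesis using f h pc rc by (simp add: Q.m_assoc[symmetric])
qed

lemma is_least_conv:
  assumes f: "f \<in> series" and h: "h \<in> series" and p: "is_least f p" and r: "is_least h r"
  shows "is_least (f \<star> h) (p \<otimes>\<^bsub>Q\<^esub> r)"
  unfolding is_least_def
proof (intro conjI allI impI)
  have pc: "p \<in> carrier Q" and rc: "r \<in> carrier Q"
    using p r series_supp_carrier f h by (auto simp: is_least_def)
  show "(f \<star> h) (p \<otimes>\<^bsub>Q\<^esub> r) \<noteq> \<zero>"
    using conv_least_value[OF assms] D.skew_integral[of "f p" "h r"] f h p r
    by (auto simp: is_least_def)
  fix q assume "(f \<star> h) q \<noteq> \<zero>"
  then obtain x where x: "q \<in> carrier Q" "f x \<noteq> \<zero>" "h (inv\<^bsub>Q\<^esub> x \<otimes>\<^bsub>Q\<^esub> q) \<noteq> \<zero>"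
    using conv_nonzeroE[OF f h] by blast
  let ?y = "inv\<^bsub>Q\<^esub> x \<otimes>\<^bsub>Q\<^esub> q"
  have xc: "x \<in> carrier Q" using series_supp_carrier[OF f x(2)] .
  then have yc: "?y \<in> carrier Q" using x by simp
  have xy: "x \<otimes>\<^bsub>Q\<^esub> ?y = q" using xc x(1) by (simp add: Q.m_assoc[symmetric])
  have "x = p \<or> p \<sqsubset> x" and "?y = r \<or> r \<sqsubset> ?y" using x p r by (auto simp: is_least_def)
  then have 1: "p \<otimes>\<^bsub>Q\<^esub> r = x \<otimes>\<^bsub>Q\<^esub> r \<or> p \<otimes>\<^bsub>Q\<^esub> r \<sqsubset> x \<otimes>\<^bsub>Q\<^esub> r"
    and 2: "x \<otimes>\<^bsub>Q\<^esub> r = q \<or> x \<otimes>\<^bsub>Q\<^esub> r \<sqsubset> q"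
    using Q.lt_mult_right[OF _ pc xc rc] Q.lt_mult_left[OF _ rc yc xc] xy by auto
  then show "q = p \<otimes>\<^bsub>Q\<^esub> r \<or> p \<otimes>\<^bsub>Q\<^esub> r \<sqsubset> q"
    using Q.lt_trans[of "p \<otimes>\<^bsub>Q\<^esub> r" "x \<otimes>\<^bsub>Q\<^esub> r" q] pc rc xc x(1) by auto
qed

text \<open>The product of two least terms is a nonzero term of the product, as \<open>D\<close> has
  no zero divisors.\<close>

lemma conv_eq_zero:
  assumes f: "f \<in> series" and h: "h \<in> series" and z: "f \<star> h = (\<lambda>_. \<zero>)"
  shows "f = (\<lambda>_. \<zero>) \<or> h = (\<lambda>_. \<zero>)"
proof (rule ccontr)
  assume "\<not> ?thesis"
  then obtain x y where "f x \<noteq> \<zero>" "h y \<noteq> \<zero>" by (metis ext)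
  then obtain p r where "is_least f p" "is_least h r"
    using is_least_exists[OF f] is_least_exists[OF h] by metis
  from is_least_conv[OF f h this] show False by (simp add: z is_least_def)
qed

end

text \<open>The predicate asks for closure properties only. Hence it covers the constant family
  \<open>carrier D\<close>, where degrees carry no information, as well as the components of
  coefficient rings with few inverses.\<close>

definition grading ::
    "('a, 'm) ring_scheme \<Rightarrow> ('q, 'n) monoid_scheme \<Rightarrow> ('q \<Rightarrow> 'a set) \<Rightarrow> bool" where
  "grading D Q V \<longleftrightarrow>
     (\<forall>q\<in>carrier Q. V q \<subseteq> carrier D \<and> \<zero>\<^bsub>D\<^esub> \<in> V q \<and>
        (\<forall>x\<in>V q. \<ominus>\<^bsub>D\<^esub> x \<in> V q \<and> (\<forall>y\<in>V q. x \<oplus>\<^bsub>D\<^esub> y \<in> V q))) \<and>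
     (\<forall>p\<in>carrier Q. \<forall>q\<in>carrier Q. \<forall>x\<in>V p. \<forall>y\<in>V q. x \<otimes>\<^bsub>D\<^esub> y \<in> V (p \<otimes>\<^bsub>Q\<^esub> q)) \<and>
     \<one>\<^bsub>D\<^esub> \<in> V \<one>\<^bsub>Q\<^esub>"

lemma gradingD:
  assumes "grading D Q V"
  shows "\<And>q x. q \<in> carrier Q \<Longrightarrow> x \<in> V q \<Longrightarrow> x \<in> carrier D"
    "\<And>q. q \<in> carrier Q \<Longrightarrow> \<zero>\<^bsub>D\<^esub> \<in> V q"
    "\<And>q x. q \<in> carrier Q \<Longrightarrow> x \<in> V q \<Longrightarrow> \<ominus>\<^bsub>D\<^esub> x \<in> V q"
    "\<And>q x y. q \<in> carrier Q \<Longrightarrow> x \<in> V q \<Longrightarrow> y \<in> V q \<Longrightarrow> x \<oplus>\<^bsub>D\<^esub> y \<in> V q"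
    "\<And>p q x y. p \<in> carrier Q \<Longrightarrow> q \<in> carrier Q \<Longrightarrow> x \<in> V p \<Longrightarrow> y \<in> V q \<Longrightarrow>
       x \<otimes>\<^bsub>D\<^esub> y \<in> V (p \<otimes>\<^bsub>Q\<^esub> q)"
    "\<one>\<^bsub>D\<^esub> \<in> V \<one>\<^bsub>Q\<^esub>"
  using assms unfolding grading_def by blast+

section \<open>Long division of series within a grading\<close>

context series_ring
begin

definition series_in :: "('q \<Rightarrow> 'a set) \<Rightarrow> ('q \<Rightarrow> 'a) set" where
  "series_in V = {f \<in> series. \<forall>q\<in>carrier Q. f q \<in> V q}"

lemma series_inD: "f \<in> series_in V \<Longrightarrow> f \<in> series"
    "f \<in> series_in V \<Longrightarrow> q \<in> carrier Q \<Longrightarrow> f q \<in> V q"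
  by (auto simp: series_in_def)

lemma series_inI: "f \<in> series \<Longrightarrow> (\<And>q. q \<in> carrier Q \<Longrightarrow> f q \<in> V q) \<Longrightarrow> f \<in> series_in V"
  by (auto simp: series_in_def)

lemma sadd_series_in:
  "grading D Q V \<Longrightarrow> f \<in> series_in V \<Longrightarrow> g \<in> series_in V \<Longrightarrow> sadd f g \<in> series_in V"
  by (rule series_inI, blast intro: sadd_series series_inD(1))
    (simp add: sadd_def series_inD(2) gradingD(4))

lemma sneg_series_in: "grading D Q V \<Longrightarrow> f \<in> series_in V \<Longrightarrow> sneg f \<in> series_in V"
  by (rule series_inI, blast intro: sneg_series series_inD(1))
    (simp add: sneg_def series_inD(2) gradingD(3))

lemma mono_series_in:
  assumes V: "grading D Q V" and "p \<in> carrier Q" "d \<in> V p"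
  shows "mono p d \<in> series_in V"
  using assms gradingD(1,2)[OF V]
  by (intro series_inI mono_series) (auto simp: mono_def)

lemma conv_series_in:
  assumes V: "grading D Q V" and f: "f \<in> series_in V" and g: "g \<in> series_in V"
  shows "f \<star> g \<in> series_in V"
proof (rule series_inI)
  note fs = series_inD[OF f] and gs = series_inD[OF g]
  show "f \<star> g \<in> series" using fs(1) gs(1) by (rule conv_series)
  fix q assume q: "q \<in> carrier Q"
  have "f x \<otimes> g (inv\<^bsub>Q\<^esub> x \<otimes>\<^bsub>Q\<^esub> q) \<in> V q" if "f x \<noteq> \<zero>" for x
  proof -
    have x: "x \<in> carrier Q" using series_supp_carrier[OF fs(1) that] .
    have "f x \<otimes> g (inv\<^bsub>Q\<^esub> x \<otimes>\<^bsub>Q\<^esub> q) \<in> V (x \<otimes>\<^bsub>Q\<^esub> (inv\<^bsub>Q\<^esub> x \<otimes>\<^bsub>Q\<^esub> q))"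
      using x q fs(2) gs(2) by (intro gradingD(5)[OF V]) auto
    then show ?thesis using x q by (simp add: Q.m_assoc[symmetric])
  qed
  then show "(f \<star> g) q \<in> V q"
    unfolding conv_def using q gradingD[OF V]
    by (simp, intro D.finsum_mem[of "V q"]) auto
qed

text \<open>Division by \<open>f\<close> proceeds by adding one term to a partial quotient \<open>g\<close> at a time. A partial
  quotient is required to satisfy \<open>p \<cdot> supp g < supp (1 - f \<star> g)\<close>, where \<open>p\<close> is the least element of
  the support of \<open>f\<close>; partial quotients are ordered by end extension, and Zorn's lemma replaces
  transfinite iteration.\<close>

lemma conv_right_inverse:
  assumes V: "grading D Q V" and f: "f \<in> series_in V" and p: "is_least f p"
    and inv_fp: "inv (f p) \<in> V (inv\<^bsub>Q\<^esub> p)"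
  shows "\<exists>g\<in>series_in V. f \<star> g = sone"
proof -
  note fs = series_inD(1)[OF f]
  have pc: "p \<in> carrier Q" and fp: "f p \<noteq> \<zero>" "f p \<in> carrier D"
    using p series_supp_carrier[OF fs] fs by (auto simp: is_least_def)
  define res where "res = (\<lambda>g. sadd sone (sneg (f \<star> g)))"
  have sone_in: "sone \<in> series_in V"
    using mono_series_in[OF V] gradingD(6)[OF V] by simp
  have res_in: "res g \<in> series_in V" if "g \<in> series_in V" for g
    unfolding res_def using that by (intro sadd_series_in sneg_series_in conv_series_in V sone_in f)
  define P where "P = {g \<in> series_in V. \<forall>q r. g q \<noteq> \<zero> \<longrightarrow> res g r \<noteq> \<zero> \<longrightarrow> p \<otimes>\<^bsub>Q\<^esub> q \<sqsubset> r}"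
  \<comment> \<open>End extension: wherever \<open>g'\<close> differs from \<open>g\<close>, the
    position lies beyond the whole support of \<open>g\<close>. In particular \<open>g'\<close>
    keeps the values of \<open>g\<close> on that support.\<close>
  define le where "le = (\<lambda>g g' :: 'q \<Rightarrow> 'a. \<forall>q. g' q \<noteq> g q \<longrightarrow> (\<forall>t. g t \<noteq> \<zero> \<longrightarrow> t \<sqsubset> q))"
  have Ps: "g \<in> series" if "g \<in> P" for g using that series_inD(1) by (auto simp: P_def)
  have le_val: "g' q = g q" if "le g g'" "g q \<noteq> \<zero>" "g \<in> P" for g g' q
    using that Q.lt_irrefl[OF series_supp_carrier[OF Ps]] unfolding le_def by blast
  have "\<exists>m\<in>P. \<forall>a\<in>P. le m a \<longrightarrow> a = m"
  proof (rule predicate_Zorn)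
    show "partial_order_on P (relation_of le P)"
    proof (rule partial_order_on_relation_ofI)
      show "le a a" for a by (simp add: le_def)
      show "le a c" if abc: "a \<in> P" "b \<in> P" "c \<in> P" "le a b" "le b c" for a b c
        unfolding le_def
      proof (intro allI impI)
        fix q t assume q: "c q \<noteq> a q" and t: "a t \<noteq> \<zero>"
        have "b t \<noteq> \<zero>" using le_val[OF abc(4) t abc(1)] t by simp
        moreover have "c q \<noteq> b q \<or> b q \<noteq> a q" using q by auto
        ultimately show "t \<sqsubset> q" using abc(4,5) t unfolding le_def by blast
      qed
      show "a = b" if ab: "a \<in> P" "b \<in> P" "le a b" "le b a" for a b
      proof
        fix q
        have "b q = a q" if "a q \<noteq> \<zero>" using le_val ab that by blast
        moreover have "a q = b q" if "b q \<noteq> \<zero>" using le_val ab that by blast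
        ultimately show "a q = b q" by metis
      qed
    qed
    fix C assume "C \<in> Chains (relation_of le P)"
    then have CP: "C \<subseteq> P" and total: "\<And>g h. g \<in> C \<Longrightarrow> h \<in> C \<Longrightarrow> le g h \<or> le h g"
      by (auto simp: Chains_def relation_of_def)
    \<comment> \<open>The union of the chain. Members that are nonzero at \<open>q\<close> agree
      there, so the choice is immaterial.\<close>
    define u where "u = (\<lambda>q. if \<exists>g\<in>C. g q \<noteq> \<zero> then (SOME g. g \<in> C \<and> g q \<noteq> \<zero>) q else \<zero>)"
    have u_val: "u q = g q" if g: "g \<in> C" "g q \<noteq> \<zero>" for g q
    proof -
      define h where "h = (SOME g. g \<in> C \<and> g q \<noteq> \<zero>)"
      have h: "h \<in> C" "h q \<noteq> \<zero>" using someI[of "\<lambda>g. g \<in> C \<and> g q \<noteq> \<zero>" g] g by (auto simp: h_def)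
      have "h q = g q" using total[OF g(1) h(1)] le_val g h CP by (metis subsetD)
      then show ?thesis using g by (auto simp: u_def h_def)
    qed
    have u_supp: "\<exists>g\<in>C. g q \<noteq> \<zero> \<and> u q = g q" if nz: "u q \<noteq> \<zero>" for q
    proof -
      obtain g where "g \<in> C" "g q \<noteq> \<zero>" using nz by (auto simp: u_def split: if_splits)
      then show ?thesis using u_val by blast
    qed
    \<comment> \<open>Every member of the chain is an initial piece of \<open>u\<close>.\<close>
    have le_u: "t \<sqsubset> q" if g: "g \<in> C" "u q \<noteq> g q" "g t \<noteq> \<zero>" for g q t
    proof -
      have "g q = \<zero>" using u_val g by metis
      then obtain h where h: "h \<in> C" "h q \<noteq> \<zero>" using u_supp g by metis
      then have neq: "h q \<noteq> g q" using \<open>g q = \<zero>\<close> by simp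
      then have "\<not> le h g" using le_val[of h g q] h CP by auto
      then have "le g h" using total g(1) h(1) by blast
      then show ?thesis using neq g(3) unfolding le_def by blast
    qed
    have u_series: "u \<in> series"
    proof (rule seriesI[OF _ _ CollectI])
      show "u q \<in> carrier D" for q
      proof (cases "u q = \<zero>")
        case False
        then obtain g where "g \<in> C" "u q = g q" using u_supp by blast
        then show ?thesis using CP Ps by (metis subsetD series_closed)
      qed simp
      show "Q.well_ordered {q. u q \<noteq> \<zero>}"
      proof (rule Q.well_orderedI)
        show "{q. u q \<noteq> \<zero>} \<subseteq> carrier Q"
        proof
          fix q assume "q \<in> {q. u q \<noteq> \<zero>}"
          then obtain g where "g \<in> C" "g q \<noteq> \<zero>" using u_supp by blast
          then show "q \<in> carrier Q" using CP Ps series_supp_carrier by blast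
        qed
        fix B assume B: "B \<subseteq> {q. u q \<noteq> \<zero>}" "B \<noteq> {}"
        then obtain t where "t \<in> B" "u t \<noteq> \<zero>" by blast
        then obtain g where g: "g \<in> C" "g t \<noteq> \<zero>" using u_supp by blast
        have gs: "g \<in> series" using g CP Ps by blast
        \<comment> \<open>What \<open>u\<close> has outside the support of \<open>g\<close> lies
          above that support. So the least element of \<open>B\<close> within the support of one
          member that meets \<open>B\<close> is least in all of \<open>B\<close>.\<close>
        show "\<exists>m\<in>B. \<forall>x\<in>B. \<not> x \<sqsubset> m"
        proof (rule Q.well_orderedE[OF series_well_ordered[OF gs], of "B \<inter> {q. g q \<noteq> \<zero>}"])
          show "B \<inter> {q. g q \<noteq> \<zero>} \<noteq> {}" using \<open>t \<in> B\<close> g by blast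
          fix m assume m: "m \<in> B \<inter> {q. g q \<noteq> \<zero>}"
            "\<And>x. x \<in> B \<inter> {q. g q \<noteq> \<zero>} \<Longrightarrow> x \<noteq> m \<Longrightarrow> m \<sqsubset> x"
          have mc: "m \<in> carrier Q" using m(1) series_supp_carrier[OF gs] by blast
          have "\<not> x \<sqsubset> m" if x: "x \<in> B" for x
          proof -
            have "u x \<noteq> \<zero>" using x B(1) by blast
            then obtain h where h: "h \<in> C" "h x \<noteq> \<zero>" using u_supp by blast
            have xc: "x \<in> carrier Q" using h CP Ps series_supp_carrier by blast
            have "x = m \<or> m \<sqsubset> x"
            proof (cases "g x = \<zero>")
              case True
              then show ?thesis using le_u[OF g(1), of x m] \<open>u x \<noteq> \<zero>\<close> m(1) by simp
            next
              case False
              then show ?thesis using m(2)[of x] x by blast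
            qed
            then show ?thesis using Q.lt_irrefl[OF mc] Q.lt_asym[of m x] mc xc by blast
          qed
          then show ?thesis using m(1) by blast
        qed simp
      qed
    qed
    have u_in: "u \<in> series_in V"
    proof (rule series_inI[OF u_series])
      fix q assume q: "q \<in> carrier Q"
      show "u q \<in> V q"
      proof (cases "u q = \<zero>")
        case True
        then show ?thesis using gradingD(2)[OF V q] by simp
      next
        case False
        then obtain g where "g \<in> C" "u q = g q" using u_supp by blast
        then show ?thesis using CP series_inD(2)[OF _ q] by (auto simp: P_def)
      qed
    qed
    have "u \<in> P"
      unfolding P_def
    proof (intro CollectI conjI u_in allI impI)
      fix q r assume q: "u q \<noteq> \<zero>" and r: "res u r \<noteq> \<zero>"
      obtain g where g: "g \<in> C" "g q \<noteq> \<zero>" using u_supp[OF q] by blast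
      have gs: "g \<in> series" using g CP Ps by blast
      have qc: "q \<in> carrier Q" using series_supp_carrier[OF gs g(2)] .
      have rc: "r \<in> carrier Q" using series_supp_carrier[OF series_inD(1)[OF res_in[OF u_in]] r] .
      show "p \<otimes>\<^bsub>Q\<^esub> q \<sqsubset> r"
      proof (rule ccontr)
        assume neg: "\<not> p \<otimes>\<^bsub>Q\<^esub> q \<sqsubset> r"
        \<comment> \<open>Where \<open>u\<close> and \<open>g\<close> differ, the position exceeds
          \<open>q\<close>, so its products with the support of \<open>f\<close> exceed
          \<open>p \<otimes> q\<close>. None of them is \<open>r\<close>, and the remainders of
          \<open>u\<close> and \<open>g\<close> agree at \<open>r\<close>.\<close>
        have "(f \<star> u) r = (f \<star> g) r"
        proof (rule conv_cong_right[OF _ fs gs], rule ccontr)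
          fix x assume x: "f x \<noteq> \<zero>"
            and ne: "u (inv\<^bsub>Q\<^esub> x \<otimes>\<^bsub>Q\<^esub> r) \<noteq> g (inv\<^bsub>Q\<^esub> x \<otimes>\<^bsub>Q\<^esub> r)"
          have xc: "x \<in> carrier Q" using series_supp_carrier[OF fs x] .
          have yc: "inv\<^bsub>Q\<^esub> x \<otimes>\<^bsub>Q\<^esub> r \<in> carrier Q" using xc rc by simp
          have "q \<sqsubset> inv\<^bsub>Q\<^esub> x \<otimes>\<^bsub>Q\<^esub> r" using le_u[OF g(1) ne g(2)] .
          then have "x \<otimes>\<^bsub>Q\<^esub> q \<sqsubset> x \<otimes>\<^bsub>Q\<^esub> (inv\<^bsub>Q\<^esub> x \<otimes>\<^bsub>Q\<^esub> r)"
            using qc yc xc by (rule Q.lt_mult_left)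
          then have 1: "x \<otimes>\<^bsub>Q\<^esub> q \<sqsubset> r" using xc rc by (simp add: Q.m_assoc[symmetric])
          have "x = p \<or> p \<otimes>\<^bsub>Q\<^esub> q \<sqsubset> x \<otimes>\<^bsub>Q\<^esub> q"
            using p x Q.lt_mult_right[OF _ pc xc qc] by (auto simp: is_least_def)
          then show False
            using 1 neg Q.lt_trans[OF _ 1, of "p \<otimes>\<^bsub>Q\<^esub> q"] pc qc xc rc by auto
        qed
        then have "res g r \<noteq> \<zero>" using r by (simp add: res_def sadd_def sneg_def)
        moreover have "g \<in> P" using g(1) CP by blast
        ultimately show False using neg g(2) unfolding P_def by blast
      qed
    qed
    then show "\<exists>u\<in>P. \<forall>a\<in>C. le a u"
      using le_u unfolding le_def by blast
  qed
  then obtain g where g: "g \<in> P" and max: "\<And>a. a \<in> P \<Longrightarrow> le g a \<Longrightarrow> a = g" by blast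
  have g_in: "g \<in> series_in V" using g by (simp add: P_def)
  note gs = series_inD(1)[OF g_in]
  have "res g s = \<zero>" for s
  proof (rule ccontr)
    assume "res g s \<noteq> \<zero>"
    then obtain r where r: "is_least (res g) r"
      using is_least_exists[OF series_inD(1)[OF res_in[OF g_in]]] by blast
    have rc: "r \<in> carrier Q"
      using r series_supp_carrier[OF series_inD(1)[OF res_in[OF g_in]]] by (auto simp: is_least_def)
    define q where "q = inv\<^bsub>Q\<^esub> p \<otimes>\<^bsub>Q\<^esub> r"
    have qc: "q \<in> carrier Q" and pq: "p \<otimes>\<^bsub>Q\<^esub> q = r"
      using pc rc by (auto simp: q_def Q.m_assoc[symmetric])
    \<comment> \<open>The leading term of the remainder divided from the left by that of
      \<open>f\<close>. The hypothesis on \<open>inv (f p)\<close> puts this new term into the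
      component of degree \<open>q\<close>.\<close>
    define c where "c = inv (f p) \<otimes> res g r"
    have cV: "c \<in> V q"
      unfolding c_def q_def using pc rc inv_fp series_inD(2)[OF res_in[OF g_in]]
      by (intro gradingD(5)[OF V]) auto
    have rr: "res g r \<in> carrier D" "res g r \<noteq> \<zero>"
      using series_inD(1)[OF res_in[OF g_in]] r by (auto simp: is_least_def)
    have cc: "c \<in> carrier D" using gradingD(1)[OF V qc cV] .
    have fpc: "f p \<otimes> c = res g r"
      unfolding c_def using fp rr by (simp add: D.m_assoc[symmetric] D.skew_r_inv D.skew_inv_closed)
    then have "c \<noteq> \<zero>" using rr fp by auto
    define m where "m = mono q c"
    have m_in: "m \<in> series_in V" unfolding m_def using mono_series_in[OF V qc cV] .
    note ms = series_inD(1)[OF m_in]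
    have m_least: "is_least m q" using \<open>c \<noteq> \<zero>\<close> by (auto simp: is_least_def m_def mono_def)
    \<comment> \<open>Cancelling \<open>p\<close> in the condition defining \<open>P\<close>,
      applied at the least position \<open>r\<close> of the remainder, puts \<open>q\<close> past
      the support of \<open>g\<close>; so adding a term at \<open>q\<close> is an end
      extension.\<close>
    have above: "t \<sqsubset> q" if "g t \<noteq> \<zero>" for t
    proof -
      have "p \<otimes>\<^bsub>Q\<^esub> t \<sqsubset> p \<otimes>\<^bsub>Q\<^esub> q" using g that rr(2) unfolding P_def pq by blast
      then show ?thesis
        using Q.lt_mult_left_iff[OF series_supp_carrier[OF gs that] qc pc] by simp
    qed
    have gq: "g q = \<zero>" using above[of q] Q.lt_irrefl[OF qc] by blast
    define h where "h = sadd g m"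
    have h_in: "h \<in> series_in V" unfolding h_def using sadd_series_in[OF V g_in m_in] .
    have h_val: "h t = (if t = q then c else g t)" for t
      using gq cc gs by (simp add: h_def sadd_def m_def mono_def)
    have res_h: "res h t = res g t \<oplus> \<ominus> (f \<star> m) t" for t
    proof -
      have "(f \<star> h) t = (f \<star> g) t \<oplus> (f \<star> m) t"
        unfolding h_def conv_sadd[OF fs gs ms] by (simp add: sadd_def)
      then show ?thesis
        using sone_series fs gs ms
        by (simp add: res_def sadd_def sneg_def D.minus_add D.a_assoc)
    qed
    \<comment> \<open>The terms of the remainder and of \<open>f \<star> m\<close> at
      \<open>r\<close> cancel, and neither series has a term below \<open>r\<close>.\<close>
    have res_h_supp: "r \<sqsubset> t" if t: "res h t \<noteq> \<zero>" for t
    proof (rule ccontr)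
      assume neg: "\<not> r \<sqsubset> t"
      have fm: "is_least (f \<star> m) r" using is_least_conv[OF fs ms p m_least] pq by simp
      have "(f \<star> m) r = res g r"
        using conv_least_value[OF fs ms p m_least] pq fpc by (simp add: m_def mono_def)
      then have "t \<noteq> r" using t res_h[of t] rr by (auto simp: D.r_neg)
      then have "res g t = \<zero>" "(f \<star> m) t = \<zero>" using neg r fm by (auto simp: is_least_def)
      then show False using t res_h[of t] by simp
    qed
    have "h \<in> P"
      unfolding P_def
    proof (intro CollectI conjI h_in allI impI)
      fix t s assume t: "h t \<noteq> \<zero>" and s: "res h s \<noteq> \<zero>"
      have rs: "r \<sqsubset> s" using res_h_supp[OF s] .
      have sc: "s \<in> carrier Q" using series_supp_carrier[OF series_inD(1)[OF res_in[OF h_in]] s] .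
      have tc: "t \<in> carrier Q" using series_supp_carrier[OF series_inD(1)[OF h_in] t] .
      have "t = q \<or> t \<sqsubset> q" using t above h_val[of t] by (auto split: if_splits)
      then have "p \<otimes>\<^bsub>Q\<^esub> t = r \<or> p \<otimes>\<^bsub>Q\<^esub> t \<sqsubset> r"
        using Q.lt_mult_left[OF _ tc qc pc] pq by auto
      then show "p \<otimes>\<^bsub>Q\<^esub> t \<sqsubset> s"
        using rs Q.lt_trans[OF _ rs, of "p \<otimes>\<^bsub>Q\<^esub> t"] pc tc rc sc by auto
    qed
    moreover have "le g h" unfolding le_def using above h_val by auto
    ultimately have "h = g" using max by blast
    then show False using h_val[of q] gq \<open>c \<noteq> \<zero>\<close> by simp
  qed
  then have "(f \<star> g) s = sone s" for s
  proof -
    assume "\<And>s. res g s = \<zero>"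
    then have "sone s \<oplus> \<ominus> (f \<star> g) s = \<zero>" by (simp add: res_def sadd_def sneg_def)
    then show ?thesis
      using sone_series fs gs by (metis D.minus_equality D.minus_minus conv_closed series_closed D.a_inv_closed)
  qed
  then show ?thesis using g_in by blast
qed

lemma full_grading: "grading D Q (\<lambda>_. carrier D)"
  by (simp add: grading_def)

lemma sone_nonzero: "sone \<noteq> (\<lambda>_. \<zero>)"
  using D.zero_neq_one by (metis mono_def)

text \<open>The right inverse \<open>g\<close> of \<open>f\<close> has itself a right inverse, and
  associativity identifies that with \<open>f\<close>.\<close>

lemma series_inverse:
  assumes f: "f \<in> series" and nz: "f \<noteq> (\<lambda>_. \<zero>)"
  shows "\<exists>g\<in>series. f \<star> g = sone \<and> g \<star> f = sone"
proof -
  have right: "\<exists>g\<in>series. h \<star> g = sone" if h: "h \<in> series" "h \<noteq> (\<lambda>_. \<zero>)" for h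
  proof -
    obtain q where "h q \<noteq> \<zero>" using h(2) by (metis ext)
    then obtain p where p: "is_least h p" using is_least_exists[OF h(1)] by blast
    have "h \<in> series_in (\<lambda>_. carrier D)" using h(1) by (auto simp: series_in_def)
    moreover have "inv (h p) \<in> carrier D"
      using p h(1) D.skew_inv_closed by (auto simp: is_least_def)
    ultimately show ?thesis
      using conv_right_inverse[OF full_grading _ p] series_inD(1) by blast
  qed
  obtain g where g: "g \<in> series" "f \<star> g = sone" using right[OF f nz] by blast
  have "g \<noteq> (\<lambda>_. \<zero>)"
  proof
    assume "g = (\<lambda>_. \<zero>)"
    then have "f \<star> g = (\<lambda>_. \<zero>)" by (auto simp: conv_def)
    then show False using g(2) sone_nonzero by simp
  qed
  then obtain h where h: "h \<in> series" "g \<star> h = sone" using right[OF g(1)] by blast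
  have "f = f \<star> (g \<star> h)" using h conv_sone[OF f] by simp
  also have "\<dots> = h" using conv_assoc[OF f g(1) h(1)] g(2) sone_conv[OF h(1)] by simp
  finally show ?thesis using g h by blast
qed

end

section \<open>The Ore condition\<close>

text \<open>The crossed product is internal to \<open>D\<close>: its homogeneous components are
  additive subgroups of \<open>D\<close>. By \<open>V_inv\<close> the component of degree one is a
  skew field, and \<open>independent\<close>, which the Linnell condition will supply, makes the sum
  of the components direct.\<close>

locale crossed_product = D: skew_field D + Q: group Q
  for D (structure) and Q :: "('q, 'n) monoid_scheme" +
  fixes V :: "'q \<Rightarrow> 'a set"
  assumes V: "grading D Q V"
    and V_inv: "\<And>q x. q \<in> carrier Q \<Longrightarrow> x \<in> V q \<Longrightarrow> x \<noteq> \<zero> \<Longrightarrow> inv x \<in> V (inv\<^bsub>Q\<^esub> q)"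
    and V_nontrivial: "\<And>q. q \<in> carrier Q \<Longrightarrow> \<exists>x\<in>V q. x \<noteq> \<zero>"
    and independent: "\<And>A v. finite A \<Longrightarrow> A \<subseteq> carrier Q \<Longrightarrow> (\<And>q. q \<in> A \<Longrightarrow> v q \<in> V q) \<Longrightarrow>
      finsum D v A = \<zero> \<Longrightarrow> q \<in> A \<Longrightarrow> v q = \<zero>"
begin

lemmas V_carrier = gradingD(1)[OF V] and V_zero = gradingD(2)[OF V]
  and V_neg = gradingD(3)[OF V] and V_add = gradingD(4)[OF V]
  and V_mult = gradingD(5)[OF V] and V_one = gradingD(6)[OF V]

text \<open>Formal finite sums are kept apart from their values under \<open>ev\<close>, since one
  and the same formal sum serves as a series for every order on \<open>Q\<close>.\<close>

definition fsupp :: "('q \<Rightarrow> 'a) set" where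
  "fsupp = {a. (\<forall>q\<in>carrier Q. a q \<in> V q) \<and> (\<forall>q. q \<notin> carrier Q \<longrightarrow> a q = \<zero>) \<and>
     finite {q. a q \<noteq> \<zero>}}"

definition ev :: "('q \<Rightarrow> 'a) \<Rightarrow> 'a" where
  "ev a = finsum D a {q. a q \<noteq> \<zero>}"

definition crossed :: "'a set" where
  "crossed = ev ` fsupp"

lemma fsuppD:
  assumes "a \<in> fsupp"
  shows "finite {q. a q \<noteq> \<zero>}" "\<And>q. q \<in> carrier Q \<Longrightarrow> a q \<in> V q"
    "\<And>q. a q \<noteq> \<zero> \<Longrightarrow> q \<in> carrier Q" "\<And>q. a q \<in> carrier D"
proof -
  show "finite {q. a q \<noteq> \<zero>}" and V: "\<And>q. q \<in> carrier Q \<Longrightarrow> a q \<in> V q"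
    and s: "\<And>q. a q \<noteq> \<zero> \<Longrightarrow> q \<in> carrier Q"
    using assms by (auto simp: fsupp_def)
  show "a q \<in> carrier D" for q
    using V V_carrier s by (metis D.zero_closed)
qed

lemma ev_eq:
  assumes "a \<in> fsupp" "finite S" "\<And>q. a q \<noteq> \<zero> \<Longrightarrow> q \<in> S"
  shows "ev a = (\<Oplus>q\<in>S. a q)"
  unfolding ev_def using assms(2)
  by (rule D.finsum_support) (use assms fsuppD in auto)

lemma ev_closed: "a \<in> fsupp \<Longrightarrow> ev a \<in> carrier D"
  unfolding ev_def by (rule D.finsum_closed) (use fsuppD in auto)

lemma fsupp_add: "a \<in> fsupp \<Longrightarrow> b \<in> fsupp \<Longrightarrow> (\<lambda>q. a q \<oplus> b q) \<in> fsupp"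
proof -
  assume ab: "a \<in> fsupp" "b \<in> fsupp"
  have "{q. a q \<oplus> b q \<noteq> \<zero>} \<subseteq> {q. a q \<noteq> \<zero>} \<union> {q. b q \<noteq> \<zero>}" by auto
  then have "finite {q. a q \<oplus> b q \<noteq> \<zero>}"
    using fsuppD(1)[OF ab(1)] fsuppD(1)[OF ab(2)] finite_subset by blast
  then show ?thesis using ab V_add by (auto simp: fsupp_def)
qed

lemma fsupp_neg: "a \<in> fsupp \<Longrightarrow> (\<lambda>q. \<ominus> a q) \<in> fsupp"
proof -
  assume a: "a \<in> fsupp"
  have "{q. \<ominus> a q \<noteq> \<zero>} \<subseteq> {q. a q \<noteq> \<zero>}" by auto
  then have "finite {q. \<ominus> a q \<noteq> \<zero>}" using fsuppD(1)[OF a] finite_subset by blast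
  then show ?thesis using a V_neg by (auto simp: fsupp_def)
qed

lemma ev_add:
  assumes a: "a \<in> fsupp" and b: "b \<in> fsupp"
  shows "ev (\<lambda>q. a q \<oplus> b q) = ev a \<oplus> ev b"
proof -
  let ?S = "{q. a q \<noteq> \<zero>} \<union> {q. b q \<noteq> \<zero>}"
  have S: "finite ?S" using fsuppD(1) a b by blast
  have "ev (\<lambda>q. a q \<oplus> b q) = (\<Oplus>q\<in>?S. a q \<oplus> b q)"
    using fsupp_add[OF a b] S by (rule ev_eq) auto
  also have "\<dots> = (\<Oplus>q\<in>?S. a q) \<oplus> (\<Oplus>q\<in>?S. b q)"
    using fsuppD(4) a b by (intro D.finsum_addf) auto
  also have "\<dots> = ev a \<oplus> ev b"
    using ev_eq[OF a S] ev_eq[OF b S] by simp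
  finally show ?thesis .
qed

lemma ev_neg:
  assumes a: "a \<in> fsupp"
  shows "ev (\<lambda>q. \<ominus> a q) = \<ominus> ev a"
proof -
  have "ev (\<lambda>q. \<ominus> a q \<oplus> a q) = ev (\<lambda>q. \<ominus> a q) \<oplus> ev a"
    by (rule ev_add[OF fsupp_neg[OF a] a])
  moreover have "ev (\<lambda>q. \<ominus> a q \<oplus> a q) = \<zero>"
    using fsuppD(4)[OF a] by (simp add: ev_def D.l_neg)
  ultimately show ?thesis
    using D.minus_equality[of "ev (\<lambda>q. \<ominus> a q)" "ev a"] ev_closed a fsupp_neg by simp
qed

lemma ev_zero: "ev (\<lambda>_. \<zero>) = \<zero>"
  by (simp add: ev_def)

lemma ev_eq_zero:
  assumes a: "a \<in> fsupp" and "ev a = \<zero>"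
  shows "a = (\<lambda>_. \<zero>)"
proof
  fix q
  show "a q = \<zero>"
    using independent[of "{q. a q \<noteq> \<zero>}" a q] assms fsuppD[OF a] by (auto simp: ev_def)
qed

lemma ev_inj:
  assumes a: "a \<in> fsupp" and b: "b \<in> fsupp" and "ev a = ev b"
  shows "a = b"
proof
  fix q
  have "(\<lambda>q. a q \<oplus> \<ominus> b q) \<in> fsupp" using fsupp_add[OF a fsupp_neg[OF b]] .
  moreover have "ev (\<lambda>q. a q \<oplus> \<ominus> b q) = \<zero>"
    using ev_add[OF a fsupp_neg[OF b]] ev_neg[OF b] assms ev_closed by (simp add: D.r_neg)
  ultimately have "(\<lambda>q. a q \<oplus> \<ominus> b q) = (\<lambda>_. \<zero>)" by (rule ev_eq_zero)
  then have "a q \<oplus> \<ominus> b q = \<zero>" by metis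
  then show "a q = b q"
    using fsuppD(4) a b by (metis D.minus_equality D.minus_minus D.a_inv_closed)
qed

lemma single_fsupp:
  assumes "p \<in> carrier Q" "d \<in> V p"
  shows "(\<lambda>q. if q = p then d else \<zero>) \<in> fsupp"
proof -
  have "{q. (if q = p then d else \<zero>) \<noteq> \<zero>} \<subseteq> {p}" by auto
  then have "finite {q. (if q = p then d else \<zero>) \<noteq> \<zero>}" by (rule finite_subset) simp
  then show ?thesis using assms V_zero by (auto simp: fsupp_def)
qed

lemma ev_single:
  assumes "p \<in> carrier Q" "d \<in> V p"
  shows "ev (\<lambda>q. if q = p then d else \<zero>) = d"
proof -
  have "ev (\<lambda>q. if q = p then d else \<zero>) = (\<Oplus>q\<in>{p}. if q = p then d else \<zero>)"
    by (rule ev_eq[OF single_fsupp[OF assms]]) (auto split: if_splits)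
  then show ?thesis using V_carrier[OF assms] by simp
qed

lemma homogeneous_crossed:
  assumes "p \<in> carrier Q" "d \<in> V p"
  shows "d \<in> crossed"
  using imageI[OF single_fsupp[OF assms], of ev] ev_single[OF assms] by (simp add: crossed_def)

lemma crossed_closed: "x \<in> crossed \<Longrightarrow> x \<in> carrier D"
  by (auto simp: crossed_def ev_closed)

lemma crossed_add: "x \<in> crossed \<Longrightarrow> y \<in> crossed \<Longrightarrow> x \<oplus> y \<in> crossed"
  unfolding crossed_def by (auto simp: ev_add[symmetric] intro: fsupp_add)

lemma crossed_neg: "x \<in> crossed \<Longrightarrow> \<ominus> x \<in> crossed"
  unfolding crossed_def by (auto simp: ev_neg[symmetric] intro: fsupp_neg)

lemma crossed_zero: "\<zero> \<in> crossed"
  using homogeneous_crossed[OF Q.one_closed V_zero[OF Q.one_closed]] .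

lemma crossed_one: "\<one> \<in> crossed"
  using homogeneous_crossed[OF Q.one_closed V_one] .

lemma crossed_finsum: "(\<And>i. i \<in> I \<Longrightarrow> f i \<in> crossed) \<Longrightarrow> finsum D f I \<in> crossed"
  using D.finsum_mem[of crossed] crossed_zero crossed_add crossed_closed by blast

lemma crossed_mult:
  assumes "x \<in> crossed" "y \<in> crossed"
  shows "x \<otimes> y \<in> crossed"
proof -
  obtain a b where a: "a \<in> fsupp" "x = ev a" and b: "b \<in> fsupp" "y = ev b"
    using assms by (auto simp: crossed_def)
  let ?A = "{q. a q \<noteq> \<zero>}" and ?B = "{q. b q \<noteq> \<zero>}"
  have terms: "a p \<otimes> b q \<in> crossed" if "p \<in> ?A" "q \<in> ?B" for p q
    using that fsuppD[OF a(1)] fsuppD[OF b(1)]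
    by (intro homogeneous_crossed[of "p \<otimes>\<^bsub>Q\<^esub> q"] V_mult) auto
  have "x \<otimes> y = (\<Oplus>p\<in>?A. a p \<otimes> y)"
    unfolding a(2) ev_def using fsuppD(1,4)[OF a(1)] crossed_closed[OF assms(2)]
    by (intro D.finsum_ldistr) auto
  also have "\<dots> = (\<Oplus>p\<in>?A. \<Oplus>q\<in>?B. a p \<otimes> b q)"
  proof (rule D.finsum_cong'[OF refl])
    fix p
    show "a p \<otimes> y = (\<Oplus>q\<in>?B. a p \<otimes> b q)"
      unfolding b(2) ev_def using fsuppD(1,4)[OF b(1)] fsuppD(4)[OF a(1)]
      by (intro D.finsum_rdistr) auto
  qed (use fsuppD(4)[OF a(1)] fsuppD(4)[OF b(1)] in \<open>auto intro!: D.finsum_closed\<close>)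
  also have "\<dots> \<in> crossed" using terms by (intro crossed_finsum) auto
  finally show ?thesis .
qed

text \<open>The scalars of the linear system behind the Ore condition.\<close>

lemma V_one_skew_subfield: "skew_subfield (V \<one>\<^bsub>Q\<^esub>) D"
  unfolding skew_subfield_def
proof
  show "subring (V \<one>\<^bsub>Q\<^esub>) D"
    by (rule D.subringI)
      (use V_carrier[OF Q.one_closed] V_one V_neg[OF Q.one_closed] V_add[OF Q.one_closed]
        V_mult[OF Q.one_closed Q.one_closed] in auto)
  show "\<forall>x\<in>V \<one>\<^bsub>Q\<^esub> - {\<zero>}. inv x \<in> V \<one>\<^bsub>Q\<^esub>"
    using V_inv[OF Q.one_closed] by auto
qed

text \<open>The elements \<open>a \<cdot> s\<^sub>q\<close> and \<open>b \<cdot> s\<^sub>q\<close> for \<open>q\<close> in a finite set \<open>E\<close> lie in a space of dimension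
  \<open>|S E|\<close>, where \<open>S\<close> contains both supports. Amenability makes this smaller than \<open>2 |E|\<close>.\<close>

lemma ore:
  assumes am: "amenable Q" and a: "a \<in> crossed" "a \<noteq> \<zero>" and b: "b \<in> crossed" "b \<noteq> \<zero>"
  shows "\<exists>c\<in>crossed. \<exists>d\<in>crossed. c \<noteq> \<zero> \<and> d \<noteq> \<zero> \<and> a \<otimes> c = b \<otimes> d"
proof -
  obtain \<alpha> \<beta> where \<alpha>: "\<alpha> \<in> fsupp" "a = ev \<alpha>" and \<beta>: "\<beta> \<in> fsupp" "b = ev \<beta>"
    using a b by (auto simp: crossed_def)
  \<comment> \<open>A Boolean selects between \<open>a\<close> and \<open>b\<close>, so the unknowns
    are indexed by pairs, two for each element of \<open>E\<close>.\<close>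
  define \<gamma> where "\<gamma> = (\<lambda>e. if e then \<alpha> else \<beta>)"
  define ab where "ab = (\<lambda>e. if e then a else b)"
  have \<gamma>: "\<gamma> e \<in> fsupp" "ab e = ev (\<gamma> e)" for e using \<alpha> \<beta> by (auto simp: \<gamma>_def ab_def)
  have abc: "ab e \<in> carrier D" "ab e \<in> crossed" "ab e \<noteq> \<zero>" for e
    using a b crossed_closed by (auto simp: ab_def)
  define S where "S = {q. \<alpha> q \<noteq> \<zero>} \<union> {q. \<beta> q \<noteq> \<zero>}"
  have S: "finite S" "S \<subseteq> carrier Q" "\<And>e q. \<gamma> e q \<noteq> \<zero> \<Longrightarrow> q \<in> S"
    using fsuppD(1,3)[OF \<alpha>(1)] fsuppD(1,3)[OF \<beta>(1)] by (auto simp: S_def \<gamma>_def split: if_splits)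
  obtain E where E: "E \<subseteq> carrier Q" "finite E" "card (S <#>\<^bsub>Q\<^esub> E) < 2 * card E"
    using Q.amenable_no_doubling[OF am S(1,2)] by blast
  define T where "T = S <#>\<^bsub>Q\<^esub> E"
  have T: "finite T" "T \<subseteq> carrier Q"
    using S E unfolding T_def set_mult_def by auto
  define s where "s = (\<lambda>q. SOME x. x \<in> V q \<and> x \<noteq> \<zero>)"
  have s: "s q \<in> V q" "s q \<noteq> \<zero>" if "q \<in> carrier Q" for q
    using someI_ex[of "\<lambda>x. x \<in> V q \<and> x \<noteq> \<zero>"] V_nontrivial[OF that] by (auto simp: s_def)
  have sc: "s q \<in> carrier D" if "q \<in> carrier Q" for q using V_carrier[OF that s(1)[OF that]] .
  define I where "I = E \<times> (UNIV :: bool set)"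
  have I: "finite I" using E by (simp add: I_def)
  \<comment> \<open>\<open>w (q, e) t\<close> is the component of degree \<open>t\<close> of
    \<open>ab e \<otimes> s q\<close>.\<close>
  define w where "w = (\<lambda>(q, e) t. \<gamma> e (t \<otimes>\<^bsub>Q\<^esub> inv\<^bsub>Q\<^esub> q) \<otimes> s q)"
  have wV: "w i t \<in> V t" if "i \<in> I" "t \<in> carrier Q" for i t
  proof -
    have "fst i \<in> carrier Q" using that(1) E(1) by (auto simp: I_def)
    then obtain q e where i: "i = (q, e)" "q \<in> carrier Q" by (cases i) simp
    have "w i t \<in> V ((t \<otimes>\<^bsub>Q\<^esub> inv\<^bsub>Q\<^esub> q) \<otimes>\<^bsub>Q\<^esub> q)"
      using i that(2) fsuppD(2)[OF \<gamma>(1)] s unfolding w_def by (auto intro!: V_mult)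
    then show ?thesis using i that(2) by (simp add: Q.m_assoc)
  qed
  \<comment> \<open>Multiplying the equation of degree \<open>t\<close> from the left by
    \<open>inv (s t)\<close> moves its coefficients into the skew field of degree one, without
    changing its solutions.\<close>
  define v where "v = (\<lambda>i t. inv (s t) \<otimes> w i t)"
  have v1: "v i t \<in> V \<one>\<^bsub>Q\<^esub>" if "i \<in> I" "t \<in> T" for i t
  proof -
    have t: "t \<in> carrier Q" using that T by blast
    have "v i t \<in> V (inv\<^bsub>Q\<^esub> t \<otimes>\<^bsub>Q\<^esub> t)"
      unfolding v_def using t wV[OF that(1)] s V_inv by (intro V_mult) auto
    then show ?thesis using t by simp
  qed
  have "card I = 2 * card E" by (simp add: I_def card_cartesian_product)
  then obtain r where r: "\<forall>i\<in>I. r i \<in> V \<one>\<^bsub>Q\<^esub>" "\<exists>i\<in>I. r i \<noteq> \<zero>"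
    "\<forall>t\<in>T. (\<Oplus>i\<in>I. v i t \<otimes> r i) = \<zero>"
    using D.underdetermined_system[OF V_one_skew_subfield T(1) I, of v] v1 E(3)
    unfolding T_def by auto
  have rc: "r i \<in> carrier D" if "i \<in> I" for i using r(1) that V_carrier Q.one_closed by blast
  have wc: "w i t \<in> carrier D" if "i \<in> I" "t \<in> T" for i t
    using wV[OF that(1)] V_carrier T that(2) by blast
  \<comment> \<open>The solution of the system, read as two elements of the crossed product. The
    equations say, degree by degree, that
    \<open>a \<otimes> c True \<oplus> b \<otimes> c False\<close> vanishes.\<close>
  define c where "c = (\<lambda>e. \<Oplus>q\<in>E. s q \<otimes> r (q, e))"
  have sr: "s q \<otimes> r (q, e) \<in> V q" if "q \<in> E" for q e
  proof -
    have "s q \<otimes> r (q, e) \<in> V (q \<otimes>\<^bsub>Q\<^esub> \<one>\<^bsub>Q\<^esub>)"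
      using that E s r(1) by (intro V_mult) (auto simp: I_def)
    then show ?thesis using that E by auto
  qed
  have src: "s q \<otimes> r (q, e) \<in> carrier D" if "q \<in> E" for q e
    using sr[OF that] V_carrier E that by blast
  have c_crossed: "c e \<in> crossed" for e
    unfolding c_def using sr E homogeneous_crossed by (intro crossed_finsum) blast
  have cc: "c e \<in> carrier D" for e using crossed_closed[OF c_crossed] .
  have ab_sum: "(\<Oplus>t\<in>T. w (q, e) t) = ab e \<otimes> s q" if q: "q \<in> E" for q e
  proof -
    have qc: "q \<in> carrier Q" using q E by blast
    have inj: "inj_on (\<lambda>p. p \<otimes>\<^bsub>Q\<^esub> q) S"
      using S(2) qc by (auto intro!: inj_onI simp: subset_iff)
    have "(\<Oplus>t\<in>T. w (q, e) t) = (\<Oplus>t\<in>(\<lambda>p. p \<otimes>\<^bsub>Q\<^esub> q) ` S. w (q, e) t)"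
    proof (rule D.finsum_support[symmetric, OF T(1)])
      show "(\<lambda>p. p \<otimes>\<^bsub>Q\<^esub> q) ` S \<subseteq> T" using q by (auto simp: T_def set_mult_def)
      then show "\<And>t. t \<in> (\<lambda>p. p \<otimes>\<^bsub>Q\<^esub> q) ` S \<Longrightarrow> w (q, e) t \<in> carrier D"
        using wc q by (auto simp: I_def)
      fix t assume t: "t \<in> T - (\<lambda>p. p \<otimes>\<^bsub>Q\<^esub> q) ` S"
      have "\<gamma> e (t \<otimes>\<^bsub>Q\<^esub> inv\<^bsub>Q\<^esub> q) = \<zero>"
      proof (rule ccontr)
        assume "\<gamma> e (t \<otimes>\<^bsub>Q\<^esub> inv\<^bsub>Q\<^esub> q) \<noteq> \<zero>"
        then have "t \<otimes>\<^bsub>Q\<^esub> inv\<^bsub>Q\<^esub> q \<in> S" using S(3) by blast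
        then have "(t \<otimes>\<^bsub>Q\<^esub> inv\<^bsub>Q\<^esub> q) \<otimes>\<^bsub>Q\<^esub> q \<in> (\<lambda>p. p \<otimes>\<^bsub>Q\<^esub> q) ` S" by blast
        moreover have "t \<in> carrier Q" using t T by blast
        ultimately show False using t qc by (simp add: Q.m_assoc)
      qed
      then show "w (q, e) t = \<zero>" using sc[OF qc] by (simp add: w_def)
    qed
    also have "\<dots> = (\<Oplus>p\<in>S. w (q, e) (p \<otimes>\<^bsub>Q\<^esub> q))"
    proof (rule D.finsum_reindex[OF _ inj])
      show "w (q, e) \<in> (\<lambda>p. p \<otimes>\<^bsub>Q\<^esub> q) ` S \<rightarrow> carrier D"
        using fsuppD(4)[OF \<gamma>(1)] sc[OF qc] by (auto simp: w_def)
    qed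
    also have "\<dots> = (\<Oplus>p\<in>S. \<gamma> e p \<otimes> s q)"
      using S(2) qc fsuppD(4)[OF \<gamma>(1)] sc[OF qc]
      by (intro D.finsum_cong') (auto simp: w_def Q.m_assoc subset_iff)
    also have "\<dots> = (\<Oplus>p\<in>S. \<gamma> e p) \<otimes> s q"
      using S fsuppD(4)[OF \<gamma>(1)] sc[OF qc] by (intro D.finsum_ldistr[symmetric]) auto
    also have "(\<Oplus>p\<in>S. \<gamma> e p) = ab e"
      unfolding \<gamma>(2) using S by (intro ev_eq[symmetric] \<gamma>(1)) auto
    finally show ?thesis .
  qed
  have "a \<otimes> c True \<oplus> b \<otimes> c False = (\<Oplus>i\<in>I. ab (snd i) \<otimes> (s (fst i) \<otimes> r i))"
  proof -
    have abc': "ab e \<otimes> c e = (\<Oplus>i\<in>E \<times> {e}. ab (snd i) \<otimes> (s (fst i) \<otimes> r i))" for e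
    proof -
      have "ab e \<otimes> c e = (\<Oplus>q\<in>E. ab e \<otimes> (s q \<otimes> r (q, e)))"
        unfolding c_def using E src abc by (intro D.finsum_rdistr) auto
      also have "\<dots> = (\<Oplus>i\<in>(\<lambda>q. (q, e)) ` E. ab (snd i) \<otimes> (s (fst i) \<otimes> r i))"
        using src abc by (subst D.finsum_reindex) (auto simp: inj_on_def)
      also have "(\<lambda>q. (q, e)) ` E = E \<times> {e}" by auto
      finally show ?thesis .
    qed
    have "I = E \<times> {True} \<union> E \<times> {False}" unfolding I_def by (auto intro: bool.exhaust)
    then have "(\<Oplus>i\<in>I. ab (snd i) \<otimes> (s (fst i) \<otimes> r i)) =
       (\<Oplus>i\<in>E \<times> {True}. ab (snd i) \<otimes> (s (fst i) \<otimes> r i)) \<oplus>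
       (\<Oplus>i\<in>E \<times> {False}. ab (snd i) \<otimes> (s (fst i) \<otimes> r i))"
      using E(2) src abc by (simp only:) (intro D.finsum_Un_disjoint, auto)
    then show ?thesis using abc'[of True] abc'[of False] by (simp add: ab_def)
  qed
  also have "\<dots> = (\<Oplus>i\<in>I. \<Oplus>t\<in>T. w i t \<otimes> r i)"
  proof (rule D.finsum_cong'[OF refl])
    show "(\<lambda>i. \<Oplus>t\<in>T. w i t \<otimes> r i) \<in> I \<rightarrow> carrier D"
      using wc rc by (auto intro!: D.finsum_closed)
    fix i assume i: "i \<in> I"
    obtain q e where qe: "i = (q, e)" "q \<in> E" using i by (auto simp: I_def)
    have "ab e \<otimes> (s q \<otimes> r i) = (\<Oplus>t\<in>T. w i t) \<otimes> r i"
      using ab_sum[OF qe(2)] sc[of q] qe E(1) rc[OF i] abc by (auto simp: D.m_assoc)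
    also have "\<dots> = (\<Oplus>t\<in>T. w i t \<otimes> r i)"
      using T(1) wc[OF i] rc[OF i] by (intro D.finsum_ldistr) auto
    finally show "ab (snd i) \<otimes> (s (fst i) \<otimes> r i) = (\<Oplus>t\<in>T. w i t \<otimes> r i)" using qe by simp
  qed
  also have "\<dots> = (\<Oplus>t\<in>T. \<Oplus>i\<in>I. w i t \<otimes> r i)"
    using wc rc by (intro D.finsum_swap I T) auto
  also have "\<dots> = \<zero>"
  proof (rule D.add.finprod_one_eqI)
    fix t assume t: "t \<in> T"
    have tc: "t \<in> carrier Q" using t T by blast
    have "(\<Oplus>i\<in>I. w i t \<otimes> r i) = (\<Oplus>i\<in>I. s t \<otimes> (v i t \<otimes> r i))"
    proof (rule D.finsum_cong'[OF refl])
      fix i assume i: "i \<in> I"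
      have ic: "inv (s t) \<in> carrier D" using sc[OF tc] s[OF tc] D.skew_inv_closed by blast
      show "w i t \<otimes> r i = s t \<otimes> (v i t \<otimes> r i)"
        unfolding v_def using sc[OF tc] s[OF tc] ic wc[OF i t] rc[OF i]
        by (simp add: D.m_assoc[symmetric] D.skew_r_inv)
    qed (use sc[OF tc] v1 V_carrier[OF Q.one_closed] rc t in auto)
    also have "\<dots> = s t \<otimes> (\<Oplus>i\<in>I. v i t \<otimes> r i)"
      using sc[OF tc] v1 V_carrier[OF Q.one_closed] rc t
      by (intro D.finsum_rdistr[symmetric] I) auto
    also have "\<dots> = \<zero>" using r(3) t sc[OF tc] by simp
    finally show "(\<Oplus>i\<in>I. w i t \<otimes> r i) = \<zero>" .
  qed
  finally have sum: "a \<otimes> c True \<oplus> b \<otimes> c False = \<zero>" .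
  have abD: "a \<in> carrier D" "b \<in> carrier D" using a b crossed_closed by auto
  have eq: "a \<otimes> c True = b \<otimes> (\<ominus> c False)"
    using sum abD cc D.minus_equality[of "a \<otimes> c True" "b \<otimes> c False"]
    by (simp add: D.r_minus)
  \<comment> \<open>Independence of the components turns a nonzero unknown into a nonzero
    element.\<close>
  have "c True \<noteq> \<zero> \<or> c False \<noteq> \<zero>"
  proof -
    obtain q e where qe: "q \<in> E" "r (q, e) \<noteq> \<zero>" using r(2) by (auto simp: I_def)
    have "c e \<noteq> \<zero>"
    proof
      assume "c e = \<zero>"
      then have "s q \<otimes> r (q, e) = \<zero>"
        using independent[OF E(2,1), of "\<lambda>q. s q \<otimes> r (q, e)" q] sr qe(1) by (simp add: c_def)
      then show False
        using D.skew_integral[of "s q" "r (q, e)"] qe s sc rc E(1) by (auto simp: I_def)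
    qed
    then show ?thesis by (cases e) auto
  qed
  \<comment> \<open>As \<open>a\<close> and \<open>b\<close> are nonzero, one side of
    \<open>eq\<close> vanishes only together with the other; hence neither multiplier is
    zero.\<close>
  moreover have "c True = \<zero> \<longleftrightarrow> \<ominus> c False = \<zero>"
    using eq D.skew_integral[OF abD(1) cc] D.skew_integral[OF abD(2), of "\<ominus> c False"] a b abD cc
    by (metis D.a_inv_closed D.r_null)
  ultimately have "c True \<noteq> \<zero>" "\<ominus> c False \<noteq> \<zero>"
    using cc by (metis D.minus_minus D.minus_zero)+
  then show ?thesis using eq c_crossed crossed_neg by blast
qed

text \<open>Right fractions with the inverse cleared: \<open>b\<close> is the denominator and
  \<open>x \<otimes> b\<close> the numerator.\<close>

definition fractions :: "'a set" where
  "fractions = {x \<in> carrier D. \<exists>b\<in>crossed. b \<noteq> \<zero> \<and> x \<otimes> b \<in> crossed}"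

lemma crossed_subset_fractions: "crossed \<subseteq> fractions"
  using crossed_one crossed_closed D.zero_neq_one by (force simp: fractions_def)

text \<open>The Ore condition provides a common right denominator for sums. For products it moves
  the numerator of the right factor past the denominator of the left one. Inversion exchanges
  numerator and denominator.\<close>

lemma fractions_skew_subfield:
  assumes am: "amenable Q"
  shows "skew_subfield fractions D"
  unfolding skew_subfield_def
proof
  note sc = crossed_closed
  show "subring fractions D"
  proof (rule D.subringI)
    show "fractions \<subseteq> carrier D" by (auto simp: fractions_def)
    show "\<one> \<in> fractions" using crossed_one crossed_subset_fractions by blast
    show "\<ominus> x \<in> fractions" if "x \<in> fractions" for x
      using that crossed_neg sc by (force simp: fractions_def D.l_minus)
    fix x y assume x: "x \<in> fractions" and y: "y \<in> fractions"
    obtain b where b: "x \<in> carrier D" "b \<in> crossed" "b \<noteq> \<zero>" "x \<otimes> b \<in> crossed"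
      using x by (auto simp: fractions_def)
    obtain b' where b': "y \<in> carrier D" "b' \<in> crossed" "b' \<noteq> \<zero>" "y \<otimes> b' \<in> crossed"
      using y by (auto simp: fractions_def)
    show "x \<oplus> y \<in> fractions"
    proof -
      obtain c d where cd: "c \<in> crossed" "d \<in> crossed" "c \<noteq> \<zero>" "b \<otimes> c = b' \<otimes> d"
        using ore[OF am b(2,3) b'(2,3)] by blast
      have "(x \<oplus> y) \<otimes> (b \<otimes> c) = (x \<otimes> b) \<otimes> c \<oplus> (y \<otimes> b') \<otimes> d"
        using b b' cd sc by (simp add: D.l_distr D.m_assoc[symmetric])
          (simp add: D.m_assoc cd(4))
      then have "(x \<oplus> y) \<otimes> (b \<otimes> c) \<in> crossed" using b b' cd by (simp add: crossed_add crossed_mult)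
      moreover have "b \<otimes> c \<noteq> \<zero>" using D.skew_integral b cd sc by blast
      ultimately show ?thesis using b b' cd crossed_mult by (auto simp: fractions_def)
    qed
    show "x \<otimes> y \<in> fractions"
    \<comment> \<open>The Ore condition speaks of nonzero elements only, so a vanishing numerator is
      treated apart.\<close>
    proof (cases "y \<otimes> b' = \<zero>")
      case True
      then have "y = \<zero>" using D.skew_integral[OF b'(1) sc[OF b'(2)]] b' by blast
      then show ?thesis using b crossed_zero crossed_subset_fractions by auto
    next
      case False
      then obtain c d where cd: "c \<in> crossed" "d \<in> crossed" "c \<noteq> \<zero>" "(y \<otimes> b') \<otimes> c = b \<otimes> d"
        using ore[OF am b'(4) _ b(2,3)] by blast
      have "(x \<otimes> y) \<otimes> (b' \<otimes> c) = x \<otimes> ((y \<otimes> b') \<otimes> c)"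
        using b b' cd sc by (simp add: D.m_assoc)
      also have "\<dots> = (x \<otimes> b) \<otimes> d" unfolding cd(4) using b cd sc by (simp add: D.m_assoc)
      finally have "(x \<otimes> y) \<otimes> (b' \<otimes> c) \<in> crossed" using b cd by (simp add: crossed_mult)
      moreover have "b' \<otimes> c \<noteq> \<zero>" using D.skew_integral b' cd sc by blast
      ultimately show ?thesis using b b' cd crossed_mult by (auto simp: fractions_def)
    qed
  qed
  show "\<forall>x\<in>fractions - {\<zero>}. inv x \<in> fractions"
  proof
    fix x assume x: "x \<in> fractions - {\<zero>}"
    then obtain b where b: "x \<in> carrier D" "b \<in> crossed" "b \<noteq> \<zero>" "x \<otimes> b \<in> crossed" "x \<noteq> \<zero>"
      by (auto simp: fractions_def)
    have ix: "inv x \<in> carrier D" using b D.skew_inv_closed by blast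
    have "inv x \<otimes> (x \<otimes> b) = b"
      using b ix sc by (simp add: D.m_assoc[symmetric] D.skew_l_inv)
    moreover have "x \<otimes> b \<noteq> \<zero>" using D.skew_integral b sc by blast
    ultimately show "inv x \<in> fractions" using b ix unfolding fractions_def by force
  qed
qed

end

section \<open>Series expansions of fractions\<close>

context series_ring
begin

lemma conv_zero: "f \<star> (\<lambda>_. \<zero>) = (\<lambda>_. \<zero>)"
  by (auto simp: conv_def)

lemma zero_conv: "(\<lambda>_. \<zero>) \<star> f = (\<lambda>_. \<zero>)"
  by (auto simp: conv_def)

end

locale crossed_series = series_ring D Q lt + crossed_product D Q V
  for D (structure) and Q :: "('q, 'n) monoid_scheme" and lt (infix "\<sqsubset>" 50) and V
begin

lemma fsupp_series_in: "a \<in> fsupp \<Longrightarrow> a \<in> series_in V"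
proof -
  assume a: "a \<in> fsupp"
  have "Q.well_ordered {q. a q \<noteq> \<zero>}"
    by (rule Q.well_ordered_finite) (use fsuppD[OF a] in auto)
  then have "a \<in> series" by (rule seriesI[rotated]) (use fsuppD[OF a] in auto)
  then show ?thesis using fsuppD(2)[OF a] by (rule series_inI)
qed

lemma fsupp_series: "a \<in> fsupp \<Longrightarrow> a \<in> series"
  using fsupp_series_in series_inD(1) by blast

lemma fsuppI:
  assumes "a \<in> series_in V" "finite {q. a q \<noteq> \<zero>}"
  shows "a \<in> fsupp"
  using assms series_inD[OF assms(1)] series_supp_carrier[of a] unfolding fsupp_def by auto

lemma fsupp_conv:
  assumes a: "a \<in> fsupp" and b: "b \<in> fsupp"
  shows "a \<star> b \<in> fsupp"
proof (rule fsuppI)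
  show "a \<star> b \<in> series_in V"
    using conv_series_in[OF V fsupp_series_in[OF a] fsupp_series_in[OF b]] .
  have "{q. (a \<star> b) q \<noteq> \<zero>} \<subseteq> {q. a q \<noteq> \<zero>} <#>\<^bsub>Q\<^esub> {q. b q \<noteq> \<zero>}"
    using conv_supp[OF fsupp_series[OF a] fsupp_series[OF b]] by blast
  moreover have "finite ({q. a q \<noteq> \<zero>} <#>\<^bsub>Q\<^esub> {q. b q \<noteq> \<zero>})"
    unfolding set_mult_def using fsuppD(1) a b by blast
  ultimately show "finite {q. (a \<star> b) q \<noteq> \<zero>}" by (rule finite_subset)
qed

lemma sone_fsupp: "sone \<in> fsupp"
  using single_fsupp[OF Q.one_closed V_one] by (simp add: mono_def)

lemma ev_sone: "ev sone = \<one>"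
  using ev_single[OF Q.one_closed V_one] by (simp add: mono_def)

lemma ev_conv:
  assumes a: "a \<in> fsupp" and b: "b \<in> fsupp"
  shows "ev (a \<star> b) = ev a \<otimes> ev b"
proof -
  let ?A = "{q. a q \<noteq> \<zero>}" and ?B = "{q. b q \<noteq> \<zero>}"
  define C where "C = ?A <#>\<^bsub>Q\<^esub> ?B"
  have fin: "finite ?A" "finite ?B" using fsuppD(1) a b by auto
  have Cc: "C \<subseteq> carrier Q" using fsuppD(3) a b by (auto simp: C_def set_mult_def)
  have finC: "finite C" using fin unfolding C_def set_mult_def by blast
  note as = fsupp_series[OF a] and bs = fsupp_series[OF b]
  note ac = fsuppD(4)[OF a] and bc = fsuppD(4)[OF b]
  have "ev (a \<star> b) = (\<Oplus>q\<in>C. (a \<star> b) q)"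
    using fsupp_conv[OF a b] finC by (rule ev_eq) (use conv_supp[OF as bs] in \<open>simp add: C_def\<close>)
  also have "\<dots> = (\<Oplus>q\<in>C. \<Oplus>x\<in>?A. a x \<otimes> b (inv\<^bsub>Q\<^esub> x \<otimes>\<^bsub>Q\<^esub> q))"
  proof (rule D.finsum_cong'[OF refl])
    show "(\<lambda>q. \<Oplus>x\<in>?A. a x \<otimes> b (inv\<^bsub>Q\<^esub> x \<otimes>\<^bsub>Q\<^esub> q)) \<in> C \<rightarrow> carrier D"
      using ac bc by (auto intro!: D.finsum_closed)
    fix q assume "q \<in> C"
    then show "(a \<star> b) q = (\<Oplus>x\<in>?A. a x \<otimes> b (inv\<^bsub>Q\<^esub> x \<otimes>\<^bsub>Q\<^esub> q))"
      using Cc fin by (intro conv_eq[OF as bs]) auto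
  qed
  also have "\<dots> = (\<Oplus>x\<in>?A. \<Oplus>q\<in>C. a x \<otimes> b (inv\<^bsub>Q\<^esub> x \<otimes>\<^bsub>Q\<^esub> q))"
    using ac bc by (intro D.finsum_swap finC fin) auto
  also have "\<dots> = (\<Oplus>x\<in>?A. a x \<otimes> ev b)"
  proof (rule D.finsum_cong'[OF refl])
    show "(\<lambda>x. a x \<otimes> ev b) \<in> ?A \<rightarrow> carrier D" using ac ev_closed[OF b] by auto
    fix x assume x: "x \<in> ?A"
    have xc: "x \<in> carrier Q" using x fsuppD(3)[OF a] by blast
    have inj: "inj_on (\<lambda>q. inv\<^bsub>Q\<^esub> x \<otimes>\<^bsub>Q\<^esub> q) C"
      using Cc xc by (auto intro!: inj_onI simp: subset_iff)
    have "ev b = (\<Oplus>y\<in>(\<lambda>q. inv\<^bsub>Q\<^esub> x \<otimes>\<^bsub>Q\<^esub> q) ` C. b y)"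
    proof (rule ev_eq[OF b])
      fix y assume y: "b y \<noteq> \<zero>"
      have "y \<in> carrier Q" using fsuppD(3)[OF b y] .
      then have "y = inv\<^bsub>Q\<^esub> x \<otimes>\<^bsub>Q\<^esub> (x \<otimes>\<^bsub>Q\<^esub> y)" using xc by (simp add: Q.m_assoc[symmetric])
      moreover have "x \<otimes>\<^bsub>Q\<^esub> y \<in> C" using x y unfolding C_def set_mult_def by blast
      ultimately show "y \<in> (\<lambda>q. inv\<^bsub>Q\<^esub> x \<otimes>\<^bsub>Q\<^esub> q) ` C" by blast
    qed (use finC in simp)
    also have "\<dots> = (\<Oplus>q\<in>C. b (inv\<^bsub>Q\<^esub> x \<otimes>\<^bsub>Q\<^esub> q))"
      using bc by (intro D.finsum_reindex inj) auto
    finally show "(\<Oplus>q\<in>C. a x \<otimes> b (inv\<^bsub>Q\<^esub> x \<otimes>\<^bsub>Q\<^esub> q)) = a x \<otimes> ev b"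
      using ac bc by (simp add: D.finsum_rdistr[OF finC])
  qed
  also have "\<dots> = ev a \<otimes> ev b"
    unfolding ev_def[of a] using fin ac ev_closed[OF b] by (intro D.finsum_ldistr[symmetric]) auto
  finally show ?thesis .
qed

text \<open>\<open>expands x f\<close> says that \<open>f\<close> is the series of \<open>x\<close>, via a presentation of \<open>x\<close> as a right fraction.\<close>

definition expands :: "'a \<Rightarrow> ('q \<Rightarrow> 'a) \<Rightarrow> bool" where
  "expands x f \<longleftrightarrow> x \<in> carrier D \<and> f \<in> series_in V \<and>
     (\<exists>b\<in>fsupp. ev b \<noteq> \<zero> \<and> f \<star> b \<in> fsupp \<and> ev (f \<star> b) = x \<otimes> ev b)"

lemma expandsD: "expands x f \<Longrightarrow> x \<in> carrier D" "expands x f \<Longrightarrow> f \<in> series_in V"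
    "expands x f \<Longrightarrow> f \<in> series"
  by (auto simp: expands_def series_in_def)

lemma expands_ev: "a \<in> fsupp \<Longrightarrow> expands (ev a) a"
  unfolding expands_def
  using sone_fsupp ev_sone conv_sone[OF fsupp_series] ev_closed fsupp_series_in D.zero_neq_one
  by (intro conjI bexI[of _ sone]) auto

lemma expands_one: "expands \<one> sone"
  using expands_ev[OF sone_fsupp] ev_sone by simp

lemma expands_neg: "expands x f \<Longrightarrow> expands (\<ominus> x) (sneg f)"
  unfolding expands_def
proof (elim conjE bexE, intro conjI)
  fix b assume *: "x \<in> carrier D" "f \<in> series_in V" "b \<in> fsupp" "ev b \<noteq> \<zero>" "f \<star> b \<in> fsupp"
    "ev (f \<star> b) = x \<otimes> ev b"
  have "sneg f \<star> b = (\<lambda>q. \<ominus> (f \<star> b) q)"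
    using sneg_conv[OF series_inD(1)[OF *(2)] fsupp_series[OF *(3)]] by (simp add: sneg_def)
  then have "sneg f \<star> b \<in> fsupp" "ev (sneg f \<star> b) = \<ominus> x \<otimes> ev b"
    using fsupp_neg[OF *(5)] ev_neg[OF *(5)] * ev_closed by (auto simp: D.l_minus)
  then show "\<exists>b\<in>fsupp. ev b \<noteq> \<zero> \<and> sneg f \<star> b \<in> fsupp \<and> ev (sneg f \<star> b) = \<ominus> x \<otimes> ev b"
    using *(3,4) by blast
qed (auto intro: sneg_series_in V)

end

locale amenable_crossed_series = crossed_series +
  assumes am: "amenable Q"
begin

text \<open>The Ore relation lives in \<open>D\<close>. Since \<open>ev\<close> is injective and
  multiplicative it lifts to formal sums, where it becomes an identity between series.\<close>

lemma fsupp_ore: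
  assumes a: "a \<in> fsupp" "ev a \<noteq> \<zero>" and b: "b \<in> fsupp" "ev b \<noteq> \<zero>"
  shows "\<exists>c\<in>fsupp. \<exists>d\<in>fsupp. ev c \<noteq> \<zero> \<and> ev d \<noteq> \<zero> \<and> a \<star> c = b \<star> d"
proof -
  have "ev a \<in> crossed" "ev b \<in> crossed" using a b by (auto simp: crossed_def)
  from ore[OF am this(1) a(2) this(2) b(2)]
  obtain c d where cd: "c \<in> fsupp" "d \<in> fsupp" "ev c \<noteq> \<zero>" "ev d \<noteq> \<zero>" "ev a \<otimes> ev c = ev b \<otimes> ev d"
    by (auto simp: crossed_def)
  then have "ev (a \<star> c) = ev (b \<star> d)" using ev_conv a b by simp
  then have "a \<star> c = b \<star> d" using ev_inj fsupp_conv a b cd by blast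
  then show ?thesis using cd by blast
qed

text \<open>The common right multiple \<open>m\<close> of the two denominators clears both fractions
  at once.\<close>

lemma expands_add:
  assumes x: "expands x f" and y: "expands y g"
  shows "expands (x \<oplus> y) (sadd f g)"
proof -
  obtain b where b: "b \<in> fsupp" "ev b \<noteq> \<zero>" "f \<star> b \<in> fsupp" "ev (f \<star> b) = x \<otimes> ev b"
    using x by (auto simp: expands_def)
  obtain b' where b': "b' \<in> fsupp" "ev b' \<noteq> \<zero>" "g \<star> b' \<in> fsupp" "ev (g \<star> b') = y \<otimes> ev b'"
    using y by (auto simp: expands_def)
  obtain c d where cd: "c \<in> fsupp" "d \<in> fsupp" "ev c \<noteq> \<zero>" "ev d \<noteq> \<zero>" "b \<star> c = b' \<star> d"
    using fsupp_ore[OF b(1,2) b'(1,2)] by blast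
  note xD = expandsD[OF x] and yD = expandsD[OF y]
  define m where "m = b \<star> c"
  have m: "m \<in> fsupp" "ev m \<noteq> \<zero>"
    using fsupp_conv[OF b(1) cd(1)] ev_conv[OF b(1) cd(1)] D.skew_integral b cd ev_closed
    by (auto simp: m_def)
  have fm: "f \<star> m = (f \<star> b) \<star> c"
    unfolding m_def using conv_assoc xD(3) fsupp_series b(1) cd(1) by simp
  have gm: "g \<star> m = (g \<star> b') \<star> d"
    unfolding m_def cd(5) using conv_assoc yD(3) fsupp_series b'(1) cd(2) by simp
  have "ev (f \<star> m) = x \<otimes> ev m"
    unfolding fm using ev_conv[OF b(3) cd(1)] ev_conv[OF b(1) cd(1)] b ev_closed cd xD
    by (simp add: m_def D.m_assoc)
  moreover have "ev (g \<star> m) = y \<otimes> ev m"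
    unfolding gm using ev_conv[OF b'(3) cd(2)] ev_conv[OF b'(1) cd(2)] b' ev_closed cd yD
    by (simp add: m_def cd(5) D.m_assoc)
  moreover have fg: "f \<star> m \<in> fsupp" "g \<star> m \<in> fsupp"
    using fm gm fsupp_conv b(3) b'(3) cd by auto
  moreover have eq: "sadd f g \<star> m = (\<lambda>q. (f \<star> m) q \<oplus> (g \<star> m) q)"
    using sadd_conv[OF xD(3) yD(3) fsupp_series[OF m(1)]] by (simp add: sadd_def)
  ultimately have "ev (sadd f g \<star> m) = (x \<oplus> y) \<otimes> ev m"
    using ev_add[OF fg] xD yD ev_closed[OF m(1)] by (simp add: D.l_distr)
  moreover have "sadd f g \<star> m \<in> fsupp" unfolding eq using fsupp_add[OF fg] .
  ultimately show ?thesis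
    unfolding expands_def using m xD yD sadd_series_in[OF V] by blast
qed

text \<open>The same exchange as for products of fractions, carried out simultaneously on series and
  on elements of \<open>D\<close>: the numerator of \<open>y\<close> is moved past the denominator
  of \<open>x\<close>. The new denominator is \<open>b' \<star> c\<close>.\<close>

lemma expands_mult:
  assumes x: "expands x f" and y: "expands y g"
  shows "expands (x \<otimes> y) (f \<star> g)"
proof -
  obtain b where b: "b \<in> fsupp" "ev b \<noteq> \<zero>" "f \<star> b \<in> fsupp" "ev (f \<star> b) = x \<otimes> ev b"
    using x by (auto simp: expands_def)
  obtain b' where b': "b' \<in> fsupp" "ev b' \<noteq> \<zero>" "g \<star> b' \<in> fsupp" "ev (g \<star> b') = y \<otimes> ev b'"
    using y by (auto simp: expands_def)
  note xD = expandsD[OF x] and yD = expandsD[OF y]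
  have "\<exists>m\<in>fsupp. ev m \<noteq> \<zero> \<and> (f \<star> g) \<star> m \<in> fsupp \<and> ev ((f \<star> g) \<star> m) = (x \<otimes> y) \<otimes> ev m"
  proof (cases "ev (g \<star> b') = \<zero>")
    case True
    then have gb: "g \<star> b' = (\<lambda>_. \<zero>)" using ev_eq_zero b'(3) by blast
    have "(f \<star> g) \<star> b' = (\<lambda>_. \<zero>)"
      using conv_assoc[OF xD(3) yD(3) fsupp_series[OF b'(1)]] gb by (simp add: conv_zero)
    moreover have "(x \<otimes> y) \<otimes> ev b' = \<zero>"
    proof -
      have "y \<otimes> ev b' = \<zero>" using b'(4) True by simp
      then show ?thesis using xD(1) yD(1) ev_closed[OF b'(1)] by (simp add: D.m_assoc)
    qed
    moreover have "(\<lambda>_. \<zero>) \<in> fsupp" using b'(3) gb by simp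
    ultimately show ?thesis using b'(1,2) ev_zero by auto
  next
    case False
    obtain c d where cd: "c \<in> fsupp" "d \<in> fsupp" "ev c \<noteq> \<zero>" "ev d \<noteq> \<zero>" "(g \<star> b') \<star> c = b \<star> d"
      using fsupp_ore[OF b'(3) False b(1,2)] by blast
    define m where "m = b' \<star> c"
    have m: "m \<in> fsupp" "ev m \<noteq> \<zero>"
      using fsupp_conv[OF b'(1) cd(1)] ev_conv[OF b'(1) cd(1)] D.skew_integral b' cd ev_closed
      by (auto simp: m_def)
    note sers = xD(3) yD(3) fsupp_series[OF b(1)] fsupp_series[OF b'(1)]
      fsupp_series[OF cd(1)] fsupp_series[OF cd(2)]
    have "(f \<star> g) \<star> m = f \<star> ((g \<star> b') \<star> c)"
      unfolding m_def using sers by (simp add: conv_assoc conv_series)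
    also have "\<dots> = (f \<star> b) \<star> d" unfolding cd(5) using sers by (simp add: conv_assoc)
    finally have eq: "(f \<star> g) \<star> m = (f \<star> b) \<star> d" .
    have "ev ((f \<star> g) \<star> m) = x \<otimes> (ev b \<otimes> ev d)"
      unfolding eq using ev_conv[OF b(3) cd(2)] b ev_closed cd xD by (simp add: D.m_assoc)
    also have "ev b \<otimes> ev d = ev ((g \<star> b') \<star> c)"
      using ev_conv[OF b(1) cd(2)] cd(5) by simp
    also have "\<dots> = y \<otimes> ev m"
      using ev_conv[OF b'(3) cd(1)] ev_conv[OF b'(1) cd(1)] b' ev_closed cd yD
      by (simp add: m_def D.m_assoc)
    finally have "ev ((f \<star> g) \<star> m) = (x \<otimes> y) \<otimes> ev m"
      using xD yD ev_closed[OF m(1)] by (simp add: D.m_assoc)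
    then show ?thesis using m eq fsupp_conv[OF b(3) cd(2)] by auto
  qed
  then show ?thesis
    unfolding expands_def using xD yD conv_series_in[OF V] by blast
qed

lemma expands_zero:
  assumes "expands \<zero> f"
  shows "f = (\<lambda>_. \<zero>)"
proof -
  obtain b where b: "b \<in> fsupp" "ev b \<noteq> \<zero>" "f \<star> b \<in> fsupp" "ev (f \<star> b) = \<zero> \<otimes> ev b"
    using assms by (auto simp: expands_def)
  then have "f \<star> b = (\<lambda>_. \<zero>)" using ev_eq_zero ev_closed by simp
  moreover have "b \<noteq> (\<lambda>_. \<zero>)" using b(2) ev_zero by blast
  ultimately show ?thesis
    using conv_eq_zero[OF expandsD(3)[OF assms] fsupp_series[OF b(1)]] by blast
qed

text \<open>The difference of two expansions expands \<zero>; such a series is annihilated by a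
  nonzero finite sum, so it is zero for lack of zero divisors. Hence the expansion does not depend
  on the fraction that witnesses it.\<close>

lemma expands_unique:
  assumes f: "expands x f" and g: "expands x g"
  shows "f = g"
proof
  fix q
  have "expands (x \<oplus> \<ominus> x) (sadd f (sneg g))"
    using expands_add[OF f expands_neg[OF g]] .
  then have "sadd f (sneg g) = (\<lambda>_. \<zero>)"
    using expands_zero expandsD(1)[OF f] by (simp add: D.r_neg)
  then have "f q \<oplus> \<ominus> g q = \<zero>" by (metis sadd_def sneg_def)
  then show "f q = g q"
    using expandsD(3)[OF f] expandsD(3)[OF g]
    by (metis D.minus_equality D.minus_minus D.a_inv_closed series_closed)
qed

text \<open>Every presentation of \<open>x\<close> as a fraction clears the expansion, not only the
  one that witnesses it. This permits a fraction fixed in advance to be used for all orders.\<close>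

lemma expands_denominator:
  assumes f: "expands x f" and a: "a \<in> fsupp" and b: "b \<in> fsupp" and eq: "ev a = x \<otimes> ev b"
  shows "f \<star> b = a"
  using expands_unique[OF expands_mult[OF f expands_ev[OF b]]] expands_ev[OF a] eq by simp

lemma expands_total:
  assumes x: "x \<in> fractions"
  shows "\<exists>f. expands x f"
proof -
  obtain a b where ab: "a \<in> fsupp" "b \<in> fsupp" "ev b \<noteq> \<zero>" "ev a = x \<otimes> ev b" "x \<in> carrier D"
    using x by (auto simp: fractions_def crossed_def)
  have bs: "b \<in> series_in V" using fsupp_series_in[OF ab(2)] .
  have "b \<noteq> (\<lambda>_. \<zero>)" using ab(3) ev_zero by blast
  then obtain q where "b q \<noteq> \<zero>" by (metis ext)
  then obtain p where p: "is_least b p" using is_least_exists[OF series_inD(1)[OF bs]] by blast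
  then have pc: "p \<in> carrier Q" "b p \<noteq> \<zero>"
    using fsuppD(3)[OF ab(2)] by (auto simp: is_least_def)
  then obtain g where g: "g \<in> series_in V" "b \<star> g = sone"
    using conv_right_inverse[OF V bs p] V_inv series_inD(2)[OF bs] by blast
  \<comment> \<open>Long division keeps \<open>g\<close> inside the grading but gives a right
    inverse only; \<open>h\<close> is two-sided but not known to be graded. The two
    coincide.\<close>
  obtain h where h: "h \<in> series" "b \<star> h = sone" "h \<star> b = sone"
    using series_inverse[OF series_inD(1)[OF bs] \<open>b \<noteq> _\<close>] by blast
  note sers = series_inD(1)[OF bs] series_inD(1)[OF g(1)] h(1)
  have "g = (h \<star> b) \<star> g" using h(3) sone_conv sers by simp
  also have "\<dots> = h" using conv_assoc[OF sers(3,1,2)] g(2) conv_sone[OF h(1)] by simp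
  finally have gb: "g \<star> b = sone" using h by simp
  have "(a \<star> g) \<star> b = a"
    using conv_assoc[OF fsupp_series[OF ab(1)] sers(2,1)] gb conv_sone[OF fsupp_series[OF ab(1)]]
    by simp
  then have "expands x (a \<star> g)"
    unfolding expands_def using ab conv_series_in[OF V fsupp_series_in[OF ab(1)] g(1)] by auto
  then show ?thesis by blast
qed

lemma expands_fractions: "expands x f \<Longrightarrow> x \<in> fractions"
  unfolding expands_def fractions_def crossed_def by force

lemma expands_nonzero: "expands x f \<Longrightarrow> x \<noteq> \<zero> \<Longrightarrow> f \<noteq> (\<lambda>_. \<zero>)"
proof
  assume x: "expands x f" "x \<noteq> \<zero>" "f = (\<lambda>_. \<zero>)"
  then obtain b where "x \<in> carrier D" "b \<in> fsupp" "ev b \<noteq> \<zero>" "x \<otimes> ev b = \<zero>"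
    by (auto simp: expands_def zero_conv ev_zero)
  then show False using D.skew_integral ev_closed x(2) by blast
qed

text \<open>The fractions form a skew subfield, so \<open>inv x\<close> has some expansion. It is a
  left inverse of \<open>f\<close> and hence equals every right inverse, wherever that one was
  constructed.\<close>

lemma expands_inverse:
  assumes f: "expands x f" and x: "x \<noteq> \<zero>" and g: "g \<in> series" "f \<star> g = sone"
  shows "expands (inv x) g"
proof -
  have xc: "x \<in> carrier D" using expandsD(1)[OF f] .
  have "inv x \<in> fractions"
    using fractions_skew_subfield[OF am] expands_fractions[OF f] x
    by (auto simp: skew_subfield_def)
  then obtain h where h: "expands (inv x) h" using expands_total by blast
  have "expands \<one> (h \<star> f)"
    using expands_mult[OF h f] D.skew_l_inv[OF xc x] by simp
  then have hf: "h \<star> f = sone" using expands_unique expands_one by blast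
  note sers = expandsD(3)[OF h] expandsD(3)[OF f] g(1)
  have "h = h \<star> (f \<star> g)" using g(2) conv_sone[OF sers(1)] by simp
  also have "\<dots> = g" using conv_assoc[OF sers] hf sone_conv[OF g(1)] by simp
  finally show ?thesis using h by simp
qed

text \<open>The leading term of a fraction is the quotient of the leading terms, so over all orders on
  \<open>Q\<close> only finitely many leading terms occur.\<close>

lemma expands_least:
  assumes f: "expands x f" and p: "is_least f p"
    and a: "a \<in> fsupp" and b: "b \<in> fsupp" "ev b \<noteq> \<zero>" and eq: "ev a = x \<otimes> ev b"
  shows "\<exists>r s. a r \<noteq> \<zero> \<and> b s \<noteq> \<zero> \<and> p = r \<otimes>\<^bsub>Q\<^esub> inv\<^bsub>Q\<^esub> s \<and> f p = a r \<otimes> inv (b s)"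
proof -
  have "b \<noteq> (\<lambda>_. \<zero>)" using b(2) ev_zero by blast
  then obtain q where "b q \<noteq> \<zero>" by (metis ext)
  then obtain s where s: "is_least b s" using is_least_exists[OF fsupp_series[OF b(1)]] by blast
  note fs = expandsD(3)[OF f] and bs = fsupp_series[OF b(1)]
  have fb: "f \<star> b = a" using expands_denominator[OF f a b(1) eq] .
  have pc: "p \<in> carrier Q" and sc: "s \<in> carrier Q" and bs0: "b s \<noteq> \<zero>"
    using p s series_supp_carrier fs bs by (auto simp: is_least_def)
  have val: "a (p \<otimes>\<^bsub>Q\<^esub> s) = f p \<otimes> b s" using conv_least_value[OF fs bs p s] fb by simp
  have "a (p \<otimes>\<^bsub>Q\<^esub> s) \<noteq> \<zero>" using is_least_conv[OF fs bs p s] fb by (auto simp: is_least_def)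
  moreover have "p = (p \<otimes>\<^bsub>Q\<^esub> s) \<otimes>\<^bsub>Q\<^esub> inv\<^bsub>Q\<^esub> s" using pc sc by (simp add: Q.m_assoc)
  moreover have "f p = a (p \<otimes>\<^bsub>Q\<^esub> s) \<otimes> inv (b s)"
    unfolding val using fs bs bs0 by (simp add: D.m_assoc D.skew_r_inv D.skew_inv_closed)
  ultimately show ?thesis using bs0 by blast
qed

text \<open>Long division is performed in the grading \<open>W\<close> of a coefficient ring that
  may be much smaller than the skew field of all coefficients; \<open>expands_inverse\<close>
  identifies its result with the expansion of \<open>inv x\<close>.\<close>

lemma expands_inverse_in:
  assumes f: "expands x f" and x: "x \<noteq> \<zero>" and W: "grading D Q W" and fW: "f \<in> series_in W"
    and p: "\<And>p. is_least f p \<Longrightarrow> inv (f p) \<in> W (inv\<^bsub>Q\<^esub> p)"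
  shows "\<exists>g\<in>series_in W. expands (inv x) g"
proof -
  obtain q where "f q \<noteq> \<zero>" using expands_nonzero[OF f x] by (metis ext)
  then obtain r where r: "is_least f r" using is_least_exists[OF expandsD(3)[OF f]] by blast
  obtain g where g: "g \<in> series_in W" "f \<star> g = sone"
    using conv_right_inverse[OF W fW r p[OF r]] by blast
  then show ?thesis using expands_inverse[OF f x series_inD(1)[OF g(1)] g(2)] by blast
qed

end

text \<open>Conjugation by \<open>w\<close> carries the order \<open>lt'\<close> to \<open>lt\<close>, so it permutes the Malcev--Neumann rings
  instead of acting on one of them.\<close>

lemma expands_conj:
  fixes D (structure)
  assumes cs': "crossed_series D Q lt' V" and cs: "crossed_series D Q lt V"
    and \<alpha>: "\<alpha> \<in> hom Q Q" and \<beta>: "\<beta> \<in> carrier Q \<rightarrow> carrier Q"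
    and \<beta>\<alpha>: "\<And>q. q \<in> carrier Q \<Longrightarrow> \<beta> (\<alpha> q) = q" and \<alpha>\<beta>: "\<And>q. q \<in> carrier Q \<Longrightarrow> \<alpha> (\<beta> q) = q"
    and mono: "\<And>q r. q \<in> carrier Q \<Longrightarrow> r \<in> carrier Q \<Longrightarrow> lt' q r \<Longrightarrow> lt (\<alpha> q) (\<alpha> r)"
    and w: "w \<in> carrier D" "w \<noteq> \<zero>"
    and wV: "\<And>q x. q \<in> carrier Q \<Longrightarrow> x \<in> V q \<Longrightarrow> w \<otimes> x \<otimes> inv w \<in> V (\<alpha> q)"
    and f: "crossed_series.expands D Q lt' V x f"
  shows "crossed_series.expands D Q lt V (w \<otimes> x \<otimes> inv w)
    (\<lambda>q. if q \<in> carrier Q then w \<otimes> f (\<beta> q) \<otimes> inv w else \<zero>)"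
proof -
  interpret A: crossed_series D Q lt' V by (rule cs')
  interpret B: crossed_series D Q lt V by (rule cs)
  define c where "c = (\<lambda>y. w \<otimes> y \<otimes> inv w)"
  \<comment> \<open>Transport of series: positions move by \<alpha>, whose inverse is \<beta>, and
    values are conjugated. As \<open>conv\<close>, \<open>ev\<close> and \<open>fsupp\<close> do not
    involve the order and are respected by this transport, the witness in \<open>expands\<close> is
    carried along.\<close>
  define t where "t = (\<lambda>f q. if q \<in> carrier Q then c (f (\<beta> q)) else \<zero>)"
  have iw: "inv w \<in> carrier D" using w A.D.skew_inv_closed by blast
  have c_closed: "c y \<in> carrier D" if "y \<in> carrier D" for y using that w iw by (simp add: c_def)
  have c_mult: "c (y \<otimes> z) = c y \<otimes> c z" if "y \<in> carrier D" "z \<in> carrier D" for y z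
  proof -
    have "c y \<otimes> c z = w \<otimes> y \<otimes> (inv w \<otimes> w) \<otimes> z \<otimes> inv w"
      using that w iw by (simp add: c_def A.D.m_assoc)
    then show ?thesis using that w iw A.D.skew_l_inv[OF w] by (simp add: c_def A.D.m_assoc)
  qed
  have c_sum: "c (finsum D g S) = (\<Oplus>i\<in>S. c (g i))"
    if "\<And>i. i \<in> S \<Longrightarrow> g i \<in> carrier D" "finite S" for g S
    using that w iw
    by (simp add: c_def A.D.finsum_rdistr A.D.finsum_ldistr Pi_def)
  have c_zero: "c y = \<zero> \<longleftrightarrow> y = \<zero>" if "y \<in> carrier D" for y
    using that w iw A.D.skew_integral A.D.skew_inv_nonzero[OF w]
    unfolding c_def by (metis A.D.l_null A.D.m_closed A.D.r_null)
  have \<alpha>c: "\<alpha> q \<in> carrier Q" if "q \<in> carrier Q" for q using \<alpha> that by (auto simp: hom_def)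
  have \<beta>c: "\<beta> q \<in> carrier Q" if "q \<in> carrier Q" for q using \<beta> that by auto
  have \<alpha>m: "\<alpha> (q \<otimes>\<^bsub>Q\<^esub> r) = \<alpha> q \<otimes>\<^bsub>Q\<^esub> \<alpha> r" if "q \<in> carrier Q" "r \<in> carrier Q" for q r
    using \<alpha> that by (auto simp: hom_def)
  have \<beta>m: "\<beta> (q \<otimes>\<^bsub>Q\<^esub> r) = \<beta> q \<otimes>\<^bsub>Q\<^esub> \<beta> r" if "q \<in> carrier Q" "r \<in> carrier Q" for q r
    using \<alpha>m[of "\<beta> q" "\<beta> r"] \<beta>\<alpha>[of "\<beta> q \<otimes>\<^bsub>Q\<^esub> \<beta> r"] that \<alpha>\<beta> \<beta>c by simp
  have \<beta>inv: "\<beta> (inv\<^bsub>Q\<^esub> q) = inv\<^bsub>Q\<^esub> \<beta> q" if "q \<in> carrier Q" for q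
    using \<beta>m \<beta>c that by (intro group_hom.hom_inv[of Q Q \<beta>])
      (auto simp: group_hom_def group_hom_axioms_def hom_def intro: A.Q.is_group)
  have t_supp: "{q. t g q \<noteq> \<zero>} = \<alpha> ` {q. g q \<noteq> \<zero>}" if g: "g \<in> A.series" for g
  proof (intro equalityI subsetI)
    fix q assume "q \<in> {q. t g q \<noteq> \<zero>}"
    then have "q \<in> carrier Q" "g (\<beta> q) \<noteq> \<zero>"
      using c_zero[of \<zero>] by (auto simp: t_def split: if_splits)
    then show "q \<in> \<alpha> ` {q. g q \<noteq> \<zero>}"
      by (intro image_eqI[of _ _ "\<beta> q"]) (simp_all add: \<alpha>\<beta>)
  next
    fix q assume "q \<in> \<alpha> ` {q. g q \<noteq> \<zero>}"
    then obtain r where r: "g r \<noteq> \<zero>" "q = \<alpha> r" by auto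
    then have "r \<in> carrier Q" using A.series_supp_carrier[OF g] by blast
    then show "q \<in> {q. t g q \<noteq> \<zero>}"
      using r \<alpha>c \<beta>\<alpha> c_zero A.series_closed[OF g] by (simp add: t_def)
  qed
  have t_series: "t g \<in> B.series_in V" if g: "g \<in> A.series_in V" for g
  proof (rule B.series_inI)
    note gs = A.series_inD(1)[OF g]
    have "B.Q.well_ordered (\<alpha> ` {q. g q \<noteq> \<zero>})"
    proof (rule B.Q.well_orderedI)
      show "\<alpha> ` {q. g q \<noteq> \<zero>} \<subseteq> carrier Q" using A.series_supp_carrier[OF gs] \<alpha>c by auto
      fix S assume S: "S \<subseteq> \<alpha> ` {q. g q \<noteq> \<zero>}" "S \<noteq> {}"
      let ?S = "{q. g q \<noteq> \<zero> \<and> \<alpha> q \<in> S}"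
      show "\<exists>m\<in>S. \<forall>x\<in>S. \<not> lt x m"
      proof (rule A.Q.well_orderedE[OF A.series_well_ordered[OF gs], of ?S])
        show "?S \<noteq> {}" using S by auto
        fix m assume m: "m \<in> ?S" "\<And>x. x \<in> ?S \<Longrightarrow> x \<noteq> m \<Longrightarrow> lt' m x"
        have mc: "m \<in> carrier Q" using m(1) A.series_supp_carrier[OF gs] by blast
        have "\<not> lt y (\<alpha> m)" if y: "y \<in> S" for y
        proof -
          obtain z where z: "z \<in> ?S" "y = \<alpha> z" using S y by auto
          have zc: "z \<in> carrier Q" using z(1) A.series_supp_carrier[OF gs] by blast
          have "z = m \<or> lt (\<alpha> m) (\<alpha> z)" using m(2)[OF z(1)] mono[OF mc zc] by blast
          then show ?thesis
            using z(2) B.Q.lt_irrefl B.Q.lt_asym \<alpha>c mc zc by blast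
        qed
        then show ?thesis using m(1) by blast
      qed auto
    qed
    then show "t g \<in> B.series"
      by (rule B.seriesI[rotated])
        (use t_supp[OF gs] c_closed A.series_closed[OF gs] in \<open>auto simp: t_def\<close>)
    fix q assume q: "q \<in> carrier Q"
    have "c (g (\<beta> q)) \<in> V (\<alpha> (\<beta> q))"
      unfolding c_def using wV \<beta>c[OF q] A.series_inD(2)[OF g] by blast
    then show "t g q \<in> V q" using q \<alpha>\<beta> by (simp add: t_def)
  qed
  have t_fsupp: "t b \<in> A.fsupp" if b: "b \<in> A.fsupp" for b
  proof (rule B.fsuppI)
    show "t b \<in> B.series_in V" using t_series[OF A.fsupp_series_in[OF b]] .
    show "finite {q. t b q \<noteq> \<zero>}"
      using t_supp[OF A.fsupp_series[OF b]] A.fsuppD(1)[OF b] by simp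
  qed
  have t_ev: "A.ev (t b) = c (A.ev b)" if b: "b \<in> A.fsupp" for b
  proof -
    note bc = A.fsuppD[OF b]
    have inj: "inj_on \<alpha> {q. b q \<noteq> \<zero>}"
      using \<beta>\<alpha> bc(3) by (metis (mono_tags, lifting) inj_onI mem_Collect_eq)
    have "A.ev (t b) = (\<Oplus>q\<in>\<alpha> ` {q. b q \<noteq> \<zero>}. t b q)"
      unfolding A.ev_def t_supp[OF A.fsupp_series[OF b]] ..
    also have "\<dots> = (\<Oplus>q\<in>{q. b q \<noteq> \<zero>}. t b (\<alpha> q))"
      using bc c_closed by (intro A.D.finsum_reindex inj) (auto simp: t_def)
    also have "\<dots> = (\<Oplus>q\<in>{q. b q \<noteq> \<zero>}. c (b q))"
      using bc c_closed \<alpha>c \<beta>\<alpha> by (intro A.D.finsum_cong') (auto simp: t_def)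
    also have "\<dots> = c (A.ev b)" unfolding A.ev_def using bc by (intro c_sum[symmetric]) auto
    finally show ?thesis .
  qed
  have t_conv: "A.conv (t g) (t b) = t (A.conv g b)"
    if g: "g \<in> A.series_in V" and b: "b \<in> A.series_in V" for g b
  proof
    fix q
    note gs = A.series_inD(1)[OF g] and bs = A.series_inD(1)[OF b]
    show "A.conv (t g) (t b) q = t (A.conv g b) q"
    proof (cases "q \<in> carrier Q")
      case q: True
      let ?S = "{x. g x \<noteq> \<zero> \<and> b (inv\<^bsub>Q\<^esub> x \<otimes>\<^bsub>Q\<^esub> \<beta> q) \<noteq> \<zero>}"
      have finS: "finite ?S" by (rule A.finite_conv_index[OF gs bs \<beta>c[OF q]])
      have Sc: "x \<in> carrier Q" if "x \<in> ?S" for x using that A.series_supp_carrier[OF gs] by blast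
      have inj: "inj_on \<alpha> ?S" using \<beta>\<alpha> Sc by (metis (no_types, lifting) inj_onI)
      have shift: "\<beta> (inv\<^bsub>Q\<^esub> (\<alpha> x) \<otimes>\<^bsub>Q\<^esub> q) = inv\<^bsub>Q\<^esub> x \<otimes>\<^bsub>Q\<^esub> \<beta> q" if "x \<in> carrier Q" for x
        using that q \<alpha>c \<beta>m \<beta>inv \<beta>\<alpha> by simp
      have "A.conv (t g) (t b) q = (\<Oplus>x\<in>\<alpha> ` ?S. t g x \<otimes> t b (inv\<^bsub>Q\<^esub> x \<otimes>\<^bsub>Q\<^esub> q))"
      proof (rule B.conv_eq[OF B.series_inD(1)[OF t_series[OF g]] B.series_inD(1)[OF t_series[OF b]] q])
        show "finite (\<alpha> ` ?S)" using finS by simp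
        fix x assume x: "t g x \<noteq> \<zero>" "t b (inv\<^bsub>Q\<^esub> x \<otimes>\<^bsub>Q\<^esub> q) \<noteq> \<zero>"
        obtain y where y: "g y \<noteq> \<zero>" "x = \<alpha> y" using x(1) t_supp[OF gs] by blast
        have yc: "y \<in> carrier Q" using A.series_supp_carrier[OF gs y(1)] .
        have "b (inv\<^bsub>Q\<^esub> y \<otimes>\<^bsub>Q\<^esub> \<beta> q) \<noteq> \<zero>"
          using x(2) y(2) shift[OF yc] c_zero[of \<zero>] by (auto simp: t_def split: if_splits)
        then show "x \<in> \<alpha> ` ?S" using y by blast
      qed
      also have "\<dots> = (\<Oplus>x\<in>?S. t g (\<alpha> x) \<otimes> t b (inv\<^bsub>Q\<^esub> (\<alpha> x) \<otimes>\<^bsub>Q\<^esub> q))"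
        using B.series_closed[OF B.series_inD(1)[OF t_series[OF g]]]
          B.series_closed[OF B.series_inD(1)[OF t_series[OF b]]]
        by (intro A.D.finsum_reindex inj) auto
      also have "\<dots> = (\<Oplus>x\<in>?S. c (g x \<otimes> b (inv\<^bsub>Q\<^esub> x \<otimes>\<^bsub>Q\<^esub> \<beta> q)))"
      proof (rule A.D.finsum_cong'[OF refl])
        show "(\<lambda>x. c (g x \<otimes> b (inv\<^bsub>Q\<^esub> x \<otimes>\<^bsub>Q\<^esub> \<beta> q))) \<in> ?S \<rightarrow> carrier D"
          using c_closed A.series_closed[OF gs] A.series_closed[OF bs] by auto
        fix x assume "x \<in> ?S"
        then have xc: "x \<in> carrier Q" using Sc by blast
        then have "inv\<^bsub>Q\<^esub> (\<alpha> x) \<otimes>\<^bsub>Q\<^esub> q \<in> carrier Q" using \<alpha>c q by simp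
        then show "t g (\<alpha> x) \<otimes> t b (inv\<^bsub>Q\<^esub> (\<alpha> x) \<otimes>\<^bsub>Q\<^esub> q) = c (g x \<otimes> b (inv\<^bsub>Q\<^esub> x \<otimes>\<^bsub>Q\<^esub> \<beta> q))"
          using xc shift[OF xc] \<alpha>c \<beta>\<alpha> c_mult A.series_closed[OF gs] A.series_closed[OF bs]
          by (simp add: t_def)
      qed
      also have "\<dots> = c (A.conv g b (\<beta> q))"
        unfolding A.conv_def using \<beta>c[OF q] finS A.series_closed[OF gs] A.series_closed[OF bs]
        by (simp add: c_sum)
      finally show ?thesis using q by (simp add: t_def)
    qed (simp add: B.conv_outside t_def)
  qed
  obtain b where b: "b \<in> A.fsupp" "A.ev b \<noteq> \<zero>" "A.conv f b \<in> A.fsupp"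
    "A.ev (A.conv f b) = x \<otimes> A.ev b"
    using f by (auto simp: A.expands_def)
  note fD = A.expandsD[OF f]
  have tfb: "A.conv (t f) (t b) = t (A.conv f b)"
    using t_conv[OF fD(2) A.fsupp_series_in[OF b(1)]] .
  have "B.expands (c x) (t f)"
    unfolding B.expands_def
  proof (intro conjI bexI)
    show "c x \<in> carrier D" using c_closed fD(1) .
    show "t f \<in> B.series_in V" using t_series fD(2) .
    show "t b \<in> A.fsupp" using t_fsupp b(1) .
    show "A.ev (t b) \<noteq> \<zero>" using t_ev[OF b(1)] c_zero A.ev_closed[OF b(1)] b(2) by simp
    show "A.conv (t f) (t b) \<in> A.fsupp" unfolding tfb using t_fsupp b(3) .
    show "A.ev (A.conv (t f) (t b)) = c x \<otimes> A.ev (t b)"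
      unfolding tfb using t_ev b c_mult fD(1) A.ev_closed[OF b(1)] by simp
  qed
  then show ?thesis unfolding t_def c_def .
qed

section \<open>Group rings in Linnell skew fields\<close>

definition gr_single ::
    "('f, 'm) ring_scheme \<Rightarrow> ('g, 'n) monoid_scheme \<Rightarrow> 'f \<Rightarrow> 'g \<Rightarrow> 'g \<Rightarrow> 'f" where
  "gr_single F G c g = (\<lambda>x\<in>carrier G. if x = g then c else \<zero>\<^bsub>F\<^esub>)"

lemma division_closure_least:
  "skew_subfield L D \<Longrightarrow> A \<subseteq> L \<Longrightarrow> division_closure D A \<subseteq> L"
  by (auto simp: division_closure_def)

lemma division_closure_superset: "A \<subseteq> division_closure D A"
  by (auto simp: division_closure_def)

lemma (in skew_field) carrier_skew_subfield: "skew_subfield (carrier R) R"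
  by (simp add: skew_subfield_def carrier_is_subring skew_inv_closed)

lemma (in skew_field) division_closure_skew_subfield:
  assumes "A \<subseteq> carrier R"
  shows "skew_subfield (division_closure R A) R"
proof -
  let ?S = "{L. skew_subfield L R \<and> A \<subseteq> L}"
  have "carrier R \<in> ?S" using assms carrier_skew_subfield by simp
  then have "subring (\<Inter>?S) R"
    by (intro subring_Inter) (auto simp: skew_subfield_def)
  then show ?thesis
    by (auto simp: skew_subfield_def division_closure_def)
qed

locale linnell_ring = F: field F + G: group G + D: skew_field D
  for F :: "('f, 'm) ring_scheme" and G :: "('g, 'n) monoid_scheme" and D :: "('d, 'k) ring_scheme" (structure)
    and \<iota> :: "('g \<Rightarrow> 'f) \<Rightarrow> 'd" +
  assumes linnell: "linnell_skew_field F G D \<iota>"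
begin

abbreviation "GR \<equiv> group_ring F G"
abbreviation "single \<equiv> gr_single F G"

definition u :: "'g \<Rightarrow> 'd" where
  "u g = \<iota> (group_elem F G g)"

definition \<kappa> :: "'f \<Rightarrow> 'd" where
  "\<kappa> c = \<iota> (single c \<one>\<^bsub>G\<^esub>)"

definition gimage :: "'g set \<Rightarrow> 'd set" where
  "gimage K = \<iota> ` group_subring F G K"

abbreviation clos :: "'g set \<Rightarrow> 'd set" where
  "clos K \<equiv> sub_division_ring F G D \<iota> K"

lemma \<iota>_hom: "\<iota> \<in> ring_hom GR D"
  using linnell by (simp add: linnell_skew_field_def)

lemma GR_carrier:
  "a \<in> carrier GR \<longleftrightarrow> a \<in> carrier G \<rightarrow>\<^sub>E carrier F \<and> finite {g \<in> carrier G. a g \<noteq> \<zero>\<^bsub>F\<^esub>}"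
  by (simp add: group_ring_def)

lemma GR_add: "a \<oplus>\<^bsub>GR\<^esub> b = (\<lambda>g\<in>carrier G. a g \<oplus>\<^bsub>F\<^esub> b g)"
  by (simp add: group_ring_def)

lemma GR_mult: "a \<otimes>\<^bsub>GR\<^esub> b = (\<lambda>g\<in>carrier G.
    (\<Oplus>\<^bsub>F\<^esub>p\<in>{(x, y). x \<in> carrier G \<and> y \<in> carrier G \<and> a x \<noteq> \<zero>\<^bsub>F\<^esub> \<and> b y \<noteq> \<zero>\<^bsub>F\<^esub> \<and>
        x \<otimes>\<^bsub>G\<^esub> y = g}. a (fst p) \<otimes>\<^bsub>F\<^esub> b (snd p)))"
  by (simp add: group_ring_def)

lemma \<iota>_closed: "a \<in> carrier GR \<Longrightarrow> \<iota> a \<in> carrier D"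
  using ring_hom_closed[OF \<iota>_hom] .

lemma \<iota>_add: "a \<in> carrier GR \<Longrightarrow> b \<in> carrier GR \<Longrightarrow> \<iota> (\<lambda>g\<in>carrier G. a g \<oplus>\<^bsub>F\<^esub> b g) = \<iota> a \<oplus> \<iota> b"
  using ring_hom_add[OF \<iota>_hom] by (simp add: GR_add)

lemma single_closed: "c \<in> carrier F \<Longrightarrow> single c g \<in> carrier GR"
proof -
  assume c: "c \<in> carrier F"
  have "{h \<in> carrier G. single c g h \<noteq> \<zero>\<^bsub>F\<^esub>} \<subseteq> {g}" by (auto simp: gr_single_def)
  then have "finite {h \<in> carrier G. single c g h \<noteq> \<zero>\<^bsub>F\<^esub>}" by (rule finite_subset) simp
  then show ?thesis using c by (simp add: GR_carrier) (auto simp: gr_single_def)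
qed

lemma single_mult:
  assumes c: "c \<in> carrier F" "d \<in> carrier F" and g: "g \<in> carrier G" "h \<in> carrier G"
  shows "single c g \<otimes>\<^bsub>GR\<^esub> single d h = single (c \<otimes>\<^bsub>F\<^esub> d) (g \<otimes>\<^bsub>G\<^esub> h)"
proof
  fix k
  show "(single c g \<otimes>\<^bsub>GR\<^esub> single d h) k = single (c \<otimes>\<^bsub>F\<^esub> d) (g \<otimes>\<^bsub>G\<^esub> h) k"
  proof (cases "k \<in> carrier G")
    case k: True
    let ?P = "{(x, y). x \<in> carrier G \<and> y \<in> carrier G \<and> single c g x \<noteq> \<zero>\<^bsub>F\<^esub> \<and>
      single d h y \<noteq> \<zero>\<^bsub>F\<^esub> \<and> x \<otimes>\<^bsub>G\<^esub> y = k}"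
    have P: "?P = (if k = g \<otimes>\<^bsub>G\<^esub> h \<and> c \<noteq> \<zero>\<^bsub>F\<^esub> \<and> d \<noteq> \<zero>\<^bsub>F\<^esub> then {(g, h)} else {})"
      using g by (auto simp: gr_single_def split: if_splits)
    have "(single c g \<otimes>\<^bsub>GR\<^esub> single d h) k =
        (\<Oplus>\<^bsub>F\<^esub>p\<in>?P. single c g (fst p) \<otimes>\<^bsub>F\<^esub> single d h (snd p))"
      using k by (simp add: GR_mult)
    also have "\<dots> = (if k = g \<otimes>\<^bsub>G\<^esub> h then c \<otimes>\<^bsub>F\<^esub> d else \<zero>\<^bsub>F\<^esub>)"
      unfolding P using c g by (auto simp: gr_single_def)
    finally show ?thesis using k by (simp add: gr_single_def)
  qed (simp add: GR_mult gr_single_def)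
qed

lemma u_single: "u g = \<iota> (single \<one>\<^bsub>F\<^esub> g)"
  by (simp add: u_def group_elem_def gr_single_def)

text \<open>The two factorizations together say that scalars commute with group elements in
  \<open>D\<close>.\<close>

lemma \<iota>_single:
  assumes "c \<in> carrier F" "g \<in> carrier G"
  shows "\<iota> (single c g) = \<kappa> c \<otimes> u g" "\<iota> (single c g) = u g \<otimes> \<kappa> c"
proof -
  note m = ring_hom_mult[OF \<iota>_hom single_closed single_closed, symmetric]
  show "\<iota> (single c g) = \<kappa> c \<otimes> u g"
    using assms m[of c "\<one>\<^bsub>F\<^esub>"] by (simp add: \<kappa>_def u_single single_mult)
  show "\<iota> (single c g) = u g \<otimes> \<kappa> c"
    using assms m[of "\<one>\<^bsub>F\<^esub>" c] by (simp add: \<kappa>_def u_single single_mult)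
qed

lemma u_closed: "u g \<in> carrier D"
  by (simp add: u_single \<iota>_closed single_closed)

lemma \<kappa>_closed: "c \<in> carrier F \<Longrightarrow> \<kappa> c \<in> carrier D"
  by (simp add: \<kappa>_def \<iota>_closed single_closed)

lemma u_mult: "g \<in> carrier G \<Longrightarrow> h \<in> carrier G \<Longrightarrow> u (g \<otimes>\<^bsub>G\<^esub> h) = u g \<otimes> u h"
  using ring_hom_mult[OF \<iota>_hom single_closed single_closed, of "\<one>\<^bsub>F\<^esub>" "\<one>\<^bsub>F\<^esub>" g h]
  by (simp add: u_single single_mult)

lemma u_one: "u \<one>\<^bsub>G\<^esub> = \<one>"
  using ring_hom_one[OF \<iota>_hom] by (simp add: u_def group_ring_def group_elem_def)

lemma u_nonzero: "g \<in> carrier G \<Longrightarrow> u g \<noteq> \<zero>"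
proof
  assume g: "g \<in> carrier G" "u g = \<zero>"
  then have "u g \<otimes> u (inv\<^bsub>G\<^esub> g) = \<zero>" using u_closed by simp
  then show False using g u_mult[of g "inv\<^bsub>G\<^esub> g"] u_one D.zero_neq_one by simp
qed

lemma u_inv: "g \<in> carrier G \<Longrightarrow> inv (u g) = u (inv\<^bsub>G\<^esub> g)"
  using u_mult[of g "inv\<^bsub>G\<^esub> g"] u_mult[of "inv\<^bsub>G\<^esub> g" g] u_one u_closed
  by (intro D.inv_char) auto

lemma \<iota>_zero: "\<iota> (\<lambda>g\<in>carrier G. \<zero>\<^bsub>F\<^esub>) = \<zero>"
proof -
  let ?z = "\<lambda>g\<in>carrier G. \<zero>\<^bsub>F\<^esub>"
  have z: "?z \<in> carrier GR" by (simp add: GR_carrier)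
  have "(\<lambda>g\<in>carrier G. ?z g \<oplus>\<^bsub>F\<^esub> ?z g) = ?z" by auto
  then have "\<iota> ?z = \<iota> ?z \<oplus> \<iota> ?z" using \<iota>_add[OF z z] by simp
  then show ?thesis using \<iota>_closed[OF z] by (metis D.add.l_cancel_one)
qed

lemma \<iota>_eq_sum:
  assumes "a \<in> carrier GR" "finite S" "S \<subseteq> carrier G"
    "\<And>g. g \<in> carrier G \<Longrightarrow> a g \<noteq> \<zero>\<^bsub>F\<^esub> \<Longrightarrow> g \<in> S"
  shows "\<iota> a = (\<Oplus>g\<in>S. \<kappa> (a g) \<otimes> u g)"
  using assms(2,1,3,4)
proof (induction S arbitrary: a rule: finite_induct)
  case empty
  then have "a = (\<lambda>g\<in>carrier G. \<zero>\<^bsub>F\<^esub>)"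
    by (intro ext) (auto simp: GR_carrier PiE_def extensional_def)
  then have "\<iota> a = \<zero>" by (simp only: \<iota>_zero)
  then show ?case by simp
next
  case (insert g S)
  have g: "g \<in> carrier G" and S: "S \<subseteq> carrier G" using insert.prems by auto
  have ac: "a x \<in> carrier F" if "x \<in> carrier G" for x
    using insert.prems(1) that by (auto simp: GR_carrier)
  define b where "b = (\<lambda>x\<in>carrier G. if x = g then \<zero>\<^bsub>F\<^esub> else a x)"
  have "{x \<in> carrier G. b x \<noteq> \<zero>\<^bsub>F\<^esub>} \<subseteq> {x \<in> carrier G. a x \<noteq> \<zero>\<^bsub>F\<^esub>}" by (auto simp: b_def)
  then have "finite {x \<in> carrier G. b x \<noteq> \<zero>\<^bsub>F\<^esub>}"
    using insert.prems(1) finite_subset by (auto simp: GR_carrier)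
  then have b: "b \<in> carrier GR" using ac by (simp add: GR_carrier) (auto simp: b_def)
  have kc: "\<kappa> (a x) \<otimes> u x \<in> carrier D" if "x \<in> carrier G" for x
    using ac[OF that] \<kappa>_closed u_closed by simp
  have "a = (\<lambda>x\<in>carrier G. single (a g) g x \<oplus>\<^bsub>F\<^esub> b x)"
  proof
    fix x
    show "a x = (\<lambda>x\<in>carrier G. single (a g) g x \<oplus>\<^bsub>F\<^esub> b x) x"
      using insert.prems(1) ac[of x]
      by (cases "x \<in> carrier G") (auto simp: b_def gr_single_def GR_carrier PiE_def extensional_def)
  qed
  then have "\<iota> a = \<iota> (single (a g) g) \<oplus> \<iota> b"
    using \<iota>_add[OF single_closed[OF ac[OF g]] b] by metis
  also have "\<iota> (single (a g) g) = \<kappa> (a g) \<otimes> u g" using \<iota>_single ac g by blast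
  also have "\<iota> b = (\<Oplus>x\<in>S. \<kappa> (b x) \<otimes> u x)"
    by (rule insert.IH[OF b S]) (use insert.prems(3) in \<open>auto simp: b_def split: if_splits\<close>)
  also have "\<dots> = (\<Oplus>x\<in>S. \<kappa> (a x) \<otimes> u x)"
    using insert.hyps S kc by (intro D.finsum_cong') (auto simp: b_def subset_iff)
  also have "\<kappa> (a g) \<otimes> u g \<oplus> (\<Oplus>x\<in>S. \<kappa> (a x) \<otimes> u x) = (\<Oplus>x\<in>insert g S. \<kappa> (a x) \<otimes> u x)"
    using insert.hyps S kc g by (intro D.finsum_insert[symmetric]) auto
  finally show ?case .
qed

lemma group_subringD:
  assumes "a \<in> group_subring F G K"
  shows "a \<in> carrier GR" "\<And>g. g \<in> carrier G \<Longrightarrow> a g \<noteq> \<zero>\<^bsub>F\<^esub> \<Longrightarrow> g \<in> K"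
    "\<And>g. g \<in> carrier G \<Longrightarrow> a g \<in> carrier F"
  using assms by (auto simp: group_subring_def GR_carrier)

lemma single_subring: "c \<in> carrier F \<Longrightarrow> g \<in> K \<Longrightarrow> single c g \<in> group_subring F G K"
  using single_closed by (auto simp: group_subring_def gr_single_def)

lemma image_carrier: "gimage K \<subseteq> carrier D"
  using \<iota>_closed by (auto simp: gimage_def group_subring_def)

lemma \<kappa>_image: "subgroup K G \<Longrightarrow> c \<in> carrier F \<Longrightarrow> \<kappa> c \<in> gimage K"
  unfolding \<kappa>_def gimage_def by (intro imageI single_subring subgroup.one_closed)

lemma u_image: "h \<in> K \<Longrightarrow> u h \<in> gimage K"
  unfolding u_single gimage_def by (intro imageI single_subring) auto

lemma image_subring:
  assumes K: "subgroup K G"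
  shows "subring (gimage K) D"
proof (rule D.subringI)
  show "gimage K \<subseteq> carrier D" by (rule image_carrier)
  show "\<one> \<in> gimage K" using u_image[OF subgroup.one_closed[OF K]] u_one by simp
next
  fix x assume "x \<in> gimage K"
  then obtain a where a: "a \<in> group_subring F G K" "x = \<iota> a" by (auto simp: gimage_def)
  note aD = group_subringD[OF a(1)]
  define b where "b = (\<lambda>g\<in>carrier G. \<ominus>\<^bsub>F\<^esub> a g)"
  have "{g \<in> carrier G. b g \<noteq> \<zero>\<^bsub>F\<^esub>} = {g \<in> carrier G. a g \<noteq> \<zero>\<^bsub>F\<^esub>}"
    using aD(3) by (auto simp: b_def)
  then have b: "b \<in> group_subring F G K"
    using a(1) aD(3) by (simp add: group_subring_def GR_carrier) (auto simp: b_def)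
  have "(\<lambda>g\<in>carrier G. b g \<oplus>\<^bsub>F\<^esub> a g) = (\<lambda>g\<in>carrier G. \<zero>\<^bsub>F\<^esub>)"
    using aD(3) by (auto simp: b_def F.l_neg)
  then have "\<iota> b \<oplus> \<iota> a = \<zero>" using \<iota>_add[OF group_subringD(1)[OF b] aD(1)] \<iota>_zero by simp
  then have "\<ominus> \<iota> a = \<iota> b"
    using \<iota>_closed[OF aD(1)] \<iota>_closed[OF group_subringD(1)[OF b]] by (simp add: D.minus_equality)
  then show "\<ominus> x \<in> gimage K" using a(2) b by (auto simp: gimage_def)
next
  fix x y assume "x \<in> gimage K" "y \<in> gimage K"
  then obtain a b where a: "a \<in> group_subring F G K" "x = \<iota> a"
    and b: "b \<in> group_subring F G K" "y = \<iota> b" by (auto simp: gimage_def)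
  note aD = group_subringD[OF a(1)] and bD = group_subringD[OF b(1)]
  let ?A = "{g \<in> carrier G. a g \<noteq> \<zero>\<^bsub>F\<^esub>}" and ?B = "{g \<in> carrier G. b g \<noteq> \<zero>\<^bsub>F\<^esub>}"
  have fin: "finite ?A" "finite ?B" using aD(1) bD(1) by (auto simp: GR_carrier)
  show "x \<oplus> y \<in> gimage K"
  proof -
    let ?c = "\<lambda>g\<in>carrier G. a g \<oplus>\<^bsub>F\<^esub> b g"
    have "{g \<in> carrier G. ?c g \<noteq> \<zero>\<^bsub>F\<^esub>} \<subseteq> ?A \<union> ?B" using aD(3) bD(3) by auto
    then have "finite {g \<in> carrier G. ?c g \<noteq> \<zero>\<^bsub>F\<^esub>}" using fin finite_subset by blast
    moreover have "?c g = \<zero>\<^bsub>F\<^esub>" if "g \<in> carrier G - K" for g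
    proof -
      have "a g = \<zero>\<^bsub>F\<^esub>" "b g = \<zero>\<^bsub>F\<^esub>" using that aD(2) bD(2) by auto
      then show ?thesis using that by simp
    qed
    ultimately have "?c \<in> group_subring F G K"
      using aD(3) bD(3) by (simp add: group_subring_def GR_carrier)
    then show ?thesis using \<iota>_add[OF aD(1) bD(1)] a(2) b(2) unfolding gimage_def by (metis imageI)
  qed
  show "x \<otimes> y \<in> gimage K"
  proof -
    let ?c = "a \<otimes>\<^bsub>GR\<^esub> b"
    let ?P = "\<lambda>g. {(x, y). x \<in> carrier G \<and> y \<in> carrier G \<and> a x \<noteq> \<zero>\<^bsub>F\<^esub> \<and> b y \<noteq> \<zero>\<^bsub>F\<^esub> \<and>
        x \<otimes>\<^bsub>G\<^esub> y = g}"
    have val: "?c g = (\<Oplus>\<^bsub>F\<^esub>p\<in>?P g. a (fst p) \<otimes>\<^bsub>F\<^esub> b (snd p))" if "g \<in> carrier G" for g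
      using that by (simp add: GR_mult)
    have empty: "?P g \<noteq> {}" if "g \<in> carrier G" "?c g \<noteq> \<zero>\<^bsub>F\<^esub>" for g
      using val[OF that(1)] that(2) by (metis F.finsum_empty)
    have "{g \<in> carrier G. ?c g \<noteq> \<zero>\<^bsub>F\<^esub>} \<subseteq> ?A <#>\<^bsub>G\<^esub> ?B"
    proof
      fix g assume "g \<in> {g \<in> carrier G. ?c g \<noteq> \<zero>\<^bsub>F\<^esub>}"
      then have "?P g \<noteq> {}" using empty by blast
      then show "g \<in> ?A <#>\<^bsub>G\<^esub> ?B" unfolding set_mult_def by blast
    qed
    moreover have "finite (?A <#>\<^bsub>G\<^esub> ?B)" using fin by (simp add: set_mult_def)
    ultimately have "finite {g \<in> carrier G. ?c g \<noteq> \<zero>\<^bsub>F\<^esub>}" using finite_subset by blast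
    moreover have "?c \<in> carrier G \<rightarrow>\<^sub>E carrier F"
    proof
      fix g assume g: "g \<in> carrier G"
      show "?c g \<in> carrier F"
        unfolding val[OF g] using aD(3) bD(3) by (intro F.finsum_closed) auto
    qed (simp add: GR_mult)
    moreover have "?c g = \<zero>\<^bsub>F\<^esub>" if g: "g \<in> carrier G - K" for g
    proof (rule ccontr)
      assume "?c g \<noteq> \<zero>\<^bsub>F\<^esub>"
      then obtain x y where "x \<in> carrier G" "y \<in> carrier G" "a x \<noteq> \<zero>\<^bsub>F\<^esub>" "b y \<noteq> \<zero>\<^bsub>F\<^esub>"
        "x \<otimes>\<^bsub>G\<^esub> y = g" using empty[of g] g by blast
      then show False using aD(2) bD(2) subgroup.m_closed[OF K] g by blast
    qed
    ultimately have "?c \<in> group_subring F G K" by (simp add: group_subring_def GR_carrier)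
    then show ?thesis
      using ring_hom_mult[OF \<iota>_hom aD(1) bD(1)] a(2) b(2) unfolding gimage_def by (metis imageI)
  qed
qed

lemma closure_skew_subfield: "skew_subfield (clos K) D"
  unfolding sub_division_ring_def
  using D.division_closure_skew_subfield[OF image_carrier[of K]] by (simp add: gimage_def)

lemma image_closure: "gimage K \<subseteq> clos K"
  unfolding sub_division_ring_def gimage_def by (rule division_closure_superset)

lemma closure_least: "skew_subfield L D \<Longrightarrow> gimage K \<subseteq> L \<Longrightarrow> clos K \<subseteq> L"
  unfolding sub_division_ring_def gimage_def by (rule division_closure_least)

text \<open>The minimality clause in the definition of a Linnell skew field.\<close>

lemma closure_top: "clos (carrier G) = carrier D"
proof -
  have "group_subring F G (carrier G) = carrier GR" by (auto simp: group_subring_def)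
  then show ?thesis
    using linnell by (simp add: sub_division_ring_def linnell_skew_field_def)
qed

section \<open>Conjugation by group elements\<close>

definition conj_by :: "'g \<Rightarrow> 'd \<Rightarrow> 'd" where
  "conj_by g x = u g \<otimes> x \<otimes> inv (u g)"

lemma inv_u_closed: "g \<in> carrier G \<Longrightarrow> inv (u g) \<in> carrier D"
  using u_inv u_closed by simp

lemma conj_closed: "g \<in> carrier G \<Longrightarrow> x \<in> carrier D \<Longrightarrow> conj_by g x \<in> carrier D"
  by (simp add: conj_by_def u_closed inv_u_closed)

lemma conj_mult:
  assumes "g \<in> carrier G" "x \<in> carrier D" "y \<in> carrier D"
  shows "conj_by g (x \<otimes> y) = conj_by g x \<otimes> conj_by g y"
proof -
  have "conj_by g x \<otimes> conj_by g y = u g \<otimes> x \<otimes> (inv (u g) \<otimes> u g) \<otimes> y \<otimes> inv (u g)"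
    using assms u_closed inv_u_closed by (simp add: conj_by_def D.m_assoc)
  then show ?thesis
    using assms u_closed inv_u_closed D.skew_l_inv[OF u_closed u_nonzero]
    by (simp add: conj_by_def D.m_assoc)
qed

lemma conj_add:
  "g \<in> carrier G \<Longrightarrow> x \<in> carrier D \<Longrightarrow> y \<in> carrier D \<Longrightarrow> conj_by g (x \<oplus> y) = conj_by g x \<oplus> conj_by g y"
  using u_closed inv_u_closed by (simp add: conj_by_def D.l_distr D.r_distr)

lemma conj_neg: "g \<in> carrier G \<Longrightarrow> x \<in> carrier D \<Longrightarrow> conj_by g (\<ominus> x) = \<ominus> conj_by g x"
  using u_closed inv_u_closed by (simp add: conj_by_def D.l_minus D.r_minus)

lemma conj_one: "g \<in> carrier G \<Longrightarrow> conj_by g \<one> = \<one>"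
  using u_closed D.skew_r_inv[OF u_closed u_nonzero] by (simp add: conj_by_def)

lemma conj_zero: "g \<in> carrier G \<Longrightarrow> conj_by g \<zero> = \<zero>"
  using u_closed inv_u_closed by (simp add: conj_by_def)

lemma conj_conj_inv: "g \<in> carrier G \<Longrightarrow> x \<in> carrier D \<Longrightarrow> conj_by (inv\<^bsub>G\<^esub> g) (conj_by g x) = x"
proof -
  assume g: "g \<in> carrier G" and x: "x \<in> carrier D"
  have "conj_by (inv\<^bsub>G\<^esub> g) (conj_by g x) = (inv (u g) \<otimes> u g) \<otimes> x \<otimes> (inv (u g) \<otimes> u g)"
    using g x u_inv[OF g] u_inv[of "inv\<^bsub>G\<^esub> g"] u_closed by (simp add: conj_by_def D.m_assoc)
  then show ?thesis using x D.skew_l_inv[OF u_closed u_nonzero[OF g]] by simp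
qed

lemma conj_inv:
  assumes g: "g \<in> carrier G" and x: "x \<in> carrier D" "x \<noteq> \<zero>"
  shows "conj_by g (inv x) = inv (conj_by g x)"
proof (rule D.inv_char[symmetric])
  have ix: "inv x \<in> carrier D" using D.skew_inv_closed x by blast
  show "conj_by g x \<otimes> conj_by g (inv x) = \<one>"
    using conj_mult[OF g x(1) ix] D.skew_r_inv[OF x] conj_one[OF g] by simp
  show "conj_by g (inv x) \<otimes> conj_by g x = \<one>"
    using conj_mult[OF g ix x(1)] D.skew_l_inv[OF x] conj_one[OF g] by simp
  show "conj_by g x \<in> carrier D" "conj_by g (inv x) \<in> carrier D" using conj_closed g x ix by auto
qed

lemma conj_u: "g \<in> carrier G \<Longrightarrow> h \<in> carrier G \<Longrightarrow> conj_by g (u h) = u (g \<otimes>\<^bsub>G\<^esub> h \<otimes>\<^bsub>G\<^esub> inv\<^bsub>G\<^esub> g)"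
  by (simp add: conj_by_def u_inv u_mult)

lemma conj_\<kappa>: "g \<in> carrier G \<Longrightarrow> c \<in> carrier F \<Longrightarrow> conj_by g (\<kappa> c) = \<kappa> c"
proof -
  assume g: "g \<in> carrier G" and c: "c \<in> carrier F"
  have "u g \<otimes> \<kappa> c = \<kappa> c \<otimes> u g" using \<iota>_single[OF c g] by simp
  then show ?thesis
    using g c \<kappa>_closed u_closed inv_u_closed D.skew_r_inv[OF u_closed u_nonzero[OF g]]
    by (simp add: conj_by_def D.m_assoc)
qed

lemma conj_image:
  assumes K: "K \<lhd> G" and g: "g \<in> carrier G" and x: "x \<in> gimage K"
  shows "conj_by g x \<in> gimage K"
proof -
  note sub = image_subring[OF normal_imp_subgroup[OF K]]
  have KG: "K \<subseteq> carrier G" using K normal_imp_subgroup subgroup.subset by blast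
  obtain a where a: "a \<in> group_subring F G K" "x = \<iota> a" using x by (auto simp: gimage_def)
  note aD = group_subringD[OF a(1)]
  let ?S = "{h \<in> carrier G. a h \<noteq> \<zero>\<^bsub>F\<^esub>}"
  have S: "finite ?S" using aD(1) by (simp add: GR_carrier)
  have t: "\<kappa> (a h) \<otimes> u h \<in> carrier D" if "h \<in> carrier G" for h
    using aD(3)[OF that] \<kappa>_closed u_closed by simp
  have "x = (\<Oplus>h\<in>?S. \<kappa> (a h) \<otimes> u h)"
    unfolding a(2) using aD(1) S by (intro \<iota>_eq_sum) auto
  then have "conj_by g x = (\<Oplus>h\<in>?S. u g \<otimes> (\<kappa> (a h) \<otimes> u h)) \<otimes> inv (u g)"
    unfolding conj_by_def using S t u_closed by (subst D.finsum_rdistr[symmetric]) auto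
  also have "\<dots> = (\<Oplus>h\<in>?S. conj_by g (\<kappa> (a h) \<otimes> u h))"
    unfolding conj_by_def using S t u_closed inv_u_closed[OF g] by (intro D.finsum_ldistr) auto
  also have "\<dots> \<in> gimage K"
  proof (rule D.subring_finsum_closed[OF sub])
    fix h assume h: "h \<in> ?S"
    then have hK: "h \<in> K" "h \<in> carrier G" using aD(2) by auto
    have "g \<otimes>\<^bsub>G\<^esub> h \<otimes>\<^bsub>G\<^esub> inv\<^bsub>G\<^esub> g \<in> K" using normal.inv_op_closed2[OF K g hK(1)] .
    then show "conj_by g (\<kappa> (a h) \<otimes> u h) \<in> gimage K"
      using hK g aD(3) \<kappa>_image[OF normal_imp_subgroup[OF K]] u_image
      by (simp add: conj_mult \<kappa>_closed u_closed conj_\<kappa> conj_u subringE(6)[OF sub])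
  qed
  finally show ?thesis .
qed

lemma conj_vimage_skew_subfield:
  assumes L: "skew_subfield L D" and g: "g \<in> carrier G"
  shows "skew_subfield {x \<in> carrier D. conj_by g x \<in> L} D"
  unfolding skew_subfield_def
proof
  note LD = D.skew_subfieldD[OF L]
  show "subring {x \<in> carrier D. conj_by g x \<in> L} D"
    by (rule D.subringI)
      (use LD g in \<open>auto simp: conj_one conj_neg conj_mult conj_add\<close>)
  show "\<forall>x\<in>{x \<in> carrier D. conj_by g x \<in> L} - {\<zero>}. inv x \<in> {x \<in> carrier D. conj_by g x \<in> L}"
  proof
    fix x assume x: "x \<in> {x \<in> carrier D. conj_by g x \<in> L} - {\<zero>}"
    have "conj_by g x \<noteq> \<zero>"
      using x conj_conj_inv[OF g, of x] conj_zero[of "inv\<^bsub>G\<^esub> g"] g by auto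
    then show "inv x \<in> {x \<in> carrier D. conj_by g x \<in> L}"
      using x g LD(8) by (auto simp: conj_inv D.skew_inv_closed)
  qed
qed

text \<open>The elements that conjugation sends into \<open>clos K\<close> form a skew subfield, and
  it contains the group ring of \<open>K\<close> because \<open>K\<close> is normal. This replaces
  the extension of automorphisms of \<open>K\<close> to the division closure.\<close>

lemma conj_closure:
  assumes K: "K \<lhd> G" and g: "g \<in> carrier G" and x: "x \<in> clos K"
  shows "conj_by g x \<in> clos K"
proof -
  have "gimage K \<subseteq> {x \<in> carrier D. conj_by g x \<in> clos K}"
    using conj_image[OF K g] image_closure image_carrier by blast
  then have "clos K \<subseteq> {x \<in> carrier D. conj_by g x \<in> clos K}"
    by (rule closure_least[OF conj_vimage_skew_subfield[OF closure_skew_subfield g]])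
  then show ?thesis using x by blast
qed

end

section \<open>Subquotients\<close>

lemma (in ring) finsum_subring:
  assumes L: "subring L R" and f: "\<And>i. i \<in> A \<Longrightarrow> f i \<in> L"
  shows "finsum (R\<lparr>carrier := L\<rparr>) f A = finsum R f A"
proof (cases "finite A")
  case True
  interpret L: ring "R\<lparr>carrier := L\<rparr>" by (rule subring_is_ring[OF L])
  have LR: "x \<in> carrier R" if "x \<in> L" for x using subringE(1)[OF L] that by blast
  from True f show ?thesis
  proof (induction A rule: finite_induct)
    case (insert i A)
    then have "finsum (R\<lparr>carrier := L\<rparr>) f (insert i A) =
        f i \<oplus>\<^bsub>R\<lparr>carrier := L\<rparr>\<^esub> finsum (R\<lparr>carrier := L\<rparr>) f A"
      by (intro L.finsum_insert) auto
    moreover have "finsum R f (insert i A) = f i \<oplus> finsum R f A"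
      using insert LR by (intro finsum_insert) auto
    ultimately show ?case using insert by simp
  qed simp
next
  case False
  then show ?thesis by (simp add: finsum_def finprod_def)
qed

context linnell_ring
begin

text \<open>The rings \<open>R\<close> to which the construction \<open>R ** Q\<close> applies.
  Invariance is required under all of \<open>G\<close>, not just under the numerator of the
  quotient, so that the next level of the tower receives the same property.\<close>

definition coef_ring :: "'g set \<Rightarrow> 'd set \<Rightarrow> bool" where
  "coef_ring K R \<longleftrightarrow> subring R D \<and> gimage K \<subseteq> R \<and> R \<subseteq> clos K \<and>
     (\<forall>g\<in>carrier G. \<forall>x\<in>R. conj_by g x \<in> R)"

lemma coef_ringD:
  assumes "coef_ring K R"
  shows "subring R D" "\<And>x. x \<in> gimage K \<Longrightarrow> x \<in> R" "\<And>x. x \<in> R \<Longrightarrow> x \<in> clos K"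
    "\<And>g x. g \<in> carrier G \<Longrightarrow> x \<in> R \<Longrightarrow> conj_by g x \<in> R"
    "\<And>x. x \<in> R \<Longrightarrow> x \<in> carrier D"
    "\<zero> \<in> R" "\<one> \<in> R" "\<And>x. x \<in> R \<Longrightarrow> \<ominus> x \<in> R"
    "\<And>x y. x \<in> R \<Longrightarrow> y \<in> R \<Longrightarrow> x \<otimes> y \<in> R" "\<And>x y. x \<in> R \<Longrightarrow> y \<in> R \<Longrightarrow> x \<oplus> y \<in> R"
    "\<And>k. k \<in> K \<Longrightarrow> u k \<in> R"
proof -
  show "subring R D" and im: "\<And>x. x \<in> gimage K \<Longrightarrow> x \<in> R" and "\<And>x. x \<in> R \<Longrightarrow> x \<in> clos K"
    and "\<And>g x. g \<in> carrier G \<Longrightarrow> x \<in> R \<Longrightarrow> conj_by g x \<in> R"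
    using assms by (auto simp: coef_ring_def)
  note R = subringE[OF this(1)]
  show "\<And>x. x \<in> R \<Longrightarrow> x \<in> carrier D" "\<zero> \<in> R" "\<one> \<in> R" "\<And>x. x \<in> R \<Longrightarrow> \<ominus> x \<in> R"
    "\<And>x y. x \<in> R \<Longrightarrow> y \<in> R \<Longrightarrow> x \<otimes> y \<in> R" "\<And>x y. x \<in> R \<Longrightarrow> y \<in> R \<Longrightarrow> x \<oplus> y \<in> R"
    using R by auto
  show "\<And>k. k \<in> K \<Longrightarrow> u k \<in> R" using im[OF u_image] .
qed

lemma coef_ring_closure: "K \<lhd> G \<Longrightarrow> coef_ring K (clos K)"
  using closure_skew_subfield[of K] image_closure conj_closure
  by (auto simp: coef_ring_def skew_subfield_def)

lemma coef_ring_image: "K \<lhd> G \<Longrightarrow> coef_ring K (gimage K)"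
  using image_subring[OF normal_imp_subgroup] image_closure conj_image by (auto simp: coef_ring_def)

text \<open>The homogeneous component \<open>R s\<^sub>q\<close>, written with all representatives
  of the coset at once. No choice of units enters, as \<open>R\<close> contains the elements of
  \<open>K\<close>.\<close>

definition vals :: "'d set \<Rightarrow> 'g set \<Rightarrow> 'd set" where
  "vals R q = {r \<otimes> u h |r h. r \<in> R \<and> h \<in> q}"

lemma conj_swap: "g \<in> carrier G \<Longrightarrow> x \<in> carrier D \<Longrightarrow> u g \<otimes> x = conj_by g x \<otimes> u g"
  using D.skew_l_inv[OF u_closed u_nonzero] u_closed inv_u_closed by (simp add: conj_by_def D.m_assoc)

end

locale linnell_subquotient = linnell_ring F G D \<iota>
  for F :: "('f, 'm) ring_scheme" and G :: "('g, 'n) monoid_scheme"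
    and D :: "('d, 'k) ring_scheme" (structure) and \<iota> :: "('g \<Rightarrow> 'f) \<Rightarrow> 'd" +
  fixes H K :: "'g set"
  assumes H: "H \<lhd> G" and K: "K \<lhd> G" and KH: "K \<subseteq> H" and am: "amenable (quotient_group G H K)"
begin

abbreviation "Q \<equiv> quotient_group G H K"

lemma H_subgroup: "subgroup H G" and K_subgroup: "subgroup K G"
  using H K normal_imp_subgroup by auto

lemma H_carrier: "h \<in> H \<Longrightarrow> h \<in> carrier G"
  using subgroup.mem_carrier[OF H_subgroup] .

lemma K_carrier: "k \<in> K \<Longrightarrow> k \<in> carrier G"
  using subgroup.mem_carrier[OF K_subgroup] .

lemma Q_group: "group Q"
  using normal.factorgroup_is_group[OF G.normal_restrict_supergroup[OF H_subgroup K KH]] .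

sublocale Q: group Q by (rule Q_group)

lemma Q_carrier: "q \<in> carrier Q \<longleftrightarrow> (\<exists>h\<in>H. q = K #>\<^bsub>G\<^esub> h)"
  by (auto simp: FactGroup_def RCOSETS_def r_coset_def)

lemma Q_mult: "h \<in> H \<Longrightarrow> h' \<in> H \<Longrightarrow> (K #>\<^bsub>G\<^esub> h) \<otimes>\<^bsub>Q\<^esub> (K #>\<^bsub>G\<^esub> h') = K #>\<^bsub>G\<^esub> (h \<otimes>\<^bsub>G\<^esub> h')"
  using normal.rcos_sum[OF K H_carrier H_carrier] by (simp add: FactGroup_def set_mult_def)

lemma Q_one: "\<one>\<^bsub>Q\<^esub> = K"
  by (simp add: FactGroup_def)

lemma coset_mem:
  assumes "q \<in> carrier Q" "h \<in> q"
  shows "h \<in> H" "h \<in> carrier G" "q = K #>\<^bsub>G\<^esub> h"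
proof -
  obtain h' where h': "h' \<in> H" "q = K #>\<^bsub>G\<^esub> h'" using assms Q_carrier by blast
  then obtain k where "k \<in> K" "h = k \<otimes>\<^bsub>G\<^esub> h'" using assms(2) by (auto simp: r_coset_def)
  then show "h \<in> H" using h' KH subgroup.m_closed[OF H_subgroup] by blast
  then show "h \<in> carrier G" by (rule H_carrier)
  show "q = K #>\<^bsub>G\<^esub> h"
    using G.repr_independence[of h K h'] assms(2) h' H_carrier K_subgroup by blast
qed

lemma coset_self: "h \<in> H \<Longrightarrow> h \<in> K #>\<^bsub>G\<^esub> h"
  using G.rcos_self[OF H_carrier K_subgroup] .

lemma coset_in_Q: "h \<in> H \<Longrightarrow> K #>\<^bsub>G\<^esub> h \<in> carrier Q"
  using Q_carrier by blast

lemma coset_nonempty: "q \<in> carrier Q \<Longrightarrow> \<exists>h. h \<in> q"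
  using Q_carrier coset_self by blast

lemma coset_mult: "p \<in> carrier Q \<Longrightarrow> q \<in> carrier Q \<Longrightarrow> g \<in> p \<Longrightarrow> h \<in> q \<Longrightarrow> g \<otimes>\<^bsub>G\<^esub> h \<in> p \<otimes>\<^bsub>Q\<^esub> q"
proof -
  assume p: "p \<in> carrier Q" "g \<in> p" and q: "q \<in> carrier Q" "h \<in> q"
  note pD = coset_mem[OF p] and qD = coset_mem[OF q]
  have "p \<otimes>\<^bsub>Q\<^esub> q = K #>\<^bsub>G\<^esub> (g \<otimes>\<^bsub>G\<^esub> h)" using Q_mult pD qD by simp
  then show ?thesis using coset_self subgroup.m_closed[OF H_subgroup] pD(1) qD(1) by blast
qed

lemma coset_inv: "q \<in> carrier Q \<Longrightarrow> h \<in> q \<Longrightarrow> inv\<^bsub>G\<^esub> h \<in> inv\<^bsub>Q\<^esub> q"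
proof -
  assume q: "q \<in> carrier Q" "h \<in> q"
  note qD = coset_mem[OF q]
  have ih: "inv\<^bsub>G\<^esub> h \<in> H" using subgroup.m_inv_closed[OF H_subgroup qD(1)] .
  have "(K #>\<^bsub>G\<^esub> inv\<^bsub>G\<^esub> h) \<otimes>\<^bsub>Q\<^esub> q = \<one>\<^bsub>Q\<^esub>"
    using Q_mult[OF ih qD(1)] qD Q_one G.coset_join2[OF G.one_closed K_subgroup]
      subgroup.one_closed[OF K_subgroup] by simp
  then have "inv\<^bsub>Q\<^esub> q = K #>\<^bsub>G\<^esub> inv\<^bsub>G\<^esub> h"
    using Q.inv_equality coset_in_Q[OF ih] q(1) by blast
  then show ?thesis using coset_self[OF ih] by simp
qed

text \<open>A single representative decides membership: replacing it by another multiplies the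
  coefficient by some \<open>u k\<close> with \<open>k \<in> K\<close>, a unit of the group ring of
  \<open>K\<close>, which is contained in \<open>R\<close>.\<close>

lemma vals_iff:
  assumes R: "coef_ring K R" and q: "q \<in> carrier Q" "h \<in> q"
  shows "x \<in> vals R q \<longleftrightarrow> x \<in> carrier D \<and> x \<otimes> inv (u h) \<in> R"
proof
  note RD = coef_ringD[OF R] and qD = coset_mem[OF q]
  note uh = u_closed[of h] u_nonzero[OF qD(2)] inv_u_closed[OF qD(2)]
  assume "x \<in> vals R q"
  then obtain r h' where rh: "x = r \<otimes> u h'" "r \<in> R" "h' \<in> q" by (auto simp: vals_def)
  then obtain k where k: "k \<in> K" "h' = k \<otimes>\<^bsub>G\<^esub> h" using qD(3) by (auto simp: r_coset_def)
  have x: "x = (r \<otimes> u k) \<otimes> u h"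
    using rh k qD K_carrier u_closed RD(5) by (simp add: u_mult D.m_assoc)
  have "r \<otimes> u k \<in> R" using RD(9,11) rh k by blast
  then show "x \<in> carrier D \<and> x \<otimes> inv (u h) \<in> R"
    unfolding x using uh RD(5) by (simp add: D.m_assoc D.skew_r_inv)
next
  note RD = coef_ringD[OF R] and qD = coset_mem[OF q]
  note uh = u_closed[of h] u_nonzero[OF qD(2)] inv_u_closed[OF qD(2)]
  assume x: "x \<in> carrier D \<and> x \<otimes> inv (u h) \<in> R"
  then have "x = (x \<otimes> inv (u h)) \<otimes> u h" using uh by (simp add: D.m_assoc D.skew_l_inv)
  then show "x \<in> vals R q" using x q(2) unfolding vals_def by blast
qed

lemma vals_mult_unit: "coef_ring K R \<Longrightarrow> q \<in> carrier Q \<Longrightarrow> h \<in> q \<Longrightarrow> r \<in> R \<Longrightarrow> r \<otimes> u h \<in> vals R q"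
  by (auto simp: vals_def)

lemma vals_mono: "R \<subseteq> R' \<Longrightarrow> vals R q \<subseteq> vals R' q"
  by (auto simp: vals_def)

text \<open>In a product of two terms the second coefficient has to pass the first group element.
  This conjugates it, and invariance of \<open>R\<close> keeps it in \<open>R\<close>.\<close>

lemma grading_vals:
  assumes R: "coef_ring K R"
  shows "grading D Q (vals R)"
  unfolding grading_def
proof (intro conjI ballI)
  note RD = coef_ringD[OF R]
  fix q assume q: "q \<in> carrier Q"
  obtain h where h: "h \<in> q" using coset_nonempty[OF q] by blast
  note iff = vals_iff[OF R q h]
  note uh = inv_u_closed[OF coset_mem(2)[OF q h]]
  show "vals R q \<subseteq> carrier D" using iff by blast
  show "\<zero> \<in> vals R q" using iff uh RD(6) by simp
  fix x assume x: "x \<in> vals R q"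
  then show "\<ominus> x \<in> vals R q" using iff uh RD(8)[of "x \<otimes> inv (u h)"] by (simp add: D.l_minus)
  fix y assume "y \<in> vals R q"
  then show "x \<oplus> y \<in> vals R q"
    using x iff uh RD(10)[of "x \<otimes> inv (u h)" "y \<otimes> inv (u h)"] by (simp add: D.l_distr)
next
  note RD = coef_ringD[OF R]
  fix p q x y assume p: "p \<in> carrier Q" and q: "q \<in> carrier Q" and x: "x \<in> vals R p" and y: "y \<in> vals R q"
  obtain r g where x': "x = r \<otimes> u g" "r \<in> R" "g \<in> p" using x by (auto simp: vals_def)
  obtain s h where y': "y = s \<otimes> u h" "s \<in> R" "h \<in> q" using y by (auto simp: vals_def)
  note gc = coset_mem(2)[OF p x'(3)] and hc = coset_mem(2)[OF q y'(3)]
  have "x \<otimes> y = r \<otimes> (u g \<otimes> s) \<otimes> u h"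
    using x' y' RD(5) u_closed by (simp add: D.m_assoc)
  also have "u g \<otimes> s = conj_by g s \<otimes> u g" using conj_swap[OF gc RD(5)[OF y'(2)]] .
  also have "r \<otimes> (conj_by g s \<otimes> u g) \<otimes> u h = (r \<otimes> conj_by g s) \<otimes> u (g \<otimes>\<^bsub>G\<^esub> h)"
    using x'(2) y'(2) RD(4,5) gc hc u_closed by (simp add: u_mult D.m_assoc)
  finally show "x \<otimes> y \<in> vals R (p \<otimes>\<^bsub>Q\<^esub> q)"
    using coset_mult[OF p q x'(3) y'(3)] RD(4,9) x'(2) y'(2) gc unfolding vals_def by blast
next
  note RD = coef_ringD[OF R]
  have "\<one> = \<one> \<otimes> u \<one>\<^bsub>G\<^esub>" by (simp add: u_one)
  moreover have "\<one>\<^bsub>G\<^esub> \<in> \<one>\<^bsub>Q\<^esub>" using Q_one subgroup.one_closed[OF K_subgroup] by simp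
  ultimately show "\<one> \<in> vals R \<one>\<^bsub>Q\<^esub>" using RD(7) unfolding vals_def by blast
qed

text \<open>Inverting a term \<open>r \<otimes> u h\<close> comes down to inverting its coefficient:
  the inverse is \<open>u (inv h) \<otimes> inv r\<close>, and moving the group element to the right
  conjugates \<open>inv r\<close>, which stays in \<open>R\<close>.\<close>

lemma vals_inverse:
  assumes R: "coef_ring K R" and q: "q \<in> carrier Q" "h \<in> q"
    and x: "x \<in> carrier D" "x \<noteq> \<zero>" and inv_mem: "inv (x \<otimes> inv (u h)) \<in> R"
  shows "inv x \<in> vals R (inv\<^bsub>Q\<^esub> q)"
proof -
  note RD = coef_ringD[OF R]
  note hc = coset_mem(2)[OF q]
  note uh = u_closed[of h] u_nonzero[OF hc] inv_u_closed[OF hc]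
  define r where "r = x \<otimes> inv (u h)"
  have r: "r \<in> carrier D" "r \<noteq> \<zero>"
    using x uh D.skew_integral[of x "inv (u h)"] D.skew_inv_nonzero[OF uh(1,2)] by (auto simp: r_def)
  have ir: "inv r \<in> R" using inv_mem by (simp add: r_def)
  have "x = r \<otimes> u h" using x uh by (simp add: r_def D.m_assoc D.skew_l_inv)
  then have "inv x = inv (u h) \<otimes> inv r" using r uh by (simp add: D.skew_inv_mult)
  also have "\<dots> = u (inv\<^bsub>G\<^esub> h) \<otimes> inv r" using u_inv hc by simp
  also have "\<dots> = conj_by (inv\<^bsub>G\<^esub> h) (inv r) \<otimes> u (inv\<^bsub>G\<^esub> h)"
    using conj_swap hc RD(5)[OF ir] by simp
  finally have "inv x = conj_by (inv\<^bsub>G\<^esub> h) (inv r) \<otimes> u (inv\<^bsub>G\<^esub> h)" .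
  moreover have "conj_by (inv\<^bsub>G\<^esub> h) (inv r) \<in> R" using RD(4)[OF _ ir] hc by simp
  ultimately show ?thesis using coset_inv[OF q] unfolding vals_def by blast
qed

abbreviation "V \<equiv> vals (clos K)"

lemma coef_clos: "coef_ring K (clos K)"
  by (rule coef_ring_closure[OF K])

text \<open>This is the Linnell condition, applied to coset representatives and to the coefficients
  of the given terms.\<close>

lemma vals_independent:
  assumes A: "finite A" "A \<subseteq> carrier Q" and v: "\<And>q. q \<in> A \<Longrightarrow> v q \<in> V q"
    and sum: "finsum D v A = \<zero>" and q: "q \<in> A"
  shows "v q = \<zero>"
proof (rule ccontr)
  assume nz: "v q \<noteq> \<zero>"
  \<comment> \<open>The Linnell condition demands nonzero coefficients and at least one summand, so
    the zero terms are discarded; \<open>q\<close> remains by assumption.\<close>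
  define B where "B = {q \<in> A. v q \<noteq> \<zero>}"
  have B: "finite B" "B \<subseteq> carrier Q" "q \<in> B" using A q nz by (auto simp: B_def)
  note vc = gradingD(1)[OF grading_vals[OF coef_clos]]
  have vD: "v q \<in> carrier D" if "q \<in> A" for q using vc v A(2) that by blast
  \<comment> \<open>The condition is phrased for families indexed by \<open>{1..n}\<close>, whence
    the enumeration of \<open>B\<close>.\<close>
  obtain e where e: "bij_betw e {1..card B} B"
    using ex_bij_betw_nat_finite_1[OF B(1)] by blast
  have eB: "e i \<in> B" if "i \<in> {1..card B}" for i using e that by (auto simp: bij_betw_def)
  define t where "t = (\<lambda>q :: 'g set. SOME h. h \<in> q)"
  have t: "t q \<in> q" if "q \<in> carrier Q" for q
    unfolding t_def using coset_nonempty[OF that] by (rule someI_ex)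
  define d where "d = (\<lambda>i. v (e i) \<otimes> inv (u (t (e i))))"
  have tB: "t (e i) \<in> e i" "e i \<in> carrier Q" "t (e i) \<in> carrier G" "K #>\<^bsub>G\<^esub> t (e i) = e i"
    if "i \<in> {1..card B}" for i
  proof -
    show 1: "e i \<in> carrier Q" using eB[OF that] B(2) by blast
    show 2: "t (e i) \<in> e i" using t[OF 1] .
    show "t (e i) \<in> carrier G" "K #>\<^bsub>G\<^esub> t (e i) = e i" using coset_mem[OF 1 2] by auto
  qed
  have d: "d i \<in> clos K - {\<zero>}" if i: "i \<in> {1..card B}" for i
  proof -
    have vi: "v (e i) \<in> V (e i)" "v (e i) \<noteq> \<zero>" using eB[OF i] v by (auto simp: B_def)
    then have "d i \<in> clos K" "v (e i) \<in> carrier D"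
      using vals_iff[OF coef_clos tB(2,1)[OF i]] by (auto simp: d_def)
    moreover have "d i \<noteq> \<zero>"
      unfolding d_def
      using D.skew_integral[OF \<open>v (e i) \<in> carrier D\<close> inv_u_closed[OF tB(3)[OF i]]] vi(2)
        D.skew_inv_nonzero[OF u_closed u_nonzero[OF tB(3)[OF i]]] by blast
    ultimately show ?thesis by blast
  qed
  have inj: "inj_on (\<lambda>i. K #>\<^bsub>G\<^esub> t (e i)) {1..card B}"
  proof -
    have "inj_on e {1..card B}" using e by (simp add: bij_betw_def)
    then show ?thesis by (simp only: inj_on_def tB(4) cong: ball_cong)
  qed
  have "card B \<ge> 1" using B by (metis One_nat_def Suc_leI card_gt_0_iff empty_iff)
  moreover have "(\<lambda>i. t (e i)) \<in> {1..card B} \<rightarrow> carrier G" "d \<in> {1..card B} \<rightarrow> clos K - {\<zero>}"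
    using d tB(3) by auto
  ultimately have "(\<Oplus>i\<in>{1..card B}. d i \<otimes> \<iota> (group_elem F G (t (e i)))) \<noteq> \<zero>"
    using linnell K_subgroup inj unfolding linnell_skew_field_def by blast
  moreover have "(\<Oplus>i\<in>{1..card B}. d i \<otimes> \<iota> (group_elem F G (t (e i)))) = (\<Oplus>i\<in>{1..card B}. v (e i))"
  proof (rule D.finsum_cong'[OF refl])
    show "(\<lambda>i. v (e i)) \<in> {1..card B} \<rightarrow> carrier D" using eB vD by (auto simp: B_def)
    fix i assume i: "i \<in> {1..card B}"
    have "v (e i) \<in> carrier D" using eB[OF i] vD by (auto simp: B_def)
    then show "d i \<otimes> \<iota> (group_elem F G (t (e i))) = v (e i)"
      using u_closed u_nonzero inv_u_closed tB(3)[OF i]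
      by (simp add: d_def u_def[symmetric] D.m_assoc D.skew_l_inv)
  qed
  moreover have "(\<Oplus>i\<in>{1..card B}. v (e i)) = finsum D v (e ` {1..card B})"
    using e eB vD by (intro D.finsum_reindex[symmetric]) (auto simp: bij_betw_def B_def)
  moreover have "e ` {1..card B} = B" using e by (simp add: bij_betw_def)
  moreover have "finsum D v B = finsum D v A"
    using A(1) by (rule D.finsum_support) (use vD in \<open>auto simp: B_def\<close>)
  ultimately show False using sum by simp
qed

lemma crossed_product: "crossed_product D Q V"
proof (unfold_locales)
  show "grading D Q V" by (rule grading_vals[OF coef_clos])
  show "inv x \<in> V (inv\<^bsub>Q\<^esub> q)" if q: "q \<in> carrier Q" and x: "x \<in> V q" "x \<noteq> \<zero>" for q x
  proof -
    obtain h where h: "h \<in> q" using coset_nonempty[OF q] by blast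
    note hc = coset_mem(2)[OF q h]
    have xc: "x \<in> carrier D" "x \<otimes> inv (u h) \<in> clos K" using x(1) vals_iff[OF coef_clos q h] by auto
    have "x \<otimes> inv (u h) \<noteq> \<zero>"
      using D.skew_integral[OF xc(1) inv_u_closed[OF hc]] x(2)
        D.skew_inv_nonzero[OF u_closed u_nonzero[OF hc]] by blast
    then have "inv (x \<otimes> inv (u h)) \<in> clos K"
      using D.skew_subfieldD(8)[OF closure_skew_subfield xc(2)] by blast
    then show ?thesis using vals_inverse[OF coef_clos q h xc(1) x(2)] by blast
  qed
  show "\<exists>x\<in>V q. x \<noteq> \<zero>" if q: "q \<in> carrier Q" for q
  proof -
    obtain h where h: "h \<in> q" using coset_nonempty[OF q] by blast
    have "u h \<in> V q"
      using vals_mult_unit[OF coef_clos q h coef_ringD(7)[OF coef_clos]] u_closed by simp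
    then show ?thesis using u_nonzero[OF coset_mem(2)[OF q h]] by blast
  qed
qed (rule vals_independent)

sublocale C: crossed_product D Q V by (rule crossed_product)

text \<open>The decomposition of a group ring element along the cosets, with terms in
  \<open>D\<close> in place of coefficients: the counterpart of \<open>group_ring_series\<close>
  under \<open>to_vals\<close>.\<close>

definition gr_series :: "('g \<Rightarrow> 'f) \<Rightarrow> 'g set \<Rightarrow> 'd" where
  "gr_series a = (\<lambda>q. if q \<in> carrier Q then \<iota> (group_ring_part F G q a) else \<zero>)"

lemma part_eq_sum:
  assumes a: "a \<in> carrier GR"
  shows "\<iota> (group_ring_part F G q a) = (\<Oplus>g\<in>{g \<in> carrier G. a g \<noteq> \<zero>\<^bsub>F\<^esub>} \<inter> q. \<kappa> (a g) \<otimes> u g)"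
proof -
  let ?p = "group_ring_part F G q a" and ?S = "{g \<in> carrier G. a g \<noteq> \<zero>\<^bsub>F\<^esub>} \<inter> q"
  have fin: "finite ?S" using a by (simp add: GR_carrier)
  have ac: "a g \<in> carrier F" if "g \<in> carrier G" for g using a that by (auto simp: GR_carrier)
  have "{g \<in> carrier G. ?p g \<noteq> \<zero>\<^bsub>F\<^esub>} \<subseteq> ?S" by (auto simp: group_ring_part_def)
  then have "finite {g \<in> carrier G. ?p g \<noteq> \<zero>\<^bsub>F\<^esub>}" using fin finite_subset by blast
  then have p: "?p \<in> carrier GR"
    using ac by (simp add: GR_carrier) (auto simp: group_ring_part_def)
  have "\<iota> ?p = (\<Oplus>g\<in>?S. \<kappa> (?p g) \<otimes> u g)"
    using p fin by (rule \<iota>_eq_sum) (auto simp: group_ring_part_def split: if_splits)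
  also have "\<dots> = (\<Oplus>g\<in>?S. \<kappa> (a g) \<otimes> u g)"
    using ac \<kappa>_closed u_closed by (intro D.finsum_cong') (auto simp: group_ring_part_def)
  finally show ?thesis .
qed

lemma gr_series_vals:
  assumes R: "coef_ring K R" and a: "a \<in> carrier GR" and q: "q \<in> carrier Q"
  shows "gr_series a q \<in> vals R q"
proof -
  note gr = gradingD[OF grading_vals[OF R]]
  have "(\<Oplus>g\<in>{g \<in> carrier G. a g \<noteq> \<zero>\<^bsub>F\<^esub>} \<inter> q. \<kappa> (a g) \<otimes> u g) \<in> vals R q"
  proof (rule D.finsum_mem)
    show "vals R q \<subseteq> carrier D" using gr(1)[OF q] by blast
    fix g assume g: "g \<in> {g \<in> carrier G. a g \<noteq> \<zero>\<^bsub>F\<^esub>} \<inter> q"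
    then have "\<kappa> (a g) \<in> R"
      using a \<kappa>_image[OF K_subgroup] coef_ringD(2)[OF R] by (auto simp: GR_carrier)
    then show "\<kappa> (a g) \<otimes> u g \<in> vals R q" using vals_mult_unit[OF R q] g by blast
  qed (use gr(2,4)[OF q] in auto)
  then show ?thesis using q part_eq_sum[OF a] by (simp add: gr_series_def)
qed

text \<open>Distinct cosets are disjoint, so the support of \<open>a\<close> is partitioned by the
  finitely many cosets that it meets, and regrouping the sum along them recovers
  \<open>\<iota> a\<close>.\<close>

lemma gr_series_fsupp:
  assumes a: "a \<in> group_subring F G H"
  shows "gr_series a \<in> C.fsupp" "C.ev (gr_series a) = \<iota> a"
proof -
  note aD = group_subringD[OF a]
  let ?S = "{g \<in> carrier G. a g \<noteq> \<zero>\<^bsub>F\<^esub>}" and ?T = "(\<lambda>g. K #>\<^bsub>G\<^esub> g) ` {g \<in> carrier G. a g \<noteq> \<zero>\<^bsub>F\<^esub>}"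
  have S: "finite ?S" using aD(1) by (simp add: GR_carrier)
  have SH: "g \<in> H" if "g \<in> ?S" for g using aD(2) that by blast
  have T: "finite ?T" "?T \<subseteq> carrier Q" using S SH coset_in_Q by auto
  have t: "\<kappa> (a g) \<otimes> u g \<in> carrier D" if "g \<in> carrier G" for g
    using aD(3)[OF that] \<kappa>_closed u_closed by simp
  have supp: "q \<in> ?T" if nz: "gr_series a q \<noteq> \<zero>" for q
  proof -
    have q: "q \<in> carrier Q" using nz by (auto simp: gr_series_def split: if_splits)
    have "?S \<inter> q \<noteq> {}"
    proof
      assume e: "?S \<inter> q = {}"
      show False using nz q part_eq_sum[OF aD(1), of q] unfolding e by (simp add: gr_series_def)
    qed
    then obtain g where "g \<in> ?S" "g \<in> q" by blast
    then show ?thesis using coset_mem(3)[OF q] by blast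
  qed
  have "{q. gr_series a q \<noteq> \<zero>} \<subseteq> ?T"
  proof
    fix q assume "q \<in> {q. gr_series a q \<noteq> \<zero>}"
    then show "q \<in> ?T" by (intro supp) simp
  qed
  then have "finite {q. gr_series a q \<noteq> \<zero>}" using T(1) by (rule finite_subset)
  then show fs: "gr_series a \<in> C.fsupp"
    using gr_series_vals[OF coef_clos aD(1)] by (auto simp: C.fsupp_def gr_series_def)
  have un: "(\<Union>q\<in>?T. ?S \<inter> q) = ?S"
    using SH coset_self by blast
  have dis: "pairwise (\<lambda>p q. disjnt (?S \<inter> p) (?S \<inter> q)) ?T"
  proof (rule pairwiseI)
    fix p q assume pq: "p \<in> ?T" "q \<in> ?T" "p \<noteq> q"
    then have "p \<in> carrier Q" "q \<in> carrier Q" using T(2) by auto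
    then have "p \<inter> q = {}" using coset_mem(3) pq(3) by (metis IntE equals0I)
    then show "disjnt (?S \<inter> p) (?S \<inter> q)" by (auto simp: disjnt_def)
  qed
  have "C.ev (gr_series a) = (\<Oplus>q\<in>?T. gr_series a q)"
    using fs T(1) supp by (rule C.ev_eq)
  also have "\<dots> = (\<Oplus>q\<in>?T. \<Oplus>g\<in>?S \<inter> q. \<kappa> (a g) \<otimes> u g)"
  proof (rule D.finsum_cong'[OF refl])
    fix q assume "q \<in> ?T"
    then have "q \<in> carrier Q" using T(2) by blast
    then show "gr_series a q = (\<Oplus>g\<in>?S \<inter> q. \<kappa> (a g) \<otimes> u g)"
      using part_eq_sum[OF aD(1)] by (simp add: gr_series_def)
  qed (use t in \<open>auto intro!: D.finsum_closed\<close>)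
  also have "\<dots> = (\<Oplus>g\<in>(\<Union>q\<in>?T. ?S \<inter> q). \<kappa> (a g) \<otimes> u g)"
    using T(1) S t by (intro D.add.finprod_UN_disjoint[symmetric] dis) auto
  also have "\<dots> = (\<Oplus>g\<in>?S. \<kappa> (a g) \<otimes> u g)" unfolding un ..
  also have "\<dots> = \<iota> a" using aD(1) S by (intro \<iota>_eq_sum[symmetric]) auto
  finally show "C.ev (gr_series a) = \<iota> a" .
qed

text \<open>The fractions form a skew subfield containing the group ring of \<open>H\<close>, so the
  division closure cannot be larger.\<close>

lemma closure_fractions: "clos H \<subseteq> C.fractions"
proof (rule closure_least[OF C.fractions_skew_subfield[OF am]])
  show "gimage H \<subseteq> C.fractions"
  proof
    fix x assume "x \<in> gimage H"
    then obtain a where "a \<in> group_subring F G H" "x = \<iota> a" by (auto simp: gimage_def)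
    then have "x \<in> C.crossed" using gr_series_fsupp[of a] unfolding C.crossed_def by (metis imageI)
    then show "x \<in> C.fractions" using C.crossed_subset_fractions by blast
  qed
qed

end

section \<open>Series embeddings\<close>

locale linnell_order = linnell_subquotient F G D \<iota> H K
  for F :: "('f, 'm) ring_scheme" and G :: "('g, 'n) monoid_scheme"
    and D :: "('d, 'k) ring_scheme" (structure) and \<iota> :: "('g \<Rightarrow> 'f) \<Rightarrow> 'd" and H K +
  fixes lt :: "'g set \<Rightarrow> 'g set \<Rightarrow> bool"
  assumes order: "group_order (quotient_group G H K) lt"
begin

sublocale S: amenable_crossed_series D Q lt V
  by unfold_locales (rule order, rule am)

lemmas [simp del] = mult_FactGroup one_FactGroup

abbreviation "MN R \<equiv> coset_series F G D \<iota> H K R lt"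

definition rep :: "'g set \<Rightarrow> 'g" where
  "rep = coset_rep G H K"

lemma rep: "q \<in> carrier Q \<Longrightarrow> rep q \<in> q" "rep \<one>\<^bsub>Q\<^esub> = \<one>\<^bsub>G\<^esub>"
proof -
  let ?P = "\<lambda>s. (\<forall>q\<in>carrier Q. s q \<in> q) \<and> s \<one>\<^bsub>Q\<^esub> = \<one>\<^bsub>G\<^esub>"
  have "?P (\<lambda>q. if q = \<one>\<^bsub>Q\<^esub> then \<one>\<^bsub>G\<^esub> else SOME h. h \<in> q)"
    using coset_nonempty Q_one subgroup.one_closed[OF K_subgroup] by (simp add: some_in_eq) blast
  then have "?P rep" unfolding rep_def coset_rep_def by (rule someI[of ?P])
  then show "q \<in> carrier Q \<Longrightarrow> rep q \<in> q" "rep \<one>\<^bsub>Q\<^esub> = \<one>\<^bsub>G\<^esub>" by auto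
qed

lemma rep_carrier: "q \<in> carrier Q \<Longrightarrow> rep q \<in> carrier G"
  using coset_mem(2) rep(1) by blast

definition s :: "'g set \<Rightarrow> 'd" where
  "s q = u (rep q)"

lemma coset_unit_eq: "coset_unit F G \<iota> H K q = s q"
  by (simp add: coset_unit_def s_def u_def rep_def)

lemma s_closed: "s q \<in> carrier D"
  by (simp add: s_def u_closed)

lemma s_nonzero: "q \<in> carrier Q \<Longrightarrow> s q \<noteq> \<zero>"
  by (simp add: s_def u_nonzero rep_carrier)

lemma s_inv_closed: "q \<in> carrier Q \<Longrightarrow> inv (s q) \<in> carrier D"
  by (simp add: s_def inv_u_closed rep_carrier)

lemma s_inv: "q \<in> carrier Q \<Longrightarrow> s q \<otimes> inv (s q) = \<one>" "q \<in> carrier Q \<Longrightarrow> inv (s q) \<otimes> s q = \<one>"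
  using D.skew_r_inv D.skew_l_inv s_closed s_nonzero by auto

lemma s_one: "s \<one>\<^bsub>Q\<^esub> = \<one>"
  by (simp add: s_def rep(2) u_one)

lemma mult_s_inv: "q \<in> carrier Q \<Longrightarrow> x \<in> carrier D \<Longrightarrow> x \<otimes> s q \<otimes> inv (s q) = x"
    "q \<in> carrier Q \<Longrightarrow> x \<in> carrier D \<Longrightarrow> x \<otimes> inv (s q) \<otimes> s q = x"
  using s_closed s_inv_closed s_inv by (simp_all add: D.m_assoc)

lemma vals_s:
  assumes "coef_ring K R" "q \<in> carrier Q"
  shows "x \<in> vals R q \<longleftrightarrow> x \<in> carrier D \<and> x \<otimes> inv (s q) \<in> R"
  unfolding s_def by (rule vals_iff[OF assms rep(1)[OF assms(2)]])

lemma vals_sI: "coef_ring K R \<Longrightarrow> q \<in> carrier Q \<Longrightarrow> r \<in> R \<Longrightarrow> r \<otimes> s q \<in> vals R q"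
  unfolding s_def using vals_mult_unit rep(1) by blast

text \<open>\<open>to_vals\<close> replaces the coefficient \<open>r\<^sub>q\<close> by the term \<open>r\<^sub>q s\<^sub>q\<close>, an element of \<open>D\<close>. In terms of
  these the twisted product becomes a plain convolution.\<close>

definition to_vals :: "('g set \<Rightarrow> 'd) \<Rightarrow> 'g set \<Rightarrow> 'd" where
  "to_vals f = (\<lambda>q. if q \<in> carrier Q then f q \<otimes> s q else \<zero>)"

text \<open>Off \<open>carrier Q\<close> the result is \<open>undefined\<close>, as membership in
  the extensional functions of \<open>malcev_neumann\<close> requires; \<open>to_vals\<close> takes
  the value \<zero> there.\<close>

definition of_vals :: "('g set \<Rightarrow> 'd) \<Rightarrow> 'g set \<Rightarrow> 'd" where
  "of_vals f = (\<lambda>q\<in>carrier Q. f q \<otimes> inv (s q))"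

lemma MN_carrier:
  "f \<in> carrier (MN R) \<longleftrightarrow> f \<in> carrier Q \<rightarrow>\<^sub>E R \<and> wfp_on {q \<in> carrier Q. f q \<noteq> \<zero>} lt"
  by (simp add: coset_series_def malcev_neumann_def)

lemma to_vals_supp:
  assumes f: "\<And>q. q \<in> carrier Q \<Longrightarrow> f q \<in> carrier D"
  shows "to_vals f q \<noteq> \<zero> \<longleftrightarrow> q \<in> carrier Q \<and> f q \<noteq> \<zero>"
  using D.skew_integral[OF f s_closed, of q q] s_nonzero[of q] s_closed[of q]
  by (auto simp: to_vals_def)

lemma to_vals_in:
  assumes R: "coef_ring K R" and f: "f \<in> carrier (MN R)"
  shows "to_vals f \<in> S.series_in (vals R)"
proof -
  note RD = coef_ringD[OF R]
  have fR: "f q \<in> R" if "q \<in> carrier Q" for q using f that by (auto simp: MN_carrier)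
  have supp: "{q. to_vals f q \<noteq> \<zero>} = {q \<in> carrier Q. f q \<noteq> \<zero>}"
    using to_vals_supp[of f] fR RD(5) by blast
  show ?thesis
  proof (rule S.series_inI)
    show "to_vals f q \<in> vals R q" if "q \<in> carrier Q" for q
      using vals_sI[OF R that fR[OF that]] that by (simp add: to_vals_def)
    have "S.Q.well_ordered {q. to_vals f q \<noteq> \<zero>}"
      unfolding S.Q.well_ordered_def supp using f by (auto simp: MN_carrier)
    moreover have "to_vals f q \<in> carrier D" for q
      using fR RD(5) s_closed by (simp add: to_vals_def)
    ultimately show "to_vals f \<in> S.series" by (intro S.seriesI) auto
  qed
qed

lemma of_vals_supp:
  assumes f: "f \<in> S.series" and q: "q \<in> carrier Q"
  shows "of_vals f q \<noteq> \<zero> \<longleftrightarrow> f q \<noteq> \<zero>"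
  using D.skew_integral[OF S.series_closed[OF f] s_inv_closed[OF q], of q]
    D.skew_inv_nonzero[OF s_closed s_nonzero[OF q]] s_inv_closed[OF q] q
  by (auto simp: of_vals_def)

lemma of_vals_in:
  assumes R: "coef_ring K R" and f: "f \<in> S.series_in (vals R)"
  shows "of_vals f \<in> carrier (MN R)"
proof -
  note fs = S.series_inD(1)[OF f]
  have "of_vals f q \<in> R" if "q \<in> carrier Q" for q
    using vals_s[OF R that] S.series_inD(2)[OF f that] that by (simp add: of_vals_def)
  then have "of_vals f \<in> carrier Q \<rightarrow>\<^sub>E R" by (auto simp: of_vals_def)
  moreover have "{q \<in> carrier Q. of_vals f q \<noteq> \<zero>} = {q. f q \<noteq> \<zero>}"
    using of_vals_supp[OF fs] S.series_supp_carrier[OF fs] by blast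
  ultimately show ?thesis
    using S.series_well_ordered[OF fs] by (simp add: MN_carrier S.Q.well_ordered_def)
qed

lemma to_of_vals:
  assumes f: "f \<in> S.series"
  shows "to_vals (of_vals f) = f"
proof
  fix q
  show "to_vals (of_vals f) q = f q"
  proof (cases "q \<in> carrier Q")
    case True
    then show ?thesis using f by (simp add: to_vals_def of_vals_def mult_s_inv)
  next
    case False
    then have "f q = \<zero>" using S.series_supp_carrier[OF f] by blast
    then show ?thesis using False by (simp add: to_vals_def)
  qed
qed

lemma of_to_vals:
  assumes f: "f \<in> carrier Q \<rightarrow>\<^sub>E carrier D"
  shows "of_vals (to_vals f) = f"
proof
  fix q
  show "of_vals (to_vals f) q = f q"
  proof (cases "q \<in> carrier Q")
    case True
    then have "f q \<in> carrier D" using f by blast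
    then show ?thesis using True by (simp add: to_vals_def of_vals_def mult_s_inv)
  next
    case False
    then show ?thesis using PiE_arb[OF f] by (simp add: of_vals_def)
  qed
qed

lemma MN_closure_ext:
  assumes "f \<in> carrier (MN (clos K))"
  shows "f \<in> carrier Q \<rightarrow>\<^sub>E carrier D" "\<And>q. q \<in> carrier Q \<Longrightarrow> f q \<in> clos K"
    "\<And>q. q \<in> carrier Q \<Longrightarrow> f q \<in> carrier D" "to_vals f \<in> S.series_in V" "to_vals f \<in> S.series"
  using assms coef_ringD(5)[OF coef_clos] to_vals_in[OF coef_clos assms] S.series_inD(1)
  by (auto simp: MN_carrier PiE_iff)

lemma to_vals_one: "to_vals \<one>\<^bsub>MN R\<^esub> = S.sone"
proof
  fix q
  show "to_vals \<one>\<^bsub>MN R\<^esub> q = S.sone q"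
    by (auto simp: to_vals_def coset_series_def malcev_neumann_def S.mono_def s_one s_closed)
qed

lemma to_vals_add:
  assumes f: "f \<in> carrier (MN (clos K))" and h: "h \<in> carrier (MN (clos K))"
  shows "to_vals (f \<oplus>\<^bsub>MN R\<^esub> h) = S.sadd (to_vals f) (to_vals h)"
  using MN_closure_ext[OF f] MN_closure_ext[OF h] s_closed
  by (auto simp: to_vals_def coset_series_def malcev_neumann_def S.sadd_def D.l_distr)

text \<open>Action and cocycle consist of the units \<open>s\<close> and their inverses, which
  cancel in pairs once the product is multiplied by the unit of degree \<open>x \<otimes> y\<close>.
  For membership in \<open>clos K\<close>, the action is a conjugation, and the cocycle compares two
  representatives of one coset.\<close>

lemma twisted_term:
  assumes x: "x \<in> carrier Q" and y: "y \<in> carrier Q" and f: "f \<in> clos K" and h: "h \<in> clos K"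
  shows "f \<otimes> coset_action F G D \<iota> H K x h \<otimes> coset_cocycle F G D \<iota> H K x y \<in> clos K"
    and "f \<otimes> coset_action F G D \<iota> H K x h \<otimes> coset_cocycle F G D \<iota> H K x y \<otimes> s (x \<otimes>\<^bsub>Q\<^esub> y) = (f \<otimes> s x) \<otimes> (h \<otimes> s y)"
proof -
  let ?t = "f \<otimes> coset_action F G D \<iota> H K x h \<otimes> coset_cocycle F G D \<iota> H K x y"
  note RD = coef_ringD[OF coef_clos]
  have xy: "x \<otimes>\<^bsub>Q\<^esub> y \<in> carrier Q" using x y by simp
  note c = s_closed[of x] s_closed[of y] s_closed[of "x \<otimes>\<^bsub>Q\<^esub> y"] s_inv_closed[OF x]
    s_inv_closed[OF xy] RD(5)[OF f] RD(5)[OF h]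
  have act: "coset_action F G D \<iota> H K x h = conj_by (rep x) h"
    by (simp add: coset_action_def coset_unit_eq s_def conj_by_def)
  have "rep x \<otimes>\<^bsub>G\<^esub> rep y \<in> x \<otimes>\<^bsub>Q\<^esub> y" using coset_mult[OF x y] rep(1) x y by blast
  then have "u (rep x \<otimes>\<^bsub>G\<^esub> rep y) \<in> V (x \<otimes>\<^bsub>Q\<^esub> y)"
    using vals_mult_unit[OF coef_clos xy _ RD(7)] u_closed by fastforce
  then have coc: "coset_cocycle F G D \<iota> H K x y \<in> clos K"
    using vals_s[OF coef_clos xy] x y
    by (simp add: coset_cocycle_def coset_unit_eq s_def u_mult rep_carrier)
  show "?t \<in> clos K"
    unfolding act using RD(4)[OF rep_carrier[OF x] h] coc f RD(9) by blast
  have "?t \<otimes> s (x \<otimes>\<^bsub>Q\<^esub> y) =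
      f \<otimes> s x \<otimes> h \<otimes> (inv (s x) \<otimes> s x) \<otimes> s y \<otimes> (inv (s (x \<otimes>\<^bsub>Q\<^esub> y)) \<otimes> s (x \<otimes>\<^bsub>Q\<^esub> y))"
    unfolding coset_action_def coset_cocycle_def coset_unit_eq using c by (simp add: D.m_assoc)
  also have "\<dots> = (f \<otimes> s x) \<otimes> (h \<otimes> s y)"
    using c s_inv x xy by (simp add: D.m_assoc)
  finally show "?t \<otimes> s (x \<otimes>\<^bsub>Q\<^esub> y) = (f \<otimes> s x) \<otimes> (h \<otimes> s y)" .
qed

lemma to_vals_mult:
  assumes f: "f \<in> carrier (MN (clos K))" and h: "h \<in> carrier (MN (clos K))"
  shows "to_vals (f \<otimes>\<^bsub>MN (clos K)\<^esub> h) = S.conv (to_vals f) (to_vals h)"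
proof
  fix q
  note fD = MN_closure_ext[OF f] and hD = MN_closure_ext[OF h]
  show "to_vals (f \<otimes>\<^bsub>MN (clos K)\<^esub> h) q = S.conv (to_vals f) (to_vals h) q"
  proof (cases "q \<in> carrier Q")
    case q: True
    let ?P = "{(x, y). x \<in> carrier Q \<and> y \<in> carrier Q \<and> f x \<noteq> \<zero> \<and> h y \<noteq> \<zero> \<and> x \<otimes>\<^bsub>Q\<^esub> y = q}"
    let ?I = "{x. to_vals f x \<noteq> \<zero> \<and> to_vals h (inv\<^bsub>Q\<^esub> x \<otimes>\<^bsub>Q\<^esub> q) \<noteq> \<zero>}"
    define t where "t = (\<lambda>p. f (fst p) \<otimes> coset_action F G D \<iota> H K (fst p) (h (snd p)) \<otimes>
      coset_cocycle F G D \<iota> H K (fst p) (snd p))"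
    have supp: "to_vals f x \<noteq> \<zero> \<longleftrightarrow> x \<in> carrier Q \<and> f x \<noteq> \<zero>"
      "to_vals h x \<noteq> \<zero> \<longleftrightarrow> x \<in> carrier Q \<and> h x \<noteq> \<zero>" for x
      using to_vals_supp fD(3) hD(3) by auto
    have solve: "x \<otimes>\<^bsub>Q\<^esub> (inv\<^bsub>Q\<^esub> x \<otimes>\<^bsub>Q\<^esub> q) = q" "inv\<^bsub>Q\<^esub> x \<otimes>\<^bsub>Q\<^esub> (x \<otimes>\<^bsub>Q\<^esub> y) = y"
      if "x \<in> carrier Q" "y \<in> carrier Q" for x y
      using that q by (simp_all add: Q.m_assoc[symmetric])
    \<comment> \<open>The definition of the twisted product runs over pairs, \<open>conv\<close>
      over left factors; a pair is recovered from its left factor.\<close>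
    have P: "?P = (\<lambda>x. (x, inv\<^bsub>Q\<^esub> x \<otimes>\<^bsub>Q\<^esub> q)) ` ?I"
    proof (intro equalityI subsetI)
      fix p assume "p \<in> ?P"
      then obtain x y where p: "p = (x, y)" "x \<in> carrier Q" "y \<in> carrier Q" "f x \<noteq> \<zero>" "h y \<noteq> \<zero>"
        "x \<otimes>\<^bsub>Q\<^esub> y = q" by blast
      then have "y = inv\<^bsub>Q\<^esub> x \<otimes>\<^bsub>Q\<^esub> q" using solve(2) by metis
      then show "p \<in> (\<lambda>x. (x, inv\<^bsub>Q\<^esub> x \<otimes>\<^bsub>Q\<^esub> q)) ` ?I" using p supp by blast
    next
      fix p assume "p \<in> (\<lambda>x. (x, inv\<^bsub>Q\<^esub> x \<otimes>\<^bsub>Q\<^esub> q)) ` ?I"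
      then show "p \<in> ?P" using supp solve(1) q by auto
    qed
    have fin: "finite ?P"
      unfolding P using S.finite_conv_index[OF fD(5) hD(5) q] by simp
    have tK: "t p \<in> clos K" and ts: "t p \<otimes> s q = to_vals f (fst p) \<otimes> to_vals h (snd p)"
      if "p \<in> ?P" for p
      using twisted_term[of "fst p" "snd p" "f (fst p)" "h (snd p)"] that fD(2) hD(2)
      by (auto simp: t_def to_vals_def)
    have tc: "t p \<in> carrier D" if "p \<in> ?P" for p using tK[OF that] coef_ringD(5)[OF coef_clos] by blast
    have "(f \<otimes>\<^bsub>MN (clos K)\<^esub> h) q = finsum (D\<lparr>carrier := clos K\<rparr>) t ?P"
      using q by (simp add: coset_series_def malcev_neumann_def t_def)
    also have "\<dots> = finsum D t ?P"
      using coef_ringD(1)[OF coef_clos] tK by (rule D.finsum_subring)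
    finally have "to_vals (f \<otimes>\<^bsub>MN (clos K)\<^esub> h) q = finsum D t ?P \<otimes> s q"
      using q by (simp add: to_vals_def)
    also have "\<dots> = (\<Oplus>p\<in>?P. t p \<otimes> s q)"
      using fin tc s_closed by (intro D.finsum_ldistr) auto
    also have "\<dots> = (\<Oplus>p\<in>?P. to_vals f (fst p) \<otimes> to_vals h (snd p))"
      using fD(5) hD(5) by (intro D.finsum_cong'[OF refl]) (use ts in auto)
    also have "\<dots> = (\<Oplus>x\<in>?I. to_vals f x \<otimes> to_vals h (inv\<^bsub>Q\<^esub> x \<otimes>\<^bsub>Q\<^esub> q))"
      unfolding P using fD(5) hD(5) by (subst D.finsum_reindex) (auto simp: inj_on_def)
    also have "\<dots> = S.conv (to_vals f) (to_vals h) q"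
      using q by (simp add: S.conv_def)
    finally show ?thesis .
  qed (simp add: to_vals_def S.conv_outside)
qed

text \<open>\<open>of_vals\<close> undoes \<open>to_vals\<close> only on extensional functions with
  values in \<open>D\<close>. The work is to see that the twisted product is such a
  function.\<close>

lemma MN_mult_closed:
  assumes f: "f \<in> carrier (MN (clos K))" and h: "h \<in> carrier (MN (clos K))"
  shows "of_vals (S.conv (to_vals f) (to_vals h)) = f \<otimes>\<^bsub>MN (clos K)\<^esub> h"
proof -
  note fD = MN_closure_ext[OF f] and hD = MN_closure_ext[OF h]
  have cs: "S.conv (to_vals f) (to_vals h) \<in> S.series_in V"
    using S.conv_series_in[OF grading_vals[OF coef_clos] fD(4) hD(4)] .
  have "(f \<otimes>\<^bsub>MN (clos K)\<^esub> h) q \<in> carrier D" if q: "q \<in> carrier Q" for q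
  proof -
    let ?t = "\<lambda>p. f (fst p) \<otimes> coset_action F G D \<iota> H K (fst p) (h (snd p)) \<otimes>
      coset_cocycle F G D \<iota> H K (fst p) (snd p)"
    let ?P = "{(x, y). x \<in> carrier Q \<and> y \<in> carrier Q \<and> f x \<noteq> \<zero> \<and> h y \<noteq> \<zero> \<and> x \<otimes>\<^bsub>Q\<^esub> y = q}"
    note sub = coef_ringD(1)[OF coef_clos]
    have t: "?t p \<in> clos K" if "p \<in> ?P" for p
      using that fD(2) hD(2) by (intro twisted_term(1)) auto
    have "(f \<otimes>\<^bsub>MN (clos K)\<^esub> h) q = finsum (D\<lparr>carrier := clos K\<rparr>) ?t ?P"
      using q by (simp add: coset_series_def malcev_neumann_def)
    also have "\<dots> = finsum D ?t ?P" using sub t by (rule D.finsum_subring)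
    also have "\<dots> \<in> clos K" using sub t by (rule D.subring_finsum_closed)
    finally have "(f \<otimes>\<^bsub>MN (clos K)\<^esub> h) q \<in> clos K" .
    then show ?thesis using coef_ringD(5)[OF coef_clos] by blast
  qed
  moreover have "(f \<otimes>\<^bsub>MN (clos K)\<^esub> h) \<in> extensional (carrier Q)"
    by (simp add: coset_series_def malcev_neumann_def)
  ultimately have "f \<otimes>\<^bsub>MN (clos K)\<^esub> h \<in> carrier Q \<rightarrow>\<^sub>E carrier D"
    by (simp add: PiE_def Pi_def)
  then show ?thesis using of_to_vals to_vals_mult[OF f h] by metis
qed

lemma gr_series_of_vals:
  "of_vals (gr_series a) = group_ring_series F G D \<iota> H K a"
  by (rule ext) (auto simp: of_vals_def gr_series_def group_ring_series_def coset_unit_eq)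

definition series_of :: "'d \<Rightarrow> 'g set \<Rightarrow> 'd" where
  "series_of x = (THE f. S.expands x f)"

lemma series_of: "x \<in> clos H \<Longrightarrow> S.expands x (series_of x)"
proof -
  assume "x \<in> clos H"
  then obtain f where "S.expands x f" using S.expands_total closure_fractions by blast
  then show ?thesis unfolding series_of_def using S.expands_unique by (metis theI)
qed

lemma series_of_eq: "S.expands x f \<Longrightarrow> series_of x = f"
  unfolding series_of_def using S.expands_unique by blast

text \<open>Expansion respects sums and products because expansions are unique, and on the group
  ring it is the decomposition along cosets.\<close>

lemma embedding_exists: "series_embedding F G D \<iota> H K lt (\<lambda>x. of_vals (series_of x))"
proof -
  note clH = coef_ringD[OF coef_ring_closure[OF H]]
  have inn: "of_vals (series_of x) \<in> carrier (MN (clos K))" if "x \<in> clos H" for x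
    using of_vals_in[OF coef_clos S.expandsD(2)[OF series_of[OF that]]] .
  have tv: "to_vals (of_vals (series_of x)) = series_of x" if "x \<in> clos H" for x
    using to_of_vals S.expandsD(3)[OF series_of[OF that]] .
  have "(\<lambda>x. of_vals (series_of x)) \<in> ring_hom (D\<lparr>carrier := clos H\<rparr>) (MN (clos K))"
  proof (rule ring_hom_memI)
    show "of_vals (series_of x) \<in> carrier (MN (clos K))" if "x \<in> carrier (D\<lparr>carrier := clos H\<rparr>)" for x
      using inn that by simp
    fix x y assume "x \<in> carrier (D\<lparr>carrier := clos H\<rparr>)" "y \<in> carrier (D\<lparr>carrier := clos H\<rparr>)"
    then have x: "x \<in> clos H" and y: "y \<in> clos H" by auto
    note ex = series_of[OF x] and ey = series_of[OF y]
    have "of_vals (series_of (x \<otimes> y)) = of_vals (S.conv (series_of x) (series_of y))"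
      using series_of_eq[OF S.expands_mult[OF ex ey]] by simp
    also have "\<dots> = of_vals (series_of x) \<otimes>\<^bsub>MN (clos K)\<^esub> of_vals (series_of y)"
      using MN_mult_closed[OF inn[OF x] inn[OF y]] tv x y by simp
    finally show "of_vals (series_of (x \<otimes>\<^bsub>D\<lparr>carrier := clos H\<rparr>\<^esub> y)) =
        of_vals (series_of x) \<otimes>\<^bsub>MN (clos K)\<^esub> of_vals (series_of y)" by simp
    have "of_vals (series_of (x \<oplus> y)) = of_vals (S.sadd (series_of x) (series_of y))"
      using series_of_eq[OF S.expands_add[OF ex ey]] by simp
    also have "\<dots> = of_vals (series_of x) \<oplus>\<^bsub>MN (clos K)\<^esub> of_vals (series_of y)"
      using S.expandsD(3)[OF ex] S.expandsD(3)[OF ey] s_inv_closed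
      by (auto simp: of_vals_def S.sadd_def coset_series_def malcev_neumann_def D.l_distr)
    finally show "of_vals (series_of (x \<oplus>\<^bsub>D\<lparr>carrier := clos H\<rparr>\<^esub> y)) =
        of_vals (series_of x) \<oplus>\<^bsub>MN (clos K)\<^esub> of_vals (series_of y)" by simp
  next
    have "of_vals (series_of \<one>) = of_vals S.sone" using series_of_eq[OF S.expands_one] by simp
    also have "\<dots> = \<one>\<^bsub>MN (clos K)\<^esub>"
    proof
      fix q
      show "of_vals S.sone q = \<one>\<^bsub>MN (clos K)\<^esub> q"
        using s_inv_closed[of q]
        by (auto simp: of_vals_def S.mono_def coset_series_def malcev_neumann_def s_one)
    qed
    finally show "of_vals (series_of \<one>\<^bsub>D\<lparr>carrier := clos H\<rparr>\<^esub>) = \<one>\<^bsub>MN (clos K)\<^esub>" by simp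
  qed
  moreover have "of_vals (series_of (\<iota> a)) = group_ring_series F G D \<iota> H K a"
    if a: "a \<in> group_subring F G H" for a
  proof -
    have "S.expands (\<iota> a) (gr_series a)"
      using S.expands_ev[OF gr_series_fsupp(1)[OF a]] gr_series_fsupp(2)[OF a] by simp
    then show ?thesis using series_of_eq gr_series_of_vals by metis
  qed
  ultimately show ?thesis by (simp add: series_embedding_def)
qed

text \<open>The elements that \<phi> sends to their expansion form a skew subfield containing the
  group ring of \<open>H\<close>, hence fill \<open>clos H\<close>. So any two embeddings agree
  there.\<close>

lemma embedding_expands:
  assumes \<phi>: "series_embedding F G D \<iota> H K lt \<phi>" and x: "x \<in> clos H"
  shows "S.expands x (to_vals (\<phi> x))"
proof -
  note clH = D.skew_subfieldD[OF closure_skew_subfield[of H]]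
  have hom: "\<phi> \<in> ring_hom (D\<lparr>carrier := clos H\<rparr>) (MN (clos K))"
    using \<phi> by (simp add: series_embedding_def)
  have inn: "\<phi> x \<in> carrier (MN (clos K))" if "x \<in> clos H" for x
    using ring_hom_closed[OF hom] that by simp
  have mult: "to_vals (\<phi> (x \<otimes> y)) = S.conv (to_vals (\<phi> x)) (to_vals (\<phi> y))"
    if "x \<in> clos H" "y \<in> clos H" for x y
    using ring_hom_mult[OF hom, of x y] to_vals_mult[OF inn inn] that by simp
  have add: "to_vals (\<phi> (x \<oplus> y)) = S.sadd (to_vals (\<phi> x)) (to_vals (\<phi> y))"
    if "x \<in> clos H" "y \<in> clos H" for x y
    using ring_hom_add[OF hom, of x y] to_vals_add[OF inn inn] that by simp
  have one: "to_vals (\<phi> \<one>) = S.sone" using ring_hom_one[OF hom] to_vals_one by simp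
  have cl: "to_vals (\<phi> x) q \<in> carrier D" if "x \<in> clos H" for x q
    using MN_closure_ext(5)[OF inn[OF that]] by simp
  let ?E = "{x \<in> clos H. S.expands x (to_vals (\<phi> x))}"
  have "clos H \<subseteq> ?E"
  proof (rule closure_least)
    show "skew_subfield ?E D"
      unfolding skew_subfield_def
    proof
      show "subring ?E D"
      proof (rule D.subringI)
        show "?E \<subseteq> carrier D" using clH(2) by blast
        show "\<one> \<in> ?E" using clH(4) one S.expands_one by simp
        fix x assume x: "x \<in> ?E"
        \<comment> \<open>\<open>ring_hom\<close> does not list preservation of zero; it follows by
          cancellation from additivity.\<close>
        have zero: "to_vals (\<phi> \<zero>) q = \<zero>" for q
          using add[OF clH(3) clH(3)] cl[OF clH(3), of q]
          by (metis D.add.l_cancel_one D.l_zero D.zero_closed S.sadd_def)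
        have "to_vals (\<phi> (\<ominus> x)) = S.sneg (to_vals (\<phi> x))"
        proof
          fix q
          have xH: "x \<in> clos H" "\<ominus> x \<in> clos H" using x clH(5) by auto
          have "x \<in> carrier D" using xH clH(2) by blast
          then have "to_vals (\<phi> (\<ominus> x)) q \<oplus> to_vals (\<phi> x) q = \<zero>"
            using add[OF xH(2,1)] zero[of q] by (simp add: D.l_neg S.sadd_def fun_eq_iff)
          then show "to_vals (\<phi> (\<ominus> x)) q = S.sneg (to_vals (\<phi> x)) q"
            using D.minus_equality cl xH by (simp add: S.sneg_def)
        qed
        then show "\<ominus> x \<in> ?E" using x clH(5) S.expands_neg by simp
        fix y assume y: "y \<in> ?E"
        show "x \<otimes> y \<in> ?E" using x y clH(6) mult S.expands_mult by simp
        show "x \<oplus> y \<in> ?E" using x y clH(7) add S.expands_add by simp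
      qed
      show "\<forall>x\<in>?E - {\<zero>}. inv x \<in> ?E"
      proof
        fix x assume x: "x \<in> ?E - {\<zero>}"
        have xH: "x \<in> clos H" "x \<noteq> \<zero>" "inv x \<in> clos H" using x clH(8) by auto
        have "x \<in> carrier D" using xH clH(2) by blast
        then have "S.conv (to_vals (\<phi> x)) (to_vals (\<phi> (inv x))) = S.sone"
          using mult[OF xH(1,3)] one D.skew_r_inv[OF _ xH(2)] by simp
        then have "S.expands (inv x) (to_vals (\<phi> (inv x)))"
          \<comment> \<open>The image of \<open>inv x\<close> is a right inverse of the expansion of
            \<open>x\<close>, which is all that \<open>expands_inverse\<close> asks of it.\<close>
          using S.expands_inverse[OF _ xH(2)] x MN_closure_ext(5)[OF inn[OF xH(3)]] by blast
        then show "inv x \<in> ?E" using xH by simp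
      qed
    qed
    show "gimage H \<subseteq> ?E"
    proof
      fix x assume xi: "x \<in> gimage H"
      then obtain a where a: "a \<in> group_subring F G H" "x = \<iota> a" by (auto simp: gimage_def)
      have ex: "S.expands (\<iota> a) (gr_series a)"
        using S.expands_ev[OF gr_series_fsupp(1)[OF a(1)]] gr_series_fsupp(2)[OF a(1)] by simp
      have "to_vals (\<phi> x) = to_vals (of_vals (gr_series a))"
        using \<phi> a by (simp add: series_embedding_def gr_series_of_vals)
      also have "\<dots> = gr_series a" using to_of_vals S.expandsD(3)[OF ex] .
      finally show "x \<in> ?E" using ex a(2) xi image_closure by auto
    qed
  qed
  then show ?thesis using x by blast
qed

end

lemma (in linnell_subquotient) linnell_orderI:
  "group_order Q lt \<Longrightarrow> linnell_order F G D \<iota> H K lt"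
  by (simp add: linnell_order_def linnell_subquotient_axioms linnell_order_axioms_def)

context linnell_subquotient
begin

definition expansion_in :: "('g set \<Rightarrow> 'g set \<Rightarrow> bool) \<Rightarrow> 'd set \<Rightarrow> 'd \<Rightarrow> ('g set \<Rightarrow> 'd) \<Rightarrow> bool" where
  "expansion_in lt R x f \<longleftrightarrow> crossed_series.expands D Q lt V x f \<and> f \<in> series_ring.series_in D Q lt (vals R)"

text \<open>Existence and uniqueness of the embedding allow it to be eliminated: what remains is
  that the expansion of \<open>x\<close> has its terms in \<open>vals R\<close> for each
  order.\<close>

lemma invariant_series_iff:
  assumes R: "coef_ring K R"
  shows "x \<in> invariant_series F G D \<iota> H K R \<longleftrightarrow>
    x \<in> clos H \<and> (\<forall>lt. group_order Q lt \<longrightarrow> (\<exists>f. expansion_in lt R x f))"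
proof -
  have "(\<exists>\<phi>. series_embedding F G D \<iota> H K lt \<phi> \<and> \<phi> x \<in> carrier (coset_series F G D \<iota> H K R lt)) \<longleftrightarrow>
      (\<exists>f. expansion_in lt R x f)" if x: "x \<in> clos H" and lt: "group_order Q lt" for lt
  proof -
    interpret L: linnell_order F G D \<iota> H K lt using linnell_orderI[OF lt] .
    show ?thesis
    proof
      assume "\<exists>\<phi>. series_embedding F G D \<iota> H K lt \<phi> \<and> \<phi> x \<in> carrier (L.MN R)"
      then obtain \<phi> where \<phi>: "series_embedding F G D \<iota> H K lt \<phi>" "\<phi> x \<in> carrier (L.MN R)" by blast
      show "\<exists>f. expansion_in lt R x f"
        unfolding expansion_in_def
        using L.embedding_expands[OF \<phi>(1) x] L.to_vals_in[OF R \<phi>(2)] by blast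
    next
      assume "\<exists>f. expansion_in lt R x f"
      then obtain f where f: "L.S.expands x f" "f \<in> L.S.series_in (vals R)"
        by (auto simp: expansion_in_def)
      have "L.of_vals (L.series_of x) \<in> carrier (L.MN R)"
        using L.of_vals_in[OF R f(2)] L.series_of_eq[OF f(1)] by simp
      then show "\<exists>\<phi>. series_embedding F G D \<iota> H K lt \<phi> \<and> \<phi> x \<in> carrier (L.MN R)"
        using L.embedding_exists by blast
    qed
  qed
  then show ?thesis unfolding invariant_series_def by blast
qed

end

section \<open>Invariant Malcev--Neumann rings\<close>

context linnell_subquotient
begin

lemma invariant_seriesD:
  assumes R: "coef_ring K R" and x: "x \<in> invariant_series F G D \<iota> H K R" and lt: "group_order Q lt"
  obtains f where "crossed_series.expands D Q lt V x f" "f \<in> series_ring.series_in D Q lt (vals R)"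
  using assms unfolding invariant_series_iff[OF R] expansion_in_def by blast

lemma invariant_seriesI:
  assumes R: "coef_ring K R" and x: "x \<in> clos H"
    and "\<And>lt. group_order Q lt \<Longrightarrow>
      \<exists>f. crossed_series.expands D Q lt V x f \<and> f \<in> series_ring.series_in D Q lt (vals R)"
  shows "x \<in> invariant_series F G D \<iota> H K R"
  using assms unfolding invariant_series_iff[OF R] expansion_in_def by blast

lemma invariant_series_mono:
  assumes R: "coef_ring K R" and R': "coef_ring K R'" and sub: "R \<subseteq> R'"
  shows "invariant_series F G D \<iota> H K R \<subseteq> invariant_series F G D \<iota> H K R'"
proof
  fix x assume x: "x \<in> invariant_series F G D \<iota> H K R"
  show "x \<in> invariant_series F G D \<iota> H K R'"
  proof (rule invariant_seriesI[OF R'])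
    show "x \<in> clos H" using x invariant_series_iff[OF R] by blast
    fix lt assume lt: "group_order Q lt"
    interpret L: linnell_order F G D \<iota> H K lt using linnell_orderI[OF lt] .
    obtain f where "L.S.expands x f" "f \<in> L.S.series_in (vals R)"
      using invariant_seriesD[OF R x lt] .
    then show "\<exists>f. L.S.expands x f \<and> f \<in> L.S.series_in (vals R')"
      using vals_mono[OF sub] unfolding L.S.series_in_def by blast
  qed
qed

lemma gimage_invariant_series:
  assumes R: "coef_ring K R"
  shows "gimage H \<subseteq> invariant_series F G D \<iota> H K R"
proof
  fix x assume x: "x \<in> gimage H"
  then obtain a where a: "a \<in> group_subring F G H" "x = \<iota> a" by (auto simp: gimage_def)
  show "x \<in> invariant_series F G D \<iota> H K R"
  proof (rule invariant_seriesI[OF R])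
    show "x \<in> clos H" using x image_closure by blast
    fix lt assume lt: "group_order Q lt"
    interpret L: linnell_order F G D \<iota> H K lt using linnell_orderI[OF lt] .
    have ex: "L.S.expands x (gr_series a)"
      using L.S.expands_ev[OF gr_series_fsupp(1)[OF a(1)]] gr_series_fsupp(2)[OF a(1)] a(2) by simp
    have "gr_series a \<in> L.S.series_in (vals R)"
      by (rule L.S.series_inI[OF L.S.expandsD(3)[OF ex]])
        (rule gr_series_vals[OF R group_subringD(1)[OF a(1)]])
    then show "\<exists>f. L.S.expands x f \<and> f \<in> L.S.series_in (vals R)" using ex by blast
  qed
qed

lemma invariant_series_subring:
  assumes R: "coef_ring K R"
  shows "subring (invariant_series F G D \<iota> H K R) D"
proof (rule D.subringI)
  let ?S = "invariant_series F G D \<iota> H K R"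
  note clH = D.skew_subfieldD[OF closure_skew_subfield[of H]]
  note W = grading_vals[OF R]
  have cl: "x \<in> clos H" if "x \<in> ?S" for x using that invariant_series_iff[OF R] by blast
  show "?S \<subseteq> carrier D" using cl clH(2) by blast
  show "\<one> \<in> ?S"
    using gimage_invariant_series[OF R] u_image[OF subgroup.one_closed[OF H_subgroup]] u_one by auto
  fix x assume x: "x \<in> ?S"
  show "\<ominus> x \<in> ?S"
  proof (rule invariant_seriesI[OF R clH(5)[OF cl[OF x]]])
    fix lt assume lt: "group_order Q lt"
    interpret L: linnell_order F G D \<iota> H K lt using linnell_orderI[OF lt] .
    obtain f where "L.S.expands x f" "f \<in> L.S.series_in (vals R)"
      using invariant_seriesD[OF R x lt] .
    then show "\<exists>f. L.S.expands (\<ominus> x) f \<and> f \<in> L.S.series_in (vals R)"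
      using L.S.expands_neg L.S.sneg_series_in[OF W] by blast
  qed
  fix y assume y: "y \<in> ?S"
  show "x \<otimes> y \<in> ?S"
  proof (rule invariant_seriesI[OF R clH(6)[OF cl[OF x] cl[OF y]]])
    fix lt assume lt: "group_order Q lt"
    interpret L: linnell_order F G D \<iota> H K lt using linnell_orderI[OF lt] .
    obtain f g where "L.S.expands x f" "f \<in> L.S.series_in (vals R)"
      "L.S.expands y g" "g \<in> L.S.series_in (vals R)"
      using invariant_seriesD[OF R x lt] invariant_seriesD[OF R y lt] by metis
    then show "\<exists>f. L.S.expands (x \<otimes> y) f \<and> f \<in> L.S.series_in (vals R)"
      using L.S.expands_mult L.S.conv_series_in[OF W] by blast
  qed
  show "x \<oplus> y \<in> ?S"
  proof (rule invariant_seriesI[OF R clH(7)[OF cl[OF x] cl[OF y]]])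
    fix lt assume lt: "group_order Q lt"
    interpret L: linnell_order F G D \<iota> H K lt using linnell_orderI[OF lt] .
    obtain f g where "L.S.expands x f" "f \<in> L.S.series_in (vals R)"
      "L.S.expands y g" "g \<in> L.S.series_in (vals R)"
      using invariant_seriesD[OF R x lt] invariant_seriesD[OF R y lt] by metis
    then show "\<exists>f. L.S.expands (x \<oplus> y) f \<and> f \<in> L.S.series_in (vals R)"
      using L.S.expands_add L.S.sadd_series_in[OF W] by blast
  qed
qed

section \<open>Invariance under conjugation and iteration of the construction\<close>

definition coset_conj :: "'g \<Rightarrow> 'g set \<Rightarrow> 'g set" where
  "coset_conj g q = (\<lambda>h. g \<otimes>\<^bsub>G\<^esub> h \<otimes>\<^bsub>G\<^esub> inv\<^bsub>G\<^esub> g) ` q"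

lemma conj_H: "g \<in> carrier G \<Longrightarrow> h \<in> H \<Longrightarrow> g \<otimes>\<^bsub>G\<^esub> h \<otimes>\<^bsub>G\<^esub> inv\<^bsub>G\<^esub> g \<in> H"
  using normal.inv_op_closed2[OF H] .

lemma conj_conj_G:
  "g \<in> carrier G \<Longrightarrow> h \<in> carrier G \<Longrightarrow>
    inv\<^bsub>G\<^esub> g \<otimes>\<^bsub>G\<^esub> (g \<otimes>\<^bsub>G\<^esub> h \<otimes>\<^bsub>G\<^esub> inv\<^bsub>G\<^esub> g) \<otimes>\<^bsub>G\<^esub> inv\<^bsub>G\<^esub> (inv\<^bsub>G\<^esub> g) = h"
proof -
  assume g: "g \<in> carrier G" and h: "h \<in> carrier G"
  have "inv\<^bsub>G\<^esub> g \<otimes>\<^bsub>G\<^esub> (g \<otimes>\<^bsub>G\<^esub> h \<otimes>\<^bsub>G\<^esub> inv\<^bsub>G\<^esub> g) \<otimes>\<^bsub>G\<^esub> inv\<^bsub>G\<^esub> (inv\<^bsub>G\<^esub> g) =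
      (inv\<^bsub>G\<^esub> g \<otimes>\<^bsub>G\<^esub> g) \<otimes>\<^bsub>G\<^esub> h \<otimes>\<^bsub>G\<^esub> (inv\<^bsub>G\<^esub> g \<otimes>\<^bsub>G\<^esub> g)"
    using g h by (simp only: G.m_assoc G.inv_closed G.inv_inv G.m_closed)
  then show ?thesis using g h by simp
qed

lemma conj_mult_G:
  "g \<in> carrier G \<Longrightarrow> h \<in> carrier G \<Longrightarrow> k \<in> carrier G \<Longrightarrow>
    g \<otimes>\<^bsub>G\<^esub> (h \<otimes>\<^bsub>G\<^esub> k) \<otimes>\<^bsub>G\<^esub> inv\<^bsub>G\<^esub> g =
    (g \<otimes>\<^bsub>G\<^esub> h \<otimes>\<^bsub>G\<^esub> inv\<^bsub>G\<^esub> g) \<otimes>\<^bsub>G\<^esub> (g \<otimes>\<^bsub>G\<^esub> k \<otimes>\<^bsub>G\<^esub> inv\<^bsub>G\<^esub> g)"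
proof -
  assume g: "g \<in> carrier G" and h: "h \<in> carrier G" and k: "k \<in> carrier G"
  have "(g \<otimes>\<^bsub>G\<^esub> h \<otimes>\<^bsub>G\<^esub> inv\<^bsub>G\<^esub> g) \<otimes>\<^bsub>G\<^esub> (g \<otimes>\<^bsub>G\<^esub> k \<otimes>\<^bsub>G\<^esub> inv\<^bsub>G\<^esub> g) =
      g \<otimes>\<^bsub>G\<^esub> h \<otimes>\<^bsub>G\<^esub> (inv\<^bsub>G\<^esub> g \<otimes>\<^bsub>G\<^esub> g) \<otimes>\<^bsub>G\<^esub> k \<otimes>\<^bsub>G\<^esub> inv\<^bsub>G\<^esub> g"
    using g h k by (simp only: G.m_assoc G.inv_closed G.m_closed)
  then show ?thesis using g h k by (simp add: G.m_assoc)
qed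

lemma coset_conj_coset:
  assumes g: "g \<in> carrier G" and h: "h \<in> H"
  shows "coset_conj g (K #>\<^bsub>G\<^esub> h) = K #>\<^bsub>G\<^esub> (g \<otimes>\<^bsub>G\<^esub> h \<otimes>\<^bsub>G\<^esub> inv\<^bsub>G\<^esub> g)"
proof (intro equalityI subsetI)
  fix x assume "x \<in> coset_conj g (K #>\<^bsub>G\<^esub> h)"
  then obtain k where k: "k \<in> K" "x = g \<otimes>\<^bsub>G\<^esub> (k \<otimes>\<^bsub>G\<^esub> h) \<otimes>\<^bsub>G\<^esub> inv\<^bsub>G\<^esub> g"
    by (auto simp: coset_conj_def r_coset_def)
  then have "x = (g \<otimes>\<^bsub>G\<^esub> k \<otimes>\<^bsub>G\<^esub> inv\<^bsub>G\<^esub> g) \<otimes>\<^bsub>G\<^esub> (g \<otimes>\<^bsub>G\<^esub> h \<otimes>\<^bsub>G\<^esub> inv\<^bsub>G\<^esub> g)"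
    using conj_mult_G[OF g K_carrier H_carrier[OF h]] by simp
  moreover have "g \<otimes>\<^bsub>G\<^esub> k \<otimes>\<^bsub>G\<^esub> inv\<^bsub>G\<^esub> g \<in> K" using normal.inv_op_closed2[OF K g k(1)] .
  ultimately show "x \<in> K #>\<^bsub>G\<^esub> (g \<otimes>\<^bsub>G\<^esub> h \<otimes>\<^bsub>G\<^esub> inv\<^bsub>G\<^esub> g)" by (auto simp: r_coset_def)
next
  fix x assume "x \<in> K #>\<^bsub>G\<^esub> (g \<otimes>\<^bsub>G\<^esub> h \<otimes>\<^bsub>G\<^esub> inv\<^bsub>G\<^esub> g)"
  then obtain k where k: "k \<in> K" "x = k \<otimes>\<^bsub>G\<^esub> (g \<otimes>\<^bsub>G\<^esub> h \<otimes>\<^bsub>G\<^esub> inv\<^bsub>G\<^esub> g)"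
    by (auto simp: r_coset_def)
  define k' where "k' = inv\<^bsub>G\<^esub> g \<otimes>\<^bsub>G\<^esub> k \<otimes>\<^bsub>G\<^esub> g"
  have k': "k' \<in> K" unfolding k'_def using normal.inv_op_closed1[OF K g k(1)] .
  have "g \<otimes>\<^bsub>G\<^esub> k' \<otimes>\<^bsub>G\<^esub> inv\<^bsub>G\<^esub> g = k"
    using conj_conj_G[of "inv\<^bsub>G\<^esub> g" k] g K_carrier[OF k(1)] by (simp add: k'_def)
  then have "x = g \<otimes>\<^bsub>G\<^esub> (k' \<otimes>\<^bsub>G\<^esub> h) \<otimes>\<^bsub>G\<^esub> inv\<^bsub>G\<^esub> g"
    using conj_mult_G[OF g K_carrier[OF k'] H_carrier[OF h]] k(2) by simp
  then show "x \<in> coset_conj g (K #>\<^bsub>G\<^esub> h)"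
    using k' by (auto simp: coset_conj_def r_coset_def)
qed

lemma coset_conj_closed: "g \<in> carrier G \<Longrightarrow> q \<in> carrier Q \<Longrightarrow> coset_conj g q \<in> carrier Q"
  using coset_conj_coset conj_H Q_carrier by metis

lemma coset_conj_inv:
  assumes "g \<in> carrier G" "q \<in> carrier Q"
  shows "coset_conj (inv\<^bsub>G\<^esub> g) (coset_conj g q) = q"
proof -
  let ?f = "\<lambda>h. inv\<^bsub>G\<^esub> g \<otimes>\<^bsub>G\<^esub> (g \<otimes>\<^bsub>G\<^esub> h \<otimes>\<^bsub>G\<^esub> inv\<^bsub>G\<^esub> g) \<otimes>\<^bsub>G\<^esub> inv\<^bsub>G\<^esub> (inv\<^bsub>G\<^esub> g)"
  have "?f ` q = (\<lambda>h. h) ` q"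
    using conj_conj_G[OF assms(1) coset_mem(2)[OF assms(2)]] by (intro image_cong refl) blast
  then show ?thesis unfolding coset_conj_def image_image by simp
qed

lemma coset_conj_inv':
  assumes "g \<in> carrier G" "q \<in> carrier Q"
  shows "coset_conj g (coset_conj (inv\<^bsub>G\<^esub> g) q) = q"
  using coset_conj_inv[of "inv\<^bsub>G\<^esub> g" q] assms by simp

lemma coset_conj_mult:
  assumes g: "g \<in> carrier G" and p: "p \<in> carrier Q" and q: "q \<in> carrier Q"
  shows "coset_conj g (p \<otimes>\<^bsub>Q\<^esub> q) = coset_conj g p \<otimes>\<^bsub>Q\<^esub> coset_conj g q"
proof -
  obtain h k where hk: "h \<in> H" "p = K #>\<^bsub>G\<^esub> h" "k \<in> H" "q = K #>\<^bsub>G\<^esub> k"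
  proof -
    from p obtain h where "h \<in> H" "p = K #>\<^bsub>G\<^esub> h" unfolding Q_carrier by (rule bexE)
    moreover from q obtain k where "k \<in> H" "q = K #>\<^bsub>G\<^esub> k" unfolding Q_carrier by (rule bexE)
    ultimately show ?thesis by (rule that)
  qed
  have hkH: "h \<otimes>\<^bsub>G\<^esub> k \<in> H" using subgroup.m_closed[OF H_subgroup] hk by blast
  have "coset_conj g (p \<otimes>\<^bsub>Q\<^esub> q) = K #>\<^bsub>G\<^esub> (g \<otimes>\<^bsub>G\<^esub> (h \<otimes>\<^bsub>G\<^esub> k) \<otimes>\<^bsub>G\<^esub> inv\<^bsub>G\<^esub> g)"
    unfolding hk(2,4) Q_mult[OF hk(1,3)] by (rule coset_conj_coset[OF g hkH])
  also have "\<dots> = coset_conj g p \<otimes>\<^bsub>Q\<^esub> coset_conj g q"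
    unfolding hk(2,4) coset_conj_coset[OF g hk(1)] coset_conj_coset[OF g hk(3)]
      Q_mult[OF conj_H[OF g hk(1)] conj_H[OF g hk(3)]]
      conj_mult_G[OF g H_carrier[OF hk(1)] H_carrier[OF hk(3)]] ..
  finally show ?thesis .
qed

lemma conj_vals:
  assumes R: "coef_ring K R" and g: "g \<in> carrier G" and q: "q \<in> carrier Q" and x: "x \<in> vals R q"
  shows "conj_by g x \<in> vals R (coset_conj g q)"
proof -
  obtain r h where rh: "x = r \<otimes> u h" "r \<in> R" "h \<in> q" using x by (auto simp: vals_def)
  have "conj_by g x = conj_by g r \<otimes> u (g \<otimes>\<^bsub>G\<^esub> h \<otimes>\<^bsub>G\<^esub> inv\<^bsub>G\<^esub> g)"
    using rh coset_mem(2)[OF q rh(3)] coef_ringD(5)[OF R] g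
    by (simp add: conj_mult u_closed conj_u)
  moreover have "g \<otimes>\<^bsub>G\<^esub> h \<otimes>\<^bsub>G\<^esub> inv\<^bsub>G\<^esub> g \<in> coset_conj g q" using rh(3) by (simp add: coset_conj_def)
  ultimately show ?thesis using coef_ringD(4)[OF R g rh(2)] unfolding vals_def by blast
qed

lemma group_order_conj:
  assumes lt: "group_order Q lt" and g: "g \<in> carrier G"
  shows "group_order Q (\<lambda>p q. lt (coset_conj g p) (coset_conj g q))"
proof -
  note c = coset_conj_closed[OF g]
  have inj: "coset_conj g p \<noteq> coset_conj g q" if "p \<in> carrier Q" "q \<in> carrier Q" "p \<noteq> q" for p q
    using coset_conj_inv[OF g] that by metis
  have lt': "irreflp_on (carrier Q) lt" "transp_on (carrier Q) lt" "totalp_on (carrier Q) lt"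
    and mono: "\<And>x y z. x \<in> carrier Q \<Longrightarrow> y \<in> carrier Q \<Longrightarrow> z \<in> carrier Q \<Longrightarrow> lt x y \<Longrightarrow>
        lt (z \<otimes>\<^bsub>Q\<^esub> x) (z \<otimes>\<^bsub>Q\<^esub> y) \<and> lt (x \<otimes>\<^bsub>Q\<^esub> z) (y \<otimes>\<^bsub>Q\<^esub> z)"
    using lt unfolding group_order_def by blast+
  show ?thesis
    unfolding group_order_def
  proof (intro conjI ballI impI)
    show "irreflp_on (carrier Q) (\<lambda>p q. lt (coset_conj g p) (coset_conj g q))"
      using lt'(1) c unfolding irreflp_on_def by blast
    show "transp_on (carrier Q) (\<lambda>p q. lt (coset_conj g p) (coset_conj g q))"
      using lt'(2) c unfolding transp_on_def by blast
    show "totalp_on (carrier Q) (\<lambda>p q. lt (coset_conj g p) (coset_conj g q))"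
    proof (rule totalp_onI)
      fix x y assume "x \<in> carrier Q" "y \<in> carrier Q" "x \<noteq> y"
      then show "lt (coset_conj g x) (coset_conj g y) \<or> lt (coset_conj g y) (coset_conj g x)"
        using lt'(3) c inj[of x y] by (intro totalp_onD[of "carrier Q" lt]) auto
    qed
    fix x y z assume *: "x \<in> carrier Q" "y \<in> carrier Q" "z \<in> carrier Q"
      "lt (coset_conj g x) (coset_conj g y)"
    from mono[OF c[OF *(1)] c[OF *(2)] c[OF *(3)] *(4)]
    show "lt (coset_conj g (z \<otimes>\<^bsub>Q\<^esub> x)) (coset_conj g (z \<otimes>\<^bsub>Q\<^esub> y))"
      "lt (coset_conj g (x \<otimes>\<^bsub>Q\<^esub> z)) (coset_conj g (y \<otimes>\<^bsub>Q\<^esub> z))"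
      unfolding coset_conj_mult[OF g *(3,1)] coset_conj_mult[OF g *(3,2)]
        coset_conj_mult[OF g *(1,3)] coset_conj_mult[OF g *(2,3)] by blast+
  qed
qed

text \<open>Conjugation by \<open>g\<close> does not act on the series for one order, but it carries
  series for the order pulled back along \<open>g\<close> to series for the given one. An element
  with coefficients in \<open>R\<close> for every order therefore has conjugates of the same
  kind.\<close>

lemma coef_ring_invariant:
  assumes R: "coef_ring K R"
  shows "coef_ring H (invariant_series F G D \<iota> H K R)"
  unfolding coef_ring_def
proof (intro conjI ballI)
  show "subring (invariant_series F G D \<iota> H K R) D" by (rule invariant_series_subring[OF R])
  show "gimage H \<subseteq> invariant_series F G D \<iota> H K R" by (rule gimage_invariant_series[OF R])
  show "invariant_series F G D \<iota> H K R \<subseteq> clos H" using invariant_series_iff[OF R] by blast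
  fix g x assume g: "g \<in> carrier G" and x: "x \<in> invariant_series F G D \<iota> H K R"
  show "conj_by g x \<in> invariant_series F G D \<iota> H K R"
  proof (rule invariant_seriesI[OF R])
    show "conj_by g x \<in> clos H" using conj_closure[OF H g] x invariant_series_iff[OF R] by blast
    fix lt assume lt: "group_order Q lt"
    \<comment> \<open>The pulled-back order; the hypothesis on \<open>x\<close> is used for this
      order in order to treat its conjugate for \<open>lt\<close>.\<close>
    define lt' where "lt' = (\<lambda>p q. lt (coset_conj g p) (coset_conj g q))"
    have lt'': "group_order Q lt'" unfolding lt'_def by (rule group_order_conj[OF lt g])
    interpret L: linnell_order F G D \<iota> H K lt using linnell_orderI[OF lt] .
    interpret L': linnell_order F G D \<iota> H K lt' using linnell_orderI[OF lt''] .
    obtain f where f: "L'.S.expands x f" "f \<in> L'.S.series_in (vals R)"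
      using invariant_seriesD[OF R x lt''] .
    let ?h = "\<lambda>q. if q \<in> carrier Q then u g \<otimes> f (coset_conj (inv\<^bsub>G\<^esub> g) q) \<otimes> inv (u g) else \<zero>"
    have ig: "inv\<^bsub>G\<^esub> g \<in> carrier G" using g by simp
    have ex: "L.S.expands (u g \<otimes> x \<otimes> inv (u g)) ?h"
    proof (rule expands_conj[OF L'.S.crossed_series_axioms L.S.crossed_series_axioms])
      show "coset_conj g \<in> hom Q Q"
        using coset_conj_closed[OF g] coset_conj_mult[OF g] by (intro homI) auto
      show "coset_conj (inv\<^bsub>G\<^esub> g) \<in> carrier Q \<rightarrow> carrier Q" using coset_conj_closed[OF ig] by blast
      show "u g \<otimes> y \<otimes> inv (u g) \<in> V (coset_conj g q)" if "q \<in> carrier Q" "y \<in> V q" for q y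
        using conj_vals[OF coef_clos g that] by (simp add: conj_by_def)
    qed (use coset_conj_inv[OF g] coset_conj_inv'[OF g] u_closed u_nonzero[OF g] f(1)
        in \<open>simp_all add: lt'_def\<close>)
    have "?h \<in> L.S.series_in (vals R)"
    proof (rule L.S.series_inI[OF L.S.expandsD(3)[OF ex]])
      fix q assume q: "q \<in> carrier Q"
      have "conj_by g (f (coset_conj (inv\<^bsub>G\<^esub> g) q)) \<in> vals R (coset_conj g (coset_conj (inv\<^bsub>G\<^esub> g) q))"
        using conj_vals[OF R g coset_conj_closed[OF ig q]]
          L'.S.series_inD(2)[OF f(2) coset_conj_closed[OF ig q]] by blast
      then show "?h q \<in> vals R q" using q coset_conj_inv'[OF g q] by (simp add: conj_by_def)
    qed
    then show "\<exists>f. L.S.expands (conj_by g x) f \<and> f \<in> L.S.series_in (vals R)"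
      using ex unfolding conj_by_def by blast
  qed
qed

text \<open>Inverses in \<open>R' ** Q\<close> of elements of \<open>R ** Q\<close> are controlled by finitely many coefficients: the
  leading terms of the series of \<open>x\<close> over all orders on \<open>Q\<close>.\<close>

lemma invariant_series_inverse:
  assumes R: "coef_ring K R" and x: "x \<in> invariant_series F G D \<iota> H K R" "x \<noteq> \<zero>"
  shows "\<exists>T. finite T \<and> T \<subseteq> R - {\<zero>} \<and>
    (\<forall>R'. coef_ring K R' \<longrightarrow> R \<subseteq> R' \<longrightarrow> (\<forall>t\<in>T. inv t \<in> R') \<longrightarrow>
      inv x \<in> invariant_series F G D \<iota> H K R')"
proof -
  have xH: "x \<in> clos H" using x(1) invariant_series_iff[OF R] by blast
  then have "x \<in> C.fractions" using closure_fractions by blast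
  then obtain a b where ab: "a \<in> C.fsupp" "b \<in> C.fsupp" "C.ev b \<noteq> \<zero>" "C.ev a = x \<otimes> C.ev b"
    by (auto simp: C.fractions_def C.crossed_def)
  note aD = C.fsuppD[OF ab(1)] and bD = C.fsuppD[OF ab(2)]
  define t where "t = (\<lambda>q :: 'g set. SOME h. h \<in> q)"
  have t: "t q \<in> q" if "q \<in> carrier Q" for q
    unfolding t_def using coset_nonempty[OF that] by (rule someI_ex)
  \<comment> \<open>Candidates for the leading coefficient of \<open>x\<close>, relative to fixed
    coset representatives, computed from one fraction of \<open>x\<close> without reference to an
    order.\<close>
  define c where "c = (\<lambda>(r, s). a r \<otimes> inv (b s) \<otimes> inv (u (t (r \<otimes>\<^bsub>Q\<^esub> inv\<^bsub>Q\<^esub> s))))"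
  \<comment> \<open>Not every candidate occurs as a leading coefficient. Those that do are nonzero
    and lie in \<open>R\<close>, so restricting to such candidates loses none of them.\<close>
  define T where "T = (c ` ({r. a r \<noteq> \<zero>} \<times> {s. b s \<noteq> \<zero>})) \<inter> (R - {\<zero>})"
  have "finite T" unfolding T_def using aD(1) bD(1) by blast
  moreover have "inv x \<in> invariant_series F G D \<iota> H K R'"
    if R': "coef_ring K R'" and sub: "R \<subseteq> R'" and invs: "\<forall>t\<in>T. inv t \<in> R'" for R'
  proof (rule invariant_seriesI[OF R'])
    show "inv x \<in> clos H" using D.skew_subfieldD(8)[OF closure_skew_subfield xH x(2)] .
    fix lt assume lt: "group_order Q lt"
    interpret L: linnell_order F G D \<iota> H K lt using linnell_orderI[OF lt] .
    obtain f where f: "L.S.expands x f" "f \<in> L.S.series_in (vals R)"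
      using invariant_seriesD[OF R x(1) lt] .
    have f': "f \<in> L.S.series_in (vals R')"
      using f(2) vals_mono[OF sub] unfolding L.S.series_in_def by blast
    have "inv (f p) \<in> vals R' (inv\<^bsub>Q\<^esub> p)" if p: "L.S.is_least f p" for p
    proof -
      obtain r s where rs: "a r \<noteq> \<zero>" "b s \<noteq> \<zero>" "p = r \<otimes>\<^bsub>Q\<^esub> inv\<^bsub>Q\<^esub> s" "f p = a r \<otimes> inv (b s)"
        using L.S.expands_least[OF f(1) p ab] by blast
      have pc: "p \<in> carrier Q" unfolding rs(3) using aD(3)[OF rs(1)] bD(3)[OF rs(2)]
        by (intro Q.m_closed Q.inv_closed)
      have fp: "f p \<noteq> \<zero>" "f p \<in> carrier D"
        using p L.S.series_closed[OF L.S.expandsD(3)[OF f(1)]] by (auto simp: L.S.is_least_def)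
      note h = t[OF pc]
      note hc = coset_mem(2)[OF pc h]
      have mem: "f p \<otimes> inv (u (t p)) \<in> R"
        using vals_iff[OF R pc h] L.S.series_inD(2)[OF f(2) pc] by blast
      have "f p \<otimes> inv (u (t p)) \<noteq> \<zero>"
        using D.skew_integral[OF fp(2) inv_u_closed[OF hc]] fp(1)
          D.skew_inv_nonzero[OF u_closed u_nonzero[OF hc]] by blast
      moreover have "f p \<otimes> inv (u (t p)) = c (r, s)" by (simp only: c_def prod.case rs(3,4)[symmetric])
      ultimately have "f p \<otimes> inv (u (t p)) \<in> T" using mem rs(1,2) unfolding T_def by auto
      then have "inv (f p \<otimes> inv (u (t p))) \<in> R'" using invs by blast
      then show ?thesis using vals_inverse[OF R' pc h fp(2,1)] by blast
    qed
    then show "\<exists>f. L.S.expands (inv x) f \<and> f \<in> L.S.series_in (vals R')"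
      using L.S.expands_inverse_in[OF f(1) x(2) grading_vals[OF R'] f'] by blast
  qed
  ultimately show ?thesis unfolding T_def by blast
qed

text \<open>For elements of the group ring the leading terms are sub-sums over a coset.\<close>

lemma group_ring_inverse:
  assumes R: "coef_ring K R" and S: "finite S" "S \<subseteq> H" and c: "\<And>g. g \<in> S \<Longrightarrow> c g \<in> carrier F"
    and x: "x = (\<Oplus>g\<in>S. \<kappa> (c g) \<otimes> u g)" "x \<noteq> \<zero>"
    and inverses: "\<And>S' h. S' \<subseteq> S \<Longrightarrow> h \<in> H \<Longrightarrow> (\<lambda>g. g \<otimes>\<^bsub>G\<^esub> inv\<^bsub>G\<^esub> h) ` S' \<subseteq> K \<Longrightarrow>
      (\<Oplus>g\<in>S'. \<kappa> (c g) \<otimes> u (g \<otimes>\<^bsub>G\<^esub> inv\<^bsub>G\<^esub> h)) \<noteq> \<zero> \<Longrightarrow>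
      inv (\<Oplus>g\<in>S'. \<kappa> (c g) \<otimes> u (g \<otimes>\<^bsub>G\<^esub> inv\<^bsub>G\<^esub> h)) \<in> R"
  shows "inv x \<in> invariant_series F G D \<iota> H K R"
proof -
  have Sc: "S \<subseteq> carrier G" using S(2) H_carrier by blast
  define a where "a = (\<lambda>g\<in>carrier G. if g \<in> S then c g else \<zero>\<^bsub>F\<^esub>)"
  have sup: "{g \<in> carrier G. a g \<noteq> \<zero>\<^bsub>F\<^esub>} \<subseteq> S" by (auto simp: a_def)
  then have fin: "finite {g \<in> carrier G. a g \<noteq> \<zero>\<^bsub>F\<^esub>}" using S(1) finite_subset by blast
  have a: "a \<in> group_subring F G H"
    using fin c S(2) by (simp add: group_subring_def GR_carrier) (auto simp: a_def)
  note aD = group_subringD[OF a]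
  have xa: "x = \<iota> a"
  proof -
    have "\<iota> a = (\<Oplus>g\<in>S. \<kappa> (a g) \<otimes> u g)"
      using aD(1) S(1) Sc by (rule \<iota>_eq_sum) (use sup in blast)
    also have "\<dots> = x"
      unfolding x(1) using c Sc \<kappa>_closed u_closed
      by (intro D.finsum_cong') (auto simp: a_def subset_iff)
    finally show ?thesis by simp
  qed
  have "x \<in> gimage H" using a xa by (simp add: gimage_def)
  then have xH: "x \<in> clos H" using image_closure by blast
  show ?thesis
  proof (rule invariant_seriesI[OF R])
    show "inv x \<in> clos H" using D.skew_subfieldD(8)[OF closure_skew_subfield xH x(2)] .
    fix lt assume lt: "group_order Q lt"
    interpret L: linnell_order F G D \<iota> H K lt using linnell_orderI[OF lt] .
    have ex: "L.S.expands x (gr_series a)"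
      using L.S.expands_ev[OF gr_series_fsupp(1)[OF a]] gr_series_fsupp(2)[OF a] xa by simp
    have inR: "gr_series a \<in> L.S.series_in (vals R)"
      by (rule L.S.series_inI[OF L.S.expandsD(3)[OF ex]]) (rule gr_series_vals[OF R aD(1)])
    have "inv (gr_series a p) \<in> vals R (inv\<^bsub>Q\<^esub> p)" if p: "L.S.is_least (gr_series a) p" for p
    proof -
      have fp: "gr_series a p \<noteq> \<zero>" "gr_series a p \<in> carrier D"
        using p L.S.series_closed[OF L.S.expandsD(3)[OF ex]] by (auto simp: L.S.is_least_def)
      then have pc: "p \<in> carrier Q" by (auto simp: gr_series_def split: if_splits)
      obtain h where h: "h \<in> p" using coset_nonempty[OF pc] by blast
      note hD = coset_mem[OF pc h]
      let ?S = "{g \<in> carrier G. a g \<noteq> \<zero>\<^bsub>F\<^esub>} \<inter> p"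
      have finS: "finite ?S" using fin by simp
      have SS: "?S \<subseteq> S" using sup by blast
      have t: "\<kappa> (a g) \<otimes> u g \<in> carrier D" if "g \<in> carrier G" for g
        using aD(3)[OF that] \<kappa>_closed u_closed by simp
      have gp: "gr_series a p = (\<Oplus>g\<in>?S. \<kappa> (a g) \<otimes> u g)"
        using part_eq_sum[OF aD(1)] pc by (simp add: gr_series_def)
      \<comment> \<open>Dividing by \<open>u h\<close> translates the sub-sum over the coset
        \<open>p\<close> into the group ring of \<open>K\<close>; this is the coefficient to which
        \<open>inverses\<close> applies.\<close>
      have "gr_series a p \<otimes> inv (u h) = (\<Oplus>g\<in>?S. \<kappa> (a g) \<otimes> u g \<otimes> inv (u h))"
        unfolding gp using finS t inv_u_closed[OF hD(2)] by (intro D.finsum_ldistr) auto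
      also have "\<dots> = (\<Oplus>g\<in>?S. \<kappa> (c g) \<otimes> u (g \<otimes>\<^bsub>G\<^esub> inv\<^bsub>G\<^esub> h))"
      proof (rule D.finsum_cong'[OF refl])
        show "(\<lambda>g. \<kappa> (c g) \<otimes> u (g \<otimes>\<^bsub>G\<^esub> inv\<^bsub>G\<^esub> h)) \<in> ?S \<rightarrow> carrier D"
          using c SS \<kappa>_closed u_closed by auto
        fix g assume g: "g \<in> ?S"
        then have "a g = c g" using SS by (auto simp: a_def)
        moreover have "c g \<in> carrier F" using c g SS by blast
        ultimately show "\<kappa> (a g) \<otimes> u g \<otimes> inv (u h) = \<kappa> (c g) \<otimes> u (g \<otimes>\<^bsub>G\<^esub> inv\<^bsub>G\<^esub> h)"
          using g hD(2) \<kappa>_closed u_closed by (simp add: u_inv u_mult D.m_assoc)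
      qed
      finally have eq: "gr_series a p \<otimes> inv (u h) = (\<Oplus>g\<in>?S. \<kappa> (c g) \<otimes> u (g \<otimes>\<^bsub>G\<^esub> inv\<^bsub>G\<^esub> h))" .
      have "gr_series a p \<otimes> inv (u h) \<noteq> \<zero>"
        using D.skew_integral[OF fp(2) inv_u_closed[OF hD(2)]] fp(1)
          D.skew_inv_nonzero[OF u_closed u_nonzero[OF hD(2)]] by blast
      moreover have "(\<lambda>g. g \<otimes>\<^bsub>G\<^esub> inv\<^bsub>G\<^esub> h) ` ?S \<subseteq> K"
      proof
        fix y assume "y \<in> (\<lambda>g. g \<otimes>\<^bsub>G\<^esub> inv\<^bsub>G\<^esub> h) ` ?S"
        then obtain g where g: "g \<in> p" "y = g \<otimes>\<^bsub>G\<^esub> inv\<^bsub>G\<^esub> h" by blast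
        then obtain k where "k \<in> K" "g = k \<otimes>\<^bsub>G\<^esub> h" using hD(3) by (auto simp: r_coset_def)
        then show "y \<in> K" using g(2) hD(2) K_carrier by (simp add: G.m_assoc)
      qed
      ultimately have "inv (gr_series a p \<otimes> inv (u h)) \<in> R"
        unfolding eq using inverses[OF SS hD(1)] by blast
      then show ?thesis using vals_inverse[OF R pc h fp(2,1)] by blast
    qed
    then show "\<exists>f. L.S.expands (inv x) f \<and> f \<in> L.S.series_in (vals R)"
      using L.S.expands_inverse_in[OF ex x(2) grading_vals[OF R] inR] by blast
  qed
qed

end

section \<open>The tower\<close>

locale linnell_chain = linnell_ring F G D \<iota>
  for F :: "('f, 'm) ring_scheme" and G :: "('g, 'n) monoid_scheme"
    and D :: "('d, 'k) ring_scheme" (structure) and \<iota> :: "('g \<Rightarrow> 'f) \<Rightarrow> 'd" +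
  fixes K :: "nat \<Rightarrow> 'g set"
  assumes K_zero: "K 0 = carrier G" and K_normal: "\<And>i. K i \<lhd> G"
    and K_Suc: "\<And>i. K (Suc i) \<subseteq> K i" and K_Inter: "(\<Inter>i. K i) = {\<one>\<^bsub>G\<^esub>}"
    and K_amenable: "\<And>i. amenable (quotient_group G (K i) (K (Suc i)))"
begin

abbreviation "T \<equiv> tower F G D \<iota> K"

lemma subquotient: "linnell_subquotient F G D \<iota> (K j) (K (Suc j))"
  by (intro linnell_subquotient.intro linnell_ring_axioms linnell_subquotient_axioms.intro
      K_normal K_Suc K_amenable)

lemma T_diag: "T i i = gimage (K i)"
  by (simp add: tower_diag gimage_def)

text \<open>The induction descends from \<open>j = i\<close>, since \<open>R ** Q\<close> has one
  level up the properties that were required of \<open>R\<close>.\<close>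

lemma coef_ring_T: "j \<le> i \<Longrightarrow> coef_ring (K j) (T i j)"
proof (induction j rule: inc_induct)
  case base
  then show ?case using coef_ring_image[OF K_normal] by (simp add: T_diag)
next
  case (step j)
  then show ?case
    using linnell_subquotient.coef_ring_invariant[OF subquotient] by (simp add: tower_step)
qed

text \<open>At \<open>j = i\<close> the larger ring, being a coefficient ring for
  \<open>K i\<close>, contains the group ring of \<open>K i\<close>, which is the smaller one.
  Monotonicity of \<open>R ** Q\<close> in \<open>R\<close> carries the inclusion to smaller
  \<open>j\<close>.\<close>

lemma T_Suc: "j \<le> i \<Longrightarrow> T i j \<subseteq> T (Suc i) j"
proof (induction j rule: inc_induct)
  case base
  then show ?case using coef_ringD(2)[OF coef_ring_T[of i "Suc i"]] by (auto simp: T_diag)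
next
  case (step j)
  have "coef_ring (K (Suc j)) (T i (Suc j))" "coef_ring (K (Suc j)) (T (Suc i) (Suc j))"
    using step.hyps by (auto intro: coef_ring_T)
  note mono = linnell_subquotient.invariant_series_mono[OF subquotient this step.IH]
  have "T n j = invariant_series F G D \<iota> (K j) (K (Suc j)) (T n (Suc j))" if "i \<le> n" for n
    by (rule tower_step) (use that step.hyps in simp)
  then show ?case using mono by (simp only: le_SucI order_refl)
qed

lemma T_mono:
  assumes "j \<le> i" "i \<le> i'"
  shows "T i j \<subseteq> T i' j"
  using assms(2)
proof (induction i' rule: dec_induct)
  case base
  show ?case by (rule order_refl)
next
  case (step n)
  then show ?case using T_Suc[of j n] assms(1) by auto
qed

lemma K_antimono: "i \<le> i' \<Longrightarrow> K i' \<subseteq> K i"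
  by (rule lift_Suc_antimono_le[of K]) (rule K_Suc)

lemma K_carrier: "K i \<subseteq> carrier G"
  using subgroup.subset normal_imp_subgroup[OF K_normal] by blast

text \<open>By descending induction on \<open>j\<close>. Each level replaces a sum by sub-sums over
  cosets, translated into the next subgroup; at level \<open>i\<close> separation leaves one term, a
  unit of the group ring.\<close>

lemma separated_inverse:
  assumes "j \<le> i" "finite S" "S \<subseteq> K j" "\<And>g. g \<in> S \<Longrightarrow> c g \<in> carrier F"
    and "\<And>g h. g \<in> S \<Longrightarrow> h \<in> S \<Longrightarrow> g \<otimes>\<^bsub>G\<^esub> inv\<^bsub>G\<^esub> h \<in> K i \<Longrightarrow> g = h"
    and "(\<Oplus>g\<in>S. \<kappa> (c g) \<otimes> u g) \<noteq> \<zero>"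
  shows "inv (\<Oplus>g\<in>S. \<kappa> (c g) \<otimes> u g) \<in> T i j"
  using assms
proof (induction j arbitrary: S c rule: inc_induct)
  case (base S c)
  have "S \<noteq> {}" using base(5) by auto
  then obtain g where g: "g \<in> S" by blast
  note sub = normal_imp_subgroup[OF K_normal[of i]]
  \<comment> \<open>At level \<open>i\<close> all quotients of elements of \<open>S\<close> lie in
    \<open>K i\<close>, so separation permits only one element.\<close>
  have "h = g" if h: "h \<in> S" for h
    using base(4)[OF h g] subgroup.m_closed[OF sub] subgroup.m_inv_closed[OF sub] base(2) g h
    by blast
  then have S: "S = {g}" using g by blast
  have gc: "g \<in> K i" "g \<in> carrier G" "c g \<in> carrier F" using g base(2,3) K_carrier by auto
  have sum: "(\<Oplus>g\<in>S. \<kappa> (c g) \<otimes> u g) = \<kappa> (c g) \<otimes> u g"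
    unfolding S using gc \<kappa>_closed u_closed by simp
  have nz: "\<kappa> (c g) \<otimes> u g \<noteq> \<zero>" using base(5) sum by simp
  have "c g \<noteq> \<zero>\<^bsub>F\<^esub>"
  proof
    assume "c g = \<zero>\<^bsub>F\<^esub>"
    moreover have "\<kappa> \<zero>\<^bsub>F\<^esub> = \<zero>"
    proof -
      have "single \<zero>\<^bsub>F\<^esub> \<one>\<^bsub>G\<^esub> = (\<lambda>g\<in>carrier G. \<zero>\<^bsub>F\<^esub>)" by (auto simp: gr_single_def)
      then show ?thesis unfolding \<kappa>_def by (simp only: \<iota>_zero)
    qed
    ultimately show False using nz u_closed by simp
  qed
  then have ic: "inv\<^bsub>F\<^esub> c g \<in> carrier F" "c g \<otimes>\<^bsub>F\<^esub> inv\<^bsub>F\<^esub> c g = \<one>\<^bsub>F\<^esub>"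
    "inv\<^bsub>F\<^esub> c g \<otimes>\<^bsub>F\<^esub> c g = \<one>\<^bsub>F\<^esub>"
    using gc(3) F.field_Units by auto
  have \<kappa>_mult: "\<kappa> (a \<otimes>\<^bsub>F\<^esub> b) = \<kappa> a \<otimes> \<kappa> b" if "a \<in> carrier F" "b \<in> carrier F" for a b
    using ring_hom_mult[OF \<iota>_hom single_closed single_closed, of a b "\<one>\<^bsub>G\<^esub>" "\<one>\<^bsub>G\<^esub>"] that
    by (simp add: \<kappa>_def single_mult)
  have \<kappa>_one: "\<kappa> \<one>\<^bsub>F\<^esub> = \<one>" using u_one by (simp add: \<kappa>_def u_single)
  have k: "\<kappa> (c g) \<otimes> \<kappa> (inv\<^bsub>F\<^esub> c g) = \<one>" "\<kappa> (inv\<^bsub>F\<^esub> c g) \<otimes> \<kappa> (c g) = \<one>"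
    using \<kappa>_mult gc ic \<kappa>_one by metis+
  have ck: "\<kappa> (c g) \<in> carrier D" "\<kappa> (inv\<^bsub>F\<^esub> c g) \<in> carrier D" using \<kappa>_closed gc ic by auto
  have ik: "inv (\<kappa> (c g)) = \<kappa> (inv\<^bsub>F\<^esub> c g)" using D.inv_char[OF ck k] .
  have "\<kappa> (c g) \<noteq> \<zero>" using nz u_closed by auto
  then have "inv (\<kappa> (c g) \<otimes> u g) = u (inv\<^bsub>G\<^esub> g) \<otimes> \<kappa> (inv\<^bsub>F\<^esub> c g)"
    using D.skew_inv_mult[OF ck(1) u_closed _ u_nonzero[OF gc(2)]] ik u_inv[OF gc(2)] by simp
  moreover have "u (inv\<^bsub>G\<^esub> g) \<in> gimage (K i)"
    using u_image subgroup.m_inv_closed[OF sub gc(1)] by blast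
  moreover have "\<kappa> (inv\<^bsub>F\<^esub> c g) \<in> gimage (K i)" using \<kappa>_image[OF sub ic(1)] .
  ultimately show ?case
    unfolding sum T_diag using subringE(6)[OF image_subring[OF sub]] by simp
next
  case (step j S c)
  interpret Q: linnell_subquotient F G D \<iota> "K j" "K (Suc j)" by (rule subquotient)
  have R: "coef_ring (K (Suc j)) (T i (Suc j))" using step.hyps by (intro coef_ring_T) simp
  have Sc: "S \<subseteq> carrier G" using step.prems(2) K_carrier by blast
  have "inv (\<Oplus>g\<in>S. \<kappa> (c g) \<otimes> u g) \<in>
      invariant_series F G D \<iota> (K j) (K (Suc j)) (T i (Suc j))"
  proof (rule Q.group_ring_inverse[where S = S and c = c, OF R])
    show "finite S" "S \<subseteq> K j" "(\<Oplus>g\<in>S. \<kappa> (c g) \<otimes> u g) \<noteq> \<zero>"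
      "(\<Oplus>g\<in>S. \<kappa> (c g) \<otimes> u g) = (\<Oplus>g\<in>S. \<kappa> (c g) \<otimes> u g)"
      using step.prems by simp_all
    show "c g \<in> carrier F" if "g \<in> S" for g using step.prems(3) that .
    fix S' h assume S': "S' \<subseteq> S" and h: "h \<in> K j"
      and sub: "(\<lambda>g. g \<otimes>\<^bsub>G\<^esub> inv\<^bsub>G\<^esub> h) ` S' \<subseteq> K (Suc j)"
      and nz: "(\<Oplus>g\<in>S'. \<kappa> (c g) \<otimes> u (g \<otimes>\<^bsub>G\<^esub> inv\<^bsub>G\<^esub> h)) \<noteq> \<zero>"
    have hc: "h \<in> carrier G" "inv\<^bsub>G\<^esub> h \<in> carrier G" using h K_carrier by auto
    have S'c: "g \<in> carrier G" if "g \<in> S'" for g using that S' Sc by blast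
    have cancel: "g \<otimes>\<^bsub>G\<^esub> inv\<^bsub>G\<^esub> h \<otimes>\<^bsub>G\<^esub> h = g" if "g \<in> S'" for g
      using S'c[OF that] hc by (simp add: G.m_assoc)
    have inj: "inj_on (\<lambda>g. g \<otimes>\<^bsub>G\<^esub> inv\<^bsub>G\<^esub> h) S'" by (rule inj_on_inverseI[of _ "\<lambda>g. g \<otimes>\<^bsub>G\<^esub> h"]) (rule cancel)
    \<comment> \<open>The translated support with its coefficients relabelled, which brings the
      sub-sum into the form of the induction hypothesis.\<close>
    let ?S = "(\<lambda>g. g \<otimes>\<^bsub>G\<^esub> inv\<^bsub>G\<^esub> h) ` S'" and ?c = "\<lambda>g. c (g \<otimes>\<^bsub>G\<^esub> h)"
    have cc: "?c g \<in> carrier F" if "g \<in> ?S" for g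
      using that cancel step.prems(3) S' by auto
    have "(\<Oplus>g\<in>?S. \<kappa> (?c g) \<otimes> u g) = (\<Oplus>g\<in>S'. \<kappa> (?c (g \<otimes>\<^bsub>G\<^esub> inv\<^bsub>G\<^esub> h)) \<otimes> u (g \<otimes>\<^bsub>G\<^esub> inv\<^bsub>G\<^esub> h))"
      using cc \<kappa>_closed u_closed by (intro D.finsum_reindex inj) auto
    also have "\<dots> = (\<Oplus>g\<in>S'. \<kappa> (c g) \<otimes> u (g \<otimes>\<^bsub>G\<^esub> inv\<^bsub>G\<^esub> h))"
      using cancel step.prems(3) S' \<kappa>_closed u_closed by (intro D.finsum_cong') auto
    finally have eq: "(\<Oplus>g\<in>?S. \<kappa> (?c g) \<otimes> u g) = (\<Oplus>g\<in>S'. \<kappa> (c g) \<otimes> u (g \<otimes>\<^bsub>G\<^esub> inv\<^bsub>G\<^esub> h))" .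
    have "inv (\<Oplus>g\<in>?S. \<kappa> (?c g) \<otimes> u g) \<in> T i (Suc j)"
    proof (rule step.IH[of ?S ?c])
      show "?S \<subseteq> K (Suc j)" by (rule sub)
      show "?c g \<in> carrier F" if "g \<in> ?S" for g using that by (rule cc)
      show "finite ?S" using step.prems(1) S' finite_subset by blast
      show "(\<Oplus>g\<in>?S. \<kappa> (?c g) \<otimes> u g) \<noteq> \<zero>" unfolding eq by (rule nz)
      fix g' k' assume "g' \<in> ?S" "k' \<in> ?S" and m: "g' \<otimes>\<^bsub>G\<^esub> inv\<^bsub>G\<^esub> k' \<in> K i"
      then obtain g k where gk: "g \<in> S'" "k \<in> S'" "g' = g \<otimes>\<^bsub>G\<^esub> inv\<^bsub>G\<^esub> h" "k' = k \<otimes>\<^bsub>G\<^esub> inv\<^bsub>G\<^esub> h"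
        by blast
      \<comment> \<open>Right translation does not change the quotients
        \<open>g \<otimes> inv k\<close>, so separation modulo \<open>K i\<close> is
        inherited.\<close>
      have "g' \<otimes>\<^bsub>G\<^esub> inv\<^bsub>G\<^esub> k' = g \<otimes>\<^bsub>G\<^esub> (inv\<^bsub>G\<^esub> h \<otimes>\<^bsub>G\<^esub> h) \<otimes>\<^bsub>G\<^esub> inv\<^bsub>G\<^esub> k"
        unfolding gk(3,4) using S'c[OF gk(1)] S'c[OF gk(2)] hc
        by (simp only: G.inv_mult_group G.m_assoc G.inv_closed G.inv_inv G.m_closed)
      then have "g \<otimes>\<^bsub>G\<^esub> inv\<^bsub>G\<^esub> k \<in> K i" using m S'c gk(1,2) hc by simp
      then show "g' = k'" using step.prems(4)[of g k] gk S' by blast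
    qed
    then show "inv (\<Oplus>g\<in>S'. \<kappa> (c g) \<otimes> u (g \<otimes>\<^bsub>G\<^esub> inv\<^bsub>G\<^esub> h)) \<in> T i (Suc j)" unfolding eq .
  qed
  then show ?case using step.hyps by (simp add: tower_step)
qed

text \<open>For one pair of distinct elements a suitable index exists because the \<open>K n\<close>
  intersect trivially. The chain decreases, so the maximum over the finitely many pairs works for
  all of them.\<close>

lemma separating_index:
  assumes S: "finite S" "S \<subseteq> carrier G"
  shows "\<exists>m\<ge>i. \<forall>g\<in>S. \<forall>h\<in>S. g \<otimes>\<^bsub>G\<^esub> inv\<^bsub>G\<^esub> h \<in> K m \<longrightarrow> g = h"
proof -
  have "\<exists>n. g \<otimes>\<^bsub>G\<^esub> inv\<^bsub>G\<^esub> h \<in> K n \<longrightarrow> g = h" if "g \<in> S" "h \<in> S" for g h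
  proof (rule ccontr)
    assume *: "\<not> ?thesis"
    then have "g \<otimes>\<^bsub>G\<^esub> inv\<^bsub>G\<^esub> h \<in> (\<Inter>n. K n)" by blast
    then have "g \<otimes>\<^bsub>G\<^esub> inv\<^bsub>G\<^esub> h = \<one>\<^bsub>G\<^esub>" using K_Inter by blast
    then have "g = h" using that S(2) by (metis G.inv_closed G.inv_equality G.inv_inv subsetD)
    then show False using * by blast
  qed
  then obtain n where n: "\<And>g h. g \<in> S \<Longrightarrow> h \<in> S \<Longrightarrow> g \<otimes>\<^bsub>G\<^esub> inv\<^bsub>G\<^esub> h \<in> K (n g h) \<Longrightarrow> g = h"
    by metis
  define m where "m = Max (insert i ((\<lambda>(g, h). n g h) ` (S \<times> S)))"
  have fin: "finite (insert i ((\<lambda>(g, h). n g h) ` (S \<times> S)))" using S(1) by simp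
  have "i \<le> m" unfolding m_def using fin by (intro Max_ge) auto
  moreover have "n g h \<le> m" if "g \<in> S" "h \<in> S" for g h
    unfolding m_def using fin that by (intro Max_ge) auto
  then have "g = h" if "g \<in> S" "h \<in> S" "g \<otimes>\<^bsub>G\<^esub> inv\<^bsub>G\<^esub> h \<in> K m" for g h
    using n K_antimono that by blast
  ultimately show ?thesis by blast
qed

lemma tower_inverse:
  assumes "j \<le> i" "x \<in> T i j" "x \<noteq> \<zero>"
  shows "\<exists>i'\<ge>i. inv x \<in> T i' j"
  using assms
proof (induction j arbitrary: x rule: inc_induct)
  case (base x)
  then obtain a where a: "a \<in> group_subring F G (K i)" "x = \<iota> a" by (auto simp: T_diag gimage_def)
  note aD = group_subringD[OF a(1)]
  define S where "S = {g \<in> carrier G. a g \<noteq> \<zero>\<^bsub>F\<^esub>}"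
  have S: "finite S" "S \<subseteq> carrier G" "S \<subseteq> K i" using aD(1,2) by (auto simp: S_def GR_carrier)
  have x: "x = (\<Oplus>g\<in>S. \<kappa> (a g) \<otimes> u g)"
    unfolding a(2) using aD(1) S by (intro \<iota>_eq_sum) (auto simp: S_def)
  \<comment> \<open>The element lives over \<open>K i\<close>, but its support may be separated only
    much further down; \<open>separated_inverse\<close> then covers the levels from \<open>i\<close>
    to \<open>m\<close>.\<close>
  obtain m where m: "m \<ge> i" "\<forall>g\<in>S. \<forall>h\<in>S. g \<otimes>\<^bsub>G\<^esub> inv\<^bsub>G\<^esub> h \<in> K m \<longrightarrow> g = h"
    using separating_index[OF S(1,2)] by blast
  have "inv x \<in> T m i"
    unfolding x using m S aD(3) base(2) x by (intro separated_inverse) auto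
  then show ?case using m(1) by blast
next
  case (step j x)
  interpret Q: linnell_subquotient F G D \<iota> "K j" "K (Suc j)" by (rule subquotient)
  have R: "coef_ring (K (Suc j)) (T n (Suc j))" if "n \<ge> i" for n
    using step.hyps that by (intro coef_ring_T) simp
  have "x \<in> invariant_series F G D \<iota> (K j) (K (Suc j)) (T i (Suc j))"
    using step.prems(1) step.hyps by (simp add: tower_step)
  from Q.invariant_series_inverse[OF R[OF order_refl] this step.prems(2)]
  obtain L where L: "finite L" "L \<subseteq> T i (Suc j) - {\<zero>}"
    "\<And>R'. coef_ring (K (Suc j)) R' \<Longrightarrow> T i (Suc j) \<subseteq> R' \<Longrightarrow> \<forall>t\<in>L. inv t \<in> R' \<Longrightarrow>
      inv x \<in> invariant_series F G D \<iota> (K j) (K (Suc j)) R'" by blast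
  have "\<exists>n\<ge>i. inv t \<in> T n (Suc j)" if "t \<in> L" for t using step.IH[of t] L(2) that by blast
  then obtain n where n: "\<And>t. t \<in> L \<Longrightarrow> i \<le> n t" "\<And>t. t \<in> L \<Longrightarrow> inv t \<in> T (n t) (Suc j)" by metis
  \<comment> \<open>Finiteness of the set \<open>L\<close> of leading coefficients yields one index
    for all of them, hence for all orders at once; including \<open>i\<close> keeps
    \<open>m \<ge> i\<close> when \<open>L\<close> is empty.\<close>
  define m where "m = Max (insert i (n ` L))"
  have im: "i \<le> m" unfolding m_def using L(1) by (intro Max_ge) auto
  have "n t \<le> m" if "t \<in> L" for t unfolding m_def using L(1) that by (intro Max_ge) auto
  then have "inv t \<in> T m (Suc j)" if "t \<in> L" for t
    using n[OF that] T_mono[of "Suc j" "n t" m] step.hyps that by auto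
  then have "inv x \<in> invariant_series F G D \<iota> (K j) (K (Suc j)) (T m (Suc j))"
    using L(3)[OF R[OF im]] T_mono[of "Suc j" i m] step.hyps im by auto
  then have "inv x \<in> T m j" using step.hyps im by (simp add: tower_step)
  then show ?case using im by blast
qed

text \<open>The union of the increasing rings is closed under inverses by
  \<open>tower_inverse\<close>, so it is a skew subfield containing the group ring, and minimality
  of \<open>D\<close> leaves nothing outside it.\<close>

lemma tower_union: "(\<Union>i. T i 0) = carrier D"
proof
  show "(\<Union>i. T i 0) \<subseteq> carrier D" using coef_ringD(5)[OF coef_ring_T] by blast
  have "skew_subfield (\<Union>i. T i 0) D"
    unfolding skew_subfield_def
  proof
    show "subring (\<Union>i. T i 0) D"
    proof (rule D.subringI)
      show "(\<Union>i. T i 0) \<subseteq> carrier D" using coef_ringD(5)[OF coef_ring_T] by blast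
      show "\<one> \<in> (\<Union>i. T i 0)" using coef_ringD(7)[OF coef_ring_T[of 0 0]] by blast
      show "\<ominus> x \<in> (\<Union>i. T i 0)" if "x \<in> (\<Union>i. T i 0)" for x
        using that coef_ringD(8)[OF coef_ring_T[of 0]] by blast
      fix x y assume "x \<in> (\<Union>i. T i 0)" "y \<in> (\<Union>i. T i 0)"
      then obtain i k where "x \<in> T i 0" "y \<in> T k 0" by blast
      then have xy: "x \<in> T (max i k) 0" "y \<in> T (max i k) 0"
        using T_mono[of 0 i "max i k"] T_mono[of 0 k "max i k"] by auto
      show "x \<otimes> y \<in> (\<Union>i. T i 0)" using coef_ringD(9)[OF coef_ring_T xy] by blast
      show "x \<oplus> y \<in> (\<Union>i. T i 0)" using coef_ringD(10)[OF coef_ring_T xy] by blast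
    qed
    show "\<forall>x\<in>(\<Union>i. T i 0) - {\<zero>}. inv x \<in> (\<Union>i. T i 0)"
      using tower_inverse[of 0] by blast
  qed
  moreover have "gimage (carrier G) \<subseteq> (\<Union>i. T i 0)" using T_diag[of 0] K_zero by auto
  ultimately have "clos (carrier G) \<subseteq> (\<Union>i. T i 0)" by (rule closure_least)
  then show "carrier D \<subseteq> (\<Union>i. T i 0)" using closure_top by simp
qed

end

theorem theorem5p1:
  fixes F :: "('f, 'm) ring_scheme"
    and G :: "('g, 'n) monoid_scheme"
    and D :: "('d, 'k) ring_scheme"
    and \<iota> :: "('g \<Rightarrow> 'f) \<Rightarrow> 'd"
    and K :: "nat \<Rightarrow> 'g set"
  assumes "field F" and "group G"
    and "K 0 = carrier G"
    and "\<And>i. K i \<lhd> G"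
    and "\<And>i. K (Suc i) \<subseteq> K i"
    and "(\<Inter>i. K i) = {\<one>\<^bsub>G\<^esub>}"
    and "\<And>i. orderable (quotient_group G (K i) (K (Suc i)))"
    and "\<And>i. amenable (quotient_group G (K i) (K (Suc i)))"
    and "linnell_skew_field F G D \<iota>"
  shows "(\<forall>i j. j \<le> i \<longrightarrow>
            subring (tower F G D \<iota> K i j) D \<and>
            tower F G D \<iota> K i j \<subseteq> sub_division_ring F G D \<iota> (K j)) \<and>
         tower F G D \<iota> K 0 0 = \<iota> ` carrier (group_ring F G) \<and>
         (\<forall>i. tower F G D \<iota> K i 0 \<subseteq> tower F G D \<iota> K (Suc i) 0) \<and>
         (\<Union>i. tower F G D \<iota> K i 0) = carrier D"
proof -
  have "skew_field D" using assms(9) by (simp add: linnell_skew_field_def)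
  then interpret linnell_chain F G D \<iota> K
    using assms by (simp add: linnell_chain_def linnell_chain_axioms_def linnell_ring_def
        linnell_ring_axioms_def)
  have "group_subring F G (carrier G) = carrier (group_ring F G)" by (auto simp: group_subring_def)
  then have "T 0 0 = \<iota> ` carrier (group_ring F G)" by (simp add: tower_diag K_zero)
  then show ?thesis
    using coef_ringD(1,3)[OF coef_ring_T] T_Suc[of 0] tower_union by blast
qed

end
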